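(* Let $n\ge 2$ and let $\operatorname{Exp}^{\otimes n}_\rho(\mathbf z)=\sum_{i\ge 0}Q_i\mathbf z^{(i)}$ ($\mathbf z\in\mathbb C_\infty^n$, $Q_i\in\operatorname{Mat}_n(\mathbb C_\infty)$, $Q_0=I$) be the exponential function of the $n$-th tensor power $\rho^{\otimes n}$. For $i\ge 0$ and $1\le \ell\le n$ put $$\gamma_{i,\ell}=\frac{g_\ell}{(f f^{(1)}\cdots f^{(i-1)})^n}\qquad(\gamma_{0,\ell}=g_\ell),$$ and let $C_i=(c_{\ell,k})_{1\le \ell,k\le n}$ be the matrix of the constants $c_{\ell,k}\in H$ for which there is a function $\alpha_\ell\in H(t,y)$ vanishing to order at least $n$ at $\Xi^{(i)}$ with $$\gamma_{i,\ell}=c_{\ell,1}g_1^{(i)}+c_{\ell,2}g_2^{(i)}+\cdots+c_{\ell,n}g_n^{(i)}+\alpha_\ell$$ (these constants are unique, since $g_k^{(i)}$ has order exactly $k-1$ at $\Xi^{(i)}$). Then for every $i\ge0$ we have $Q_i=C_i$; in particular $Q_i\in\operatorname{Mat}_n(H)$.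
   Context: Let $q$ be a prime power and $E/\mathbb F_q$ the elliptic curve $y^2+c_1ty+c_3y=t^3+c_2t^2+c_4t+c_6$ ($c_i\in\mathbb F_q$) with point at infinity $\infty$. Let $\mathbf A=\mathbb F_q[t,y]$ and let $A=\mathbb F_q[\theta,\eta]$ be an isomorphic copy ($\theta,\eta$ satisfy the same equation); $\iota:\mathbf A\to A$, $t\mapsto\theta$, $y\mapsto\eta$. Let $K=\mathbb F_q(\theta,\eta)$, $\deg=-\operatorname{ord}_\infty$ (so $\deg\theta=2,\deg\eta=3$), $|x|=q^{\deg x}$, $K_\infty$ the completion at $\infty$, $\mathbb C_\infty$ the completion of an algebraic closure of $K_\infty$, and $H\subset K_\infty$ the Hilbert class field of $K$. Put $\Xi=(\theta,\eta)\in E(K)$. For a field $L\supseteq\mathbb F_q$, nonzero elements of $L(t,y)$ have a leading term with respect to the monomials $t^i,t^jy$ (of distinct degrees), and $\widetilde{\operatorname{sgn}}$ denotes the leading coefficient (quotient of leading coefficients for rational functions). Frobenius twisting: for $g=\sum c_{jk}t^jy^k$ put $g^{(1)}=\sum c_{jk}^qt^jy^k$, extended to rational functions and entrywise to vectors and matrices; $g^{(i)}$ is the $i$-th iterate; for a point $X=(t_0,y_0)$, $X^{(1)}=(t_0^q,y_0^q)$. $[k]P$ is multiplication in the group law. Let $V=(\alpha,\beta)\in E(H)$ be the unique point whose coordinates have positive degree with $V-V^{(1)}=\Xi$ in the group law, and $f\in H(t,y)$ the unique function with $\widetilde{\operatorname{sgn}}(f)=1$ and divisor $(V^{(1)})-(V)+(\Xi)-(\infty)$.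 Fix $n$. For $1\le j\le n$ let $g_j\in H(t,y)$ be the function with $\widetilde{\operatorname{sgn}}(g_j)=1$ and divisor $-n(V)+(n-j)(\infty)+(j-1)(\Xi)+([j-1]V^{(1)}+[n-j+1]V)$. Tensor power: let $\tau$ act on $H(t,y)$ by $\tau(m)=f^nm^{(1)}$, and $c\tau^j\in H[\tau]$ by $m\mapsto c\,\tau^j(m)$. For every $a\in\mathbf A$ and $1\le i\le n$ there are unique $P_{ik}\in H[\tau]$ with $a g_i=\sum_{k=1}^nP_{ik}(g_k)$; $\rho^{\otimes n}_a$ is the matrix $(P_{ik})$, viewed as an element $\sum_jA_j\tau^j$ of $\operatorname{Mat}_n(H)[\tau]$ (with $\tau B=B^{(1)}\tau$), acting on $\mathbb C_\infty^n$ by $\mathbf z\mapsto\sum_jA_j\mathbf z^{(j)}$. This $\rho^{\otimes n}$ is an Anderson $\mathbf A$-module; $d[a]$ denotes the constant term of $\rho^{\otimes n}_a$ (it equals $\iota(a)I$ plus a nilpotent matrix). Its exponential $\operatorname{Exp}^{\otimes n}_\rho(\mathbf z)=\sum_{i\ge0}Q_i\mathbf z^{(i)}$, $Q_0=I$, is the unique such $\mathbb F_q$-linear entire power series with $\operatorname{Exp}^{\otimes n}_\rho(d[a]\mathbf z)=\rho^{\otimes n}_a(\operatorname{Exp}^{\otimes n}_\rho(\mathbf z))$ for all $a\in\mathbf A$. *)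

theory Defs
  imports
    "HOL-Computational_Algebra.Polynomial"
    "HOL-Library.Poly_Mapping"
    "Jordan_Normal_Form.Matrix"
begin

section \<open>Subfields of a field, abelian and unramified extensions\<close>

definition is_subfield :: "'a::field set \<Rightarrow> bool" where
  "is_subfield L \<longleftrightarrow> 0 \<in> L \<and> 1 \<in> L \<and>
     (\<forall>x\<in>L. \<forall>y\<in>L. x + y \<in> L \<and> x * y \<in> L) \<and> (\<forall>x\<in>L. - x \<in> L \<and> inverse x \<in> L)"

definition field_gen :: "'a::field set \<Rightarrow> 'a set" where
  "field_gen S = is_subfield hull S"

definition finite_dim_over :: "'a::field set \<Rightarrow> 'a set \<Rightarrow> bool" where
  "finite_dim_over K L \<longleftrightarrow>
     (\<exists>B. finite B \<and> B \<subseteq> L \<and> (\<forall>x\<in>L. \<exists>c. (\<forall>b\<in>B. c b \<in> K) \<and> x = (\<Sum>b\<in>B. c b * b)))"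

definition field_auts :: "'a::field set \<Rightarrow> 'a set \<Rightarrow> ('a \<Rightarrow> 'a) set" where
  "field_auts K L = {s. bij_betw s L L \<and> (\<forall>x\<in>K. s x = x) \<and>
     (\<forall>x\<in>L. \<forall>y\<in>L. s (x + y) = s x + s y \<and> s (x * y) = s x * s y)}"

definition finite_abelian_ext :: "'a::field set \<Rightarrow> 'a set \<Rightarrow> bool" where
  "finite_abelian_ext K L \<longleftrightarrow> is_subfield L \<and> K \<subseteq> L \<and> finite_dim_over K L \<and>
     {x\<in>L. \<forall>s\<in>field_auts K L. s x = x} = K \<and>
     (\<forall>s\<in>field_auts K L. \<forall>r\<in>field_auts K L. \<forall>x\<in>L. s (r x) = r (s x))"

definition normalized_valuation :: "'a::field set \<Rightarrow> ('a \<Rightarrow> int) \<Rightarrow> bool" where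
  "normalized_valuation L v \<longleftrightarrow>
     (\<forall>x\<in>L - {0}. \<forall>y\<in>L - {0}. v (x * y) = v x + v y \<and>
        (x + y \<noteq> 0 \<longrightarrow> min (v x) (v y) \<le> v (x + y))) \<and>
     (\<exists>x\<in>L - {0}. v x = 1)"

text \<open>Ramification index one at every place. The residue fields of a global function field are
  finite, so there is no separability condition on residue extensions.\<close>

definition unramified_ext :: "'a::field set \<Rightarrow> 'a set \<Rightarrow> bool" where
  "unramified_ext K L \<longleftrightarrow>
     (\<forall>v. normalized_valuation L v \<longrightarrow> (\<exists>x\<in>K - {0}. v x = 1))"

text \<open>The Hilbert class field of \<open>K\<close> with respect to \<open>\<infinity>\<close> is the maximal unramified abelian extension in
  which \<open>\<infinity>\<close> splits completely. For a Galois extension \<open>L\<close> of \<open>K\<close> inside the ambient field, \<open>\<infinity>\<close>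
  splits completely in \<open>L\<close> iff \<open>L \<subseteq> K\<^sub>\<infinity>\<close>.\<close>

definition hilbert_class_field :: "'a::field set \<Rightarrow> 'a set \<Rightarrow> 'a set \<Rightarrow> bool" where
  "hilbert_class_field K Kinf H \<longleftrightarrow>
     (finite_abelian_ext K H \<and> unramified_ext K H \<and> H \<subseteq> Kinf) \<and>
     (\<forall>L. finite_abelian_ext K L \<and> unramified_ext K L \<and> L \<subseteq> Kinf \<longrightarrow> L \<subseteq> H)"


section \<open>Weierstrass curves and the group law\<close>

record 'c weierstrass =
  wc1 :: 'c
  wc2 :: 'c
  wc3 :: 'c
  wc4 :: 'c
  wc6 :: 'c

datatype 'c point = Infinity | Affine 'c 'c

fun on_curve :: "'c::field weierstrass \<Rightarrow> 'c point \<Rightarrow> bool" where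
  "on_curve E Infinity \<longleftrightarrow> True"
| "on_curve E (Affine x y) \<longleftrightarrow>
     y^2 + wc1 E * x * y + wc3 E * y = x^3 + wc2 E * x^2 + wc4 E * x + wc6 E"

text \<open>Smoothness is tested on all points with coordinates in the ambient field, which will be
  algebraically closed; the point at infinity of a Weierstrass curve is always smooth.\<close>

definition elliptic_curve_over :: "'c::alg_closed_field set \<Rightarrow> 'c weierstrass \<Rightarrow> bool" where
  "elliptic_curve_over k E \<longleftrightarrow>
     {wc1 E, wc2 E, wc3 E, wc4 E, wc6 E} \<subseteq> k \<and>
     (\<forall>x y. on_curve E (Affine x y) \<longrightarrow>
        \<not> (wc1 E * y = 3 * x^2 + 2 * wc2 E * x + wc4 E \<and> 2 * y + wc1 E * x + wc3 E = 0))"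

fun ec_neg :: "'c::field weierstrass \<Rightarrow> 'c point \<Rightarrow> 'c point" where
  "ec_neg E Infinity = Infinity"
| "ec_neg E (Affine x y) = Affine x (- y - wc1 E * x - wc3 E)"

fun ec_add :: "'c::field weierstrass \<Rightarrow> 'c point \<Rightarrow> 'c point \<Rightarrow> 'c point" where
  "ec_add E Infinity P = P"
| "ec_add E P Infinity = P"
| "ec_add E (Affine x1 y1) (Affine x2 y2) =
     (if Affine x2 y2 = ec_neg E (Affine x1 y1) then Infinity
      else
        let l = (if x1 = x2
                 then (3 * x1^2 + 2 * wc2 E * x1 + wc4 E - wc1 E * y1) / (2 * y1 + wc1 E * x1 + wc3 E)
                 else (y2 - y1) / (x2 - x1));
            m = y1 - l * x1;
            x3 = l^2 + wc1 E * l - wc2 E - x1 - x2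
        in Affine x3 (- (l + wc1 E) * x3 - m - wc3 E))"

definition ec_diff :: "'c::field weierstrass \<Rightarrow> 'c point \<Rightarrow> 'c point \<Rightarrow> 'c point" where
  "ec_diff E P R = ec_add E P (ec_neg E R)"

definition ec_mult :: "'c::field weierstrass \<Rightarrow> nat \<Rightarrow> 'c point \<Rightarrow> 'c point" where
  "ec_mult E k P = (ec_add E P ^^ k) Infinity"

fun frob_point :: "nat \<Rightarrow> 'c::field point \<Rightarrow> 'c point" where
  "frob_point q Infinity = Infinity"
| "frob_point q (Affine x y) = Affine (x^q) (y^q)"


section \<open>Polynomial functions on the curve\<close>

text \<open>A pair \<open>(a, b)\<close> of univariate polynomials stands for \<open>a(t) + b(t) y\<close>; by the Weierstrass
  equation every polynomial in \<open>t, y\<close> has a unique such normal form. The monomials \<open>t^i\<close> and \<open>t^j y\<close>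
  have the pairwise distinct degrees \<open>2 i\<close> and \<open>2 j + 3\<close>.\<close>

type_synonym 'c polyfun = "'c poly \<times> 'c poly"

definition coeffs_in :: "'c::zero set \<Rightarrow> 'c polyfun \<Rightarrow> bool" where
  "coeffs_in L p \<longleftrightarrow> (\<forall>i. coeff (fst p) i \<in> L \<and> coeff (snd p) i \<in> L)"

definition pf_deg :: "'c::zero polyfun \<Rightarrow> nat" where
  "pf_deg p = max (2 * degree (fst p)) (if snd p = 0 then 0 else 2 * degree (snd p) + 3)"

definition pf_lead :: "'c::zero polyfun \<Rightarrow> 'c" where
  "pf_lead p = (if snd p \<noteq> 0 \<and> 2 * degree (fst p) < 2 * degree (snd p) + 3
                then lead_coeff (snd p) else lead_coeff (fst p))"

definition pf_value :: "'c::field polyfun \<Rightarrow> 'c \<Rightarrow> 'c \<Rightarrow> 'c" where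
  "pf_value p x y = poly (fst p) x + poly (snd p) x * y"

definition pf_twist :: "nat \<Rightarrow> 'c::field polyfun \<Rightarrow> 'c polyfun" where
  "pf_twist q p = (map_poly (\<lambda>c. c^q) (fst p), map_poly (\<lambda>c. c^q) (snd p))"


section \<open>The field \<open>K\<close>, its completion, and \<open>\<complex>\<^sub>\<infinity>\<close>\<close>

definition abs_limit :: "('c::field \<Rightarrow> real) \<Rightarrow> (nat \<Rightarrow> 'c) \<Rightarrow> 'c \<Rightarrow> bool" where
  "abs_limit absv s l \<longleftrightarrow> (\<lambda>k. absv (s k - l)) \<longlonglongrightarrow> 0"

definition abs_closure :: "('c::field \<Rightarrow> real) \<Rightarrow> 'c set \<Rightarrow> 'c set" where
  "abs_closure absv S = {x. \<forall>e>0. \<exists>s\<in>S. absv (x - s) < e}"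

definition nonarch_abs :: "('c::field \<Rightarrow> real) \<Rightarrow> bool" where
  "nonarch_abs absv \<longleftrightarrow>
     (\<forall>x. 0 \<le> absv x \<and> (absv x = 0 \<longleftrightarrow> x = 0)) \<and>
     (\<forall>x y. absv (x * y) = absv x * absv y \<and> absv (x + y) \<le> max (absv x) (absv y))"

definition abs_complete :: "('c::field \<Rightarrow> real) \<Rightarrow> bool" where
  "abs_complete absv \<longleftrightarrow>
     (\<forall>s. (\<forall>e>0. \<exists>N. \<forall>m\<ge>N. \<forall>k\<ge>N. absv (s m - s k) < e) \<longrightarrow> (\<exists>l. abs_limit absv s l))"

definition algebraic_over :: "'c::field set \<Rightarrow> 'c set" where
  "algebraic_over L = {x. \<exists>p. p \<noteq> 0 \<and> (\<forall>i. coeff p i \<in> L) \<and> poly p x = 0}"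

definition base_field :: "'c::field set \<Rightarrow> 'c \<Rightarrow> 'c \<Rightarrow> 'c set" where
  "base_field k \<theta> \<eta> = field_gen (k \<union> {\<theta>, \<eta>})"

definition K_infinity :: "('c::field \<Rightarrow> real) \<Rightarrow> 'c set \<Rightarrow> 'c \<Rightarrow> 'c \<Rightarrow> 'c set" where
  "K_infinity absv k \<theta> \<eta> = abs_closure absv (base_field k \<theta> \<eta>)"

text \<open>The ambient type is a model of \<open>\<complex>\<^sub>\<infinity>\<close>, which this predicate determines up to isometry over \<open>K\<close>:
  it is complete for an absolute value with \<open>|x| = q^(deg x)\<close> on \<open>A = k[\<theta>, \<eta>]\<close> (hence on \<open>K\<close>), the
  closure of \<open>K\<close> in it is the completion \<open>K\<^sub>\<infinity>\<close>, and the algebraic closure of \<open>K\<^sub>\<infinity>\<close> in it is dense.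
  That \<open>\<complex>\<^sub>\<infinity>\<close> is itself algebraically closed is recorded in the sort of the type. The third conjunct
  also says that \<open>k[\<theta>, \<eta>]\<close> satisfies no relations besides the Weierstrass equation.\<close>

definition is_C_infinity ::
  "('c::alg_closed_field \<Rightarrow> real) \<Rightarrow> 'c set \<Rightarrow> 'c weierstrass \<Rightarrow> 'c \<Rightarrow> 'c \<Rightarrow> bool" where
  "is_C_infinity absv k E \<theta> \<eta> \<longleftrightarrow>
     nonarch_abs absv \<and> on_curve E (Affine \<theta> \<eta>) \<and>
     (\<forall>p. p \<noteq> (0, 0) \<and> coeffs_in k p \<longrightarrow>
        absv (pf_value p \<theta> \<eta>) = real (card k) ^ pf_deg p) \<and>
     abs_complete absv \<and>
     abs_closure absv (algebraic_over (K_infinity absv k \<theta> \<eta>)) = UNIV"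

definition abs_deg :: "nat \<Rightarrow> ('c \<Rightarrow> real) \<Rightarrow> 'c \<Rightarrow> real" where
  "abs_deg q absv x = log (real q) (absv x)"


section \<open>The function field\<close>

text \<open>A field containing the constants, \<open>t\<close> and \<open>y\<close>. The last conjunct of \<open>function_field_of\<close> says that
  the subring generated by them is the coordinate ring, that is, the quotient of the bivariate
  polynomial ring by the Weierstrass equation; \<open>ratfuns F L\<close> is then \<open>L(t, y)\<close>. The ambient field
  may be larger than the field of rational functions.\<close>

record ('c, 'f) function_field =
  ff_const :: "'c \<Rightarrow> 'f"
  ff_t :: 'f
  ff_y :: 'f

definition pf_eval :: "('c::field, 'f::field) function_field \<Rightarrow> 'c polyfun \<Rightarrow> 'f" where
  "pf_eval F p = poly (map_poly (ff_const F) (fst p)) (ff_t F)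
               + poly (map_poly (ff_const F) (snd p)) (ff_t F) * ff_y F"

definition function_field_of ::
  "'c::field weierstrass \<Rightarrow> ('c, 'f::field) function_field \<Rightarrow> bool" where
  "function_field_of E F \<longleftrightarrow>
     ff_const F 1 = 1 \<and>
     (\<forall>x y. ff_const F (x + y) = ff_const F x + ff_const F y \<and>
            ff_const F (x * y) = ff_const F x * ff_const F y) \<and>
     ff_y F ^ 2 + ff_const F (wc1 E) * ff_t F * ff_y F + ff_const F (wc3 E) * ff_y F =
       ff_t F ^ 3 + ff_const F (wc2 E) * ff_t F ^ 2 + ff_const F (wc4 E) * ff_t F
         + ff_const F (wc6 E) \<and>
     (\<forall>p. pf_eval F p = 0 \<longrightarrow> p = (0, 0))"

definition regfuns :: "('c::field, 'f::field) function_field \<Rightarrow> 'c set \<Rightarrow> 'f set" where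
  "regfuns F L = {pf_eval F p | p. coeffs_in L p}"

definition ratfuns :: "('c::field, 'f::field) function_field \<Rightarrow> 'c set \<Rightarrow> 'f set" where
  "ratfuns F L = field_gen (ff_const F ` L \<union> {ff_t F, ff_y F})"

definition sgn_tilde :: "('c::field, 'f::field) function_field \<Rightarrow> 'f \<Rightarrow> 'c" where
  "sgn_tilde F h = (THE s. \<exists>p r. p \<noteq> (0, 0) \<and> r \<noteq> (0, 0) \<and> h = pf_eval F p / pf_eval F r \<and>
                            s = pf_lead p / pf_lead r)"

text \<open>The \<open>q\<close>-twist; reducing to normal form commutes with twisting because the Weierstrass
  coefficients lie in the field with \<open>q\<close> elements.\<close>

definition twist :: "nat \<Rightarrow> ('c::field, 'f::field) function_field \<Rightarrow> 'f \<Rightarrow> 'f" where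
  "twist q F h = (THE h'. \<exists>p r. r \<noteq> (0, 0) \<and> h = pf_eval F p / pf_eval F r \<and>
                            h' = pf_eval F (pf_twist q p) / pf_eval F (pf_twist q r))"

fun local_ring :: "('c::field, 'f::field) function_field \<Rightarrow> 'c point \<Rightarrow> 'f set" where
  "local_ring F (Affine x y) =
     {pf_eval F p / pf_eval F r | p r. pf_value r x y \<noteq> 0}"
| "local_ring F Infinity =
     {pf_eval F p / pf_eval F r | p r. r \<noteq> (0, 0) \<and> (p = (0, 0) \<or> pf_deg p \<le> pf_deg r)}"

fun local_max_ideal :: "('c::field, 'f::field) function_field \<Rightarrow> 'c point \<Rightarrow> 'f set" where
  "local_max_ideal F (Affine x y) =
     {pf_eval F p / pf_eval F r | p r. pf_value p x y = 0 \<and> pf_value r x y \<noteq> 0}"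
| "local_max_ideal F Infinity =
     {pf_eval F p / pf_eval F r | p r. r \<noteq> (0, 0) \<and> (p = (0, 0) \<or> pf_deg p < pf_deg r)}"

definition uniformizer :: "('c::field, 'f::field) function_field \<Rightarrow> 'c point \<Rightarrow> 'f \<Rightarrow> bool" where
  "uniformizer F P u \<longleftrightarrow> local_max_ideal F P = {u * h | h. h \<in> local_ring F P}"

text \<open>Meaningful for nonzero rational functions \<open>h\<close> and points \<open>P\<close> on the curve, where the local
  ring is a discrete valuation ring.\<close>

definition ord_at :: "('c::field, 'f::field) function_field \<Rightarrow> 'c point \<Rightarrow> 'f \<Rightarrow> int" where
  "ord_at F P h = (THE k. \<exists>u w. uniformizer F P u \<and> w \<noteq> 0 \<and>
                     w \<in> local_ring F P \<and> inverse w \<in> local_ring F P \<and> h = w * u powi k)"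

definition vanishes_to_order ::
  "('c::field, 'f::field) function_field \<Rightarrow> nat \<Rightarrow> 'c point \<Rightarrow> 'f \<Rightarrow> bool" where
  "vanishes_to_order F n P h \<longleftrightarrow> h = 0 \<or> int n \<le> ord_at F P h"

type_synonym 'c divisor = "'c point \<Rightarrow>\<^sub>0 int"

abbreviation pt :: "'c point \<Rightarrow> 'c divisor" where
  "pt P \<equiv> Poly_Mapping.single P 1"

abbreviation dmult :: "int \<Rightarrow> 'c point \<Rightarrow> 'c divisor" where
  "dmult k P \<equiv> Poly_Mapping.single P k"

definition has_divisor ::
  "'c::field weierstrass \<Rightarrow> ('c, 'f::field) function_field \<Rightarrow> 'f \<Rightarrow> 'c divisor \<Rightarrow> bool" where
  "has_divisor E F h D \<longleftrightarrow> h \<noteq> 0 \<and> Poly_Mapping.keys D \<subseteq> {P. on_curve E P} \<and>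
     (\<forall>P. on_curve E P \<longrightarrow> ord_at F P h = Poly_Mapping.lookup D P)"


section \<open>The shtuka function and the functions \<open>g\<^sub>j\<close>\<close>

definition drinfeld_point ::
  "('c::field \<Rightarrow> real) \<Rightarrow> nat \<Rightarrow> 'c weierstrass \<Rightarrow> 'c set \<Rightarrow> 'c point \<Rightarrow> 'c point \<Rightarrow> bool" where
  "drinfeld_point absv q E H \<Xi> V \<longleftrightarrow>
     (\<exists>\<alpha>\<in>H. \<exists>\<beta>\<in>H. V = Affine \<alpha> \<beta> \<and> 0 < abs_deg q absv \<alpha> \<and> 0 < abs_deg q absv \<beta>) \<and>
     on_curve E V \<and> ec_diff E V (frob_point q V) = \<Xi>"

definition shtuka_function ::
  "nat \<Rightarrow> 'c::field weierstrass \<Rightarrow> ('c, 'f::field) function_field \<Rightarrow> 'c set \<Rightarrow>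
   'c point \<Rightarrow> 'c point \<Rightarrow> 'f \<Rightarrow> bool" where
  "shtuka_function q E F H \<Xi> V f \<longleftrightarrow>
     f \<in> ratfuns F H \<and> sgn_tilde F f = 1 \<and>
     has_divisor E F f (pt (frob_point q V) - pt V + pt \<Xi> - pt Infinity)"

definition basis_function ::
  "nat \<Rightarrow> 'c::field weierstrass \<Rightarrow> ('c, 'f::field) function_field \<Rightarrow> 'c set \<Rightarrow>
   'c point \<Rightarrow> 'c point \<Rightarrow> nat \<Rightarrow> nat \<Rightarrow> 'f \<Rightarrow> bool" where
  "basis_function q E F H \<Xi> V n j h \<longleftrightarrow>
     h \<in> ratfuns F H \<and> sgn_tilde F h = 1 \<and>
     has_divisor E F h
       (dmult (- int n) V + dmult (int n - int j) Infinity + dmult (int j - 1) \<Xi>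
        + pt (ec_add E (ec_mult E (j - 1) (frob_point q V)) (ec_mult E (n - j + 1) V)))"


section \<open>The tensor power and its exponential function\<close>

text \<open>The underlying additive group of \<open>H[\<tau>]\<close> is represented by polynomials: the coefficient of
  index \<open>j\<close> of \<open>p :: 'c poly\<close> is the left coefficient of \<open>\<tau>^j\<close>. The family \<open>g\<close> is indexed from 1 to \<open>n\<close>,
  matrices and vectors from 0 to \<open>n - 1\<close>.\<close>

definition tau :: "nat \<Rightarrow> ('c::field, 'f::field) function_field \<Rightarrow> nat \<Rightarrow> 'f \<Rightarrow> 'f \<Rightarrow> 'f" where
  "tau q F n f m = f ^ n * twist q F m"

definition tau_act ::
  "nat \<Rightarrow> ('c::field, 'f::field) function_field \<Rightarrow> nat \<Rightarrow> 'f \<Rightarrow> 'c poly \<Rightarrow> 'f \<Rightarrow> 'f" where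
  "tau_act q F n f p m = (\<Sum>j\<le>degree p. ff_const F (coeff p j) * (tau q F n f ^^ j) m)"

definition tensor_relation ::
  "nat \<Rightarrow> ('c::field, 'f::field) function_field \<Rightarrow> 'c set \<Rightarrow> nat \<Rightarrow> 'f \<Rightarrow> (nat \<Rightarrow> 'f) \<Rightarrow>
   'f \<Rightarrow> 'c poly mat \<Rightarrow> bool" where
  "tensor_relation q F H n f g a P \<longleftrightarrow>
     P \<in> carrier_mat n n \<and>
     (\<forall>i<n. \<forall>k<n. \<forall>j. coeff (P $$ (i, k)) j \<in> H) \<and>
     (\<forall>i<n. a * g (Suc i) = (\<Sum>k<n. tau_act q F n f (P $$ (i, k)) (g (Suc k))))"

definition tensor_power ::
  "nat \<Rightarrow> ('c::field, 'f::field) function_field \<Rightarrow> 'c set \<Rightarrow> nat \<Rightarrow> 'f \<Rightarrow> (nat \<Rightarrow> 'f) \<Rightarrow>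
   'f \<Rightarrow> 'c poly mat" where
  "tensor_power q F H n f g a = (THE P. tensor_relation q F H n f g a P)"

definition tau_coeff :: "'c::field poly mat \<Rightarrow> nat \<Rightarrow> 'c mat" where
  "tau_coeff P j = map_mat (\<lambda>p. coeff p j) P"

definition tau_mat_act :: "nat \<Rightarrow> nat \<Rightarrow> 'c::field poly mat \<Rightarrow> 'c vec \<Rightarrow> 'c vec" where
  "tau_mat_act q n P z =
     vec n (\<lambda>i. \<Sum>k<n. \<Sum>j\<le>degree (P $$ (i, k)). coeff (P $$ (i, k)) j * (z $ k) ^ (q ^ j))"

definition frob_series_sums ::
  "('c::field \<Rightarrow> real) \<Rightarrow> nat \<Rightarrow> nat \<Rightarrow> (nat \<Rightarrow> 'c mat) \<Rightarrow> 'c vec \<Rightarrow> 'c vec \<Rightarrow> bool" where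
  "frob_series_sums absv q n Q z w \<longleftrightarrow> w \<in> carrier_vec n \<and>
     (\<forall>r<n. abs_limit absv
        (\<lambda>N. \<Sum>i<N. (Q i *\<^sub>v map_vec (\<lambda>x. x ^ (q ^ i)) z) $ r) (w $ r))"

text \<open>\<open>R a\<close> is the twisted matrix polynomial by which \<open>a\<close> acts, and \<open>tau_coeff (R a) 0\<close> is \<open>d[a]\<close>.\<close>

definition is_exponential ::
  "('c::field \<Rightarrow> real) \<Rightarrow> nat \<Rightarrow> nat \<Rightarrow> 'f set \<Rightarrow> ('f \<Rightarrow> 'c poly mat) \<Rightarrow> (nat \<Rightarrow> 'c mat) \<Rightarrow> bool"
where
  "is_exponential absv q n A R Q \<longleftrightarrow>
     (\<forall>i. Q i \<in> carrier_mat n n) \<and> Q 0 = 1\<^sub>m n \<and>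
     (\<forall>z\<in>carrier_vec n. \<exists>w. frob_series_sums absv q n Q z w) \<and>
     (\<forall>a\<in>A. \<forall>z\<in>carrier_vec n. \<forall>w. frob_series_sums absv q n Q z w \<longrightarrow>
        frob_series_sums absv q n Q (tau_coeff (R a) 0 *\<^sub>v z) (tau_mat_act q n (R a) w))"


section \<open>The matrices \<open>C\<^sub>i\<close>\<close>

definition gamma_fun ::
  "nat \<Rightarrow> ('c::field, 'f::field) function_field \<Rightarrow> nat \<Rightarrow> 'f \<Rightarrow> (nat \<Rightarrow> 'f) \<Rightarrow> nat \<Rightarrow> nat \<Rightarrow> 'f" where
  "gamma_fun q F n f g i l = g l / (\<Prod>j<i. (twist q F ^^ j) f) ^ n"

definition expansion_relation ::
  "nat \<Rightarrow> ('c::field, 'f::field) function_field \<Rightarrow> 'c set \<Rightarrow> 'c point \<Rightarrow> nat \<Rightarrow> 'f \<Rightarrow> (nat \<Rightarrow> 'f) \<Rightarrow>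
   nat \<Rightarrow> 'c mat \<Rightarrow> bool" where
  "expansion_relation q F H \<Xi> n f g i M \<longleftrightarrow>
     M \<in> carrier_mat n n \<and> (\<forall>l<n. \<forall>k<n. M $$ (l, k) \<in> H) \<and>
     (\<forall>l<n. \<exists>\<alpha>\<in>ratfuns F H. vanishes_to_order F n (frob_point (q ^ i) \<Xi>) \<alpha> \<and>
        gamma_fun q F n f g i (Suc l) =
          (\<Sum>k<n. ff_const F (M $$ (l, k)) * (twist q F ^^ i) (g (Suc k))) + \<alpha>)"

definition C_matrix ::
  "nat \<Rightarrow> ('c::field, 'f::field) function_field \<Rightarrow> 'c set \<Rightarrow> 'c point \<Rightarrow> nat \<Rightarrow> 'f \<Rightarrow> (nat \<Rightarrow> 'f) \<Rightarrow>
   nat \<Rightarrow> 'c mat" where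
  "C_matrix q F H \<Xi> n f g i = (THE M. expansion_relation q F H \<Xi> n f g i M)"

end

(* The proof avoids the group law entirely and works with orders of vanishing.

   Multiplication by t on g_1, ..., g_n is expressed through tau; every tau-image vanishes to order n
   at Xi, and g_k has order k - 1 there, so d[t] is upper triangular with diagonal theta. Dividing
   the relation for t by (f f^(1) ... f^(i-1))^n and expanding at Xi^(i) modulo order n shows that
   the matrices C_i satisfy C_i d[t]^(i) = sum_{j <= i} A_j C_{i-j}^(j), which is the recursion that the
   functional equation of the exponential imposes on the Q_i. Since theta^(q^i) <> theta for i > 0,
   the Sylvester operator X |-> X d[t]^(i) - d[t] X is injective, so both sequences agree.

   The order of g_k at Xi could a priori exceed k - 1, if the last point of its divisor were Xi. This
   really happens (for q = 4, Frobenius = -2, n = 3 one has [3]V = Xi), but then the g_k do not give a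
   tensor relation with unique coefficients. *)

theory Submission
  imports Defs
begin

section \<open>Subfields\<close>

text \<open>The points in the divisors have to be told apart from \<Xi> without the group law. The
  tool is that no function has a simple pole at infinity as its only pole: a function without affine
  poles is a polynomial in t and y, and such polynomials never have degree 1. This gives V \<noteq>
  \<Xi>. A last point equal to \<Xi> contradicts the uniqueness of the tensor relation for g_1, ...,
  g_(n-1), and its existence for g_n. Whether V is a twist of \<Xi> is left open: the divisor of f
  f^(1) ... f^(i-1) telescopes, so that a pole of g_l at \<Xi>^(i) would cancel in \<gamma>_(i,l).

  Orders, twists and the matrices are definite descriptions, so each needs existence and uniqueness.
  For orders, the local rings are treated by an explicit division by a uniformizer. This division
  keeps track of a coefficient field L, since the constants of the expansions must lie in H although
  divisors are tested over an algebraically closed field. Finally, |\<theta>| = q^2 > 1 is the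
  source of \<theta>^(q^i) \<noteq> \<theta>, and the recursion for Q_i comes from comparing
  coefficients of series in Frobenius powers.\<close>

lemma is_subfieldD:
  assumes "is_subfield L"
  shows "0 \<in> L" "1 \<in> L" "x \<in> L \<Longrightarrow> y \<in> L \<Longrightarrow> x + y \<in> L" "x \<in> L \<Longrightarrow> y \<in> L \<Longrightarrow> x * y \<in> L"
    "x \<in> L \<Longrightarrow> - x \<in> L" "x \<in> L \<Longrightarrow> inverse x \<in> L"
  using assms by (auto simp: is_subfield_def)

lemma is_subfield_diff: "is_subfield L \<Longrightarrow> x \<in> L \<Longrightarrow> y \<in> L \<Longrightarrow> x - y \<in> L"
  using is_subfieldD(3)[of L x "- y"] is_subfieldD(5)[of L y] by simp

lemma is_subfield_divide: "is_subfield L \<Longrightarrow> x \<in> L \<Longrightarrow> y \<in> L \<Longrightarrow> x / y \<in> L"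
  by (simp add: divide_inverse is_subfieldD(4,6))

lemma is_subfield_power: "is_subfield L \<Longrightarrow> x \<in> L \<Longrightarrow> x ^ m \<in> L"
  by (induction m) (auto intro: is_subfieldD)

lemma is_subfield_sum: "is_subfield L \<Longrightarrow> (\<And>i. i \<in> I \<Longrightarrow> h i \<in> L) \<Longrightarrow> sum h I \<in> L"
  by (induction I rule: infinite_finite_induct) (auto intro: is_subfieldD)

lemma is_subfield_prod: "is_subfield L \<Longrightarrow> (\<And>i. i \<in> I \<Longrightarrow> h i \<in> L) \<Longrightarrow> prod h I \<in> L"
  by (induction I rule: infinite_finite_induct) (auto intro: is_subfieldD)

lemma is_subfield_UNIV [simp]: "is_subfield UNIV"
  by (simp add: is_subfield_def)

lemma is_subfield_field_gen: "is_subfield (field_gen S)"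
  unfolding field_gen_def
  by (rule hull_in) (unfold is_subfield_def, blast)

lemma field_gen_superset: "S \<subseteq> field_gen S"
  unfolding field_gen_def by (rule hull_subset)

lemma field_gen_minimal: "S \<subseteq> L \<Longrightarrow> is_subfield L \<Longrightarrow> field_gen S \<subseteq> L"
  unfolding field_gen_def by (rule hull_minimal)

text \<open>Multiplication by a nonzero \<open>a\<close> permutes the nonzero elements of
  \<open>k\<close>; comparing the products over them gives
  \<open>a ^ (card k - 1) = 1\<close>.\<close>

lemma power_card_subfield:
  fixes k :: "'a::field set"
  assumes k: "is_subfield k" "finite k" and a: "a \<in> k"
  shows "a ^ card k = a"
proof (cases "a = 0")
  case True
  have "card k > 0" using k a by (auto simp: card_gt_0_iff)
  with True show ?thesis by simp
next
  case False
  let ?U = "k - {0}"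
  have "bij_betw ((*) a) ?U ?U"
  proof (rule bij_betwI[where g = "\<lambda>x. inverse a * x"])
    show "(*) a \<in> ?U \<rightarrow> ?U" "(*) (inverse a) \<in> ?U \<rightarrow> ?U"
      using False a is_subfieldD[OF k(1)] by auto
  qed (use False in \<open>auto simp: field_simps\<close>)
  then have "prod id ?U = (\<Prod>x\<in>?U. a * x)"
    using prod.reindex_bij_betw[of "(*) a" ?U ?U id] by simp
  also have "\<dots> = a ^ card ?U * prod id ?U"
    by (simp add: prod.distrib)
  finally have "(a ^ card ?U - 1) * prod id ?U = 0" by (simp add: algebra_simps)
  moreover have "prod id ?U \<noteq> 0" using k by simp
  ultimately have "a ^ card ?U = 1" by simp
  moreover have "card k = Suc (card ?U)"
    using k is_subfieldD(1)[OF k(1)] by (metis card_Suc_Diff1)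
  ultimately show ?thesis by simp
qed

text \<open>The polynomial \<open>(1 + X)^q - 1 - X^q\<close> has degree less than \<open>q\<close> and vanishes at all \<open>q\<close>
  elements of \<open>k\<close>, so it is zero.\<close>

lemma frobenius_add:
  fixes k :: "'a::field set"
  assumes k: "is_subfield k" "finite k"
  shows "(x + y) ^ card k = x ^ card k + (y::'a) ^ card k"
proof -
  define q where "q = card k"
  have q: "q > 0" unfolding q_def using k is_subfieldD(1)[OF k(1)] by (auto simp: card_gt_0_iff)
  define p :: "'a poly" where "p = [:1, 1:] ^ q - 1 - monom 1 q"
  have "p = 0"
  proof (rule ccontr)
    assume p: "p \<noteq> 0"
    have "degree p < q"
    proof -
      have "degree p \<le> q"
        unfolding p_def
        by (intro degree_diff_le) (auto simp: degree_power_eq degree_monom_le)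
      moreover have "coeff p q = 0"
        using q by (simp add: p_def coeff_linear_power)
      ultimately show ?thesis using p
        by (metis le_neq_implies_less leading_coeff_0_iff)
    qed
    moreover have "k \<subseteq> {x. poly p x = 0}"
    proof
      fix a assume "a \<in> k"
      then have "a ^ q = a" "(1 + a) ^ q = 1 + a"
        unfolding q_def using k by (auto intro!: power_card_subfield is_subfieldD)
      then show "a \<in> {x. poly p x = 0}" by (simp add: p_def poly_power poly_monom)
    qed
    then have "q \<le> degree p"
      unfolding q_def
      using card_mono[OF poly_roots_finite[OF p], of k] card_poly_roots_bound[OF p] by linarith
    ultimately show False by simp
  qed
  have one: "(1 + a) ^ q = 1 + a ^ q" for a :: 'a
  proof -
    have "poly p a = 0" using \<open>p = 0\<close> by simp
    then show ?thesis by (simp add: p_def poly_power poly_monom algebra_simps)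
  qed
  show ?thesis
  proof (cases "x = 0")
    case True
    then show ?thesis using q by (simp add: q_def)
  next
    case False
    then have "x + y = x * (1 + y / x)" by (simp add: field_simps)
    then have "(x + y) ^ q = (x * (1 + y / x)) ^ q" by (rule arg_cong)
    also have "\<dots> = x ^ q * (1 + (y / x) ^ q)" by (simp only: power_mult_distrib one)
    also have "\<dots> = x ^ q + y ^ q" using False by (simp add: field_simps power_divide)
    finally show ?thesis by (simp add: q_def)
  qed
qed

section \<open>The coordinate ring\<close>

text \<open>With L = \<open>pf_L E\<close> and G = \<open>pf_G E\<close>, polynomials in t, the
  Weierstrass equation reads y^2 + L y = G.\<close>

definition pf_L :: "'c::field weierstrass \<Rightarrow> 'c poly" where
  "pf_L E = [:wc3 E, wc1 E:]"

definition pf_G :: "'c::field weierstrass \<Rightarrow> 'c poly" where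
  "pf_G E = [:wc6 E, wc4 E, wc2 E, 1:]"

text \<open>The product in the coordinate ring, brought to normal form by y^2 = G - L y.\<close>

definition pf_mul :: "'c::field weierstrass \<Rightarrow> 'c polyfun \<Rightarrow> 'c polyfun \<Rightarrow> 'c polyfun" where
  "pf_mul E p r = (fst p * fst r + snd p * snd r * pf_G E,
                   fst p * snd r + snd p * fst r - snd p * snd r * pf_L E)"

text \<open>The substitution y |-> - y - L, that is, the involution of the curve over the t-line.
  The product of \<open>p\<close> with it is the norm \<open>pf_norm\<close> down to polynomials in
  t.\<close>

definition pf_conj :: "'c::field weierstrass \<Rightarrow> 'c polyfun \<Rightarrow> 'c polyfun" where
  "pf_conj E p = (fst p - snd p * pf_L E, - snd p)"

definition pf_norm :: "'c::field weierstrass \<Rightarrow> 'c polyfun \<Rightarrow> 'c poly" where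
  "pf_norm E p = fst p ^ 2 - fst p * snd p * pf_L E - snd p ^ 2 * pf_G E"

definition wc_in :: "'c set \<Rightarrow> 'c weierstrass \<Rightarrow> bool" where
  "wc_in L E \<longleftrightarrow> {wc1 E, wc2 E, wc3 E, wc4 E, wc6 E} \<subseteq> L"

definition poly_in :: "'c::zero set \<Rightarrow> 'c poly \<Rightarrow> bool" where
  "poly_in L a \<longleftrightarrow> (\<forall>i. coeff a i \<in> L)"

lemma coeffs_in_iff: "coeffs_in L p \<longleftrightarrow> poly_in L (fst p) \<and> poly_in L (snd p)"
  by (auto simp: coeffs_in_def poly_in_def)

lemma poly_in_pCons [simp]: "poly_in L (pCons c a) \<longleftrightarrow> c \<in> L \<and> poly_in L a"
  unfolding poly_in_def by (auto simp: coeff_pCons split: nat.splits)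

lemma poly_in_UNIV [simp]: "poly_in UNIV a"
  by (simp add: poly_in_def)

lemma coeffs_in_UNIV [simp]: "coeffs_in UNIV a"
  by (simp add: coeffs_in_def)

lemma poly_in_ring:
  assumes "is_subfield L"
  shows "poly_in L 0" "poly_in L 1"
    "poly_in L a \<Longrightarrow> poly_in L b \<Longrightarrow> poly_in L (a + b)"
    "poly_in L a \<Longrightarrow> poly_in L b \<Longrightarrow> poly_in L (a * b)"
    "poly_in L a \<Longrightarrow> poly_in L b \<Longrightarrow> poly_in L (a - b)"
    "poly_in L a \<Longrightarrow> poly_in L (- a)"
  using assms
  by (auto simp: poly_in_def coeff_mult one_pCons coeff_pCons split: nat.splits
      intro!: is_subfieldD is_subfield_diff is_subfield_sum)

lemma poly_in_poly:
  assumes "is_subfield L" "poly_in L a" "x \<in> L"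
  shows "poly a x \<in> L"
  using assms by (auto simp: poly_altdef poly_in_def intro!: is_subfield_sum is_subfieldD is_subfield_power)

lemma poly_in_synthetic_div:
  assumes L: "is_subfield L" and "poly_in L a" "x \<in> L"
  shows "poly_in L (synthetic_div a x)"
  using assms(2)
proof (induction a)
  case (pCons c a)
  then show ?case using poly_in_poly[OF L _ assms(3)] by auto
qed (simp add: poly_in_ring[OF L])

lemma poly_in_LG: "is_subfield L \<Longrightarrow> wc_in L E \<Longrightarrow> poly_in L (pf_L E) \<and> poly_in L (pf_G E)"
  by (auto simp: pf_L_def pf_G_def wc_in_def poly_in_ring is_subfieldD)

lemma coeffs_in_mul:
  "is_subfield L \<Longrightarrow> wc_in L E \<Longrightarrow> coeffs_in L p \<Longrightarrow> coeffs_in L r \<Longrightarrow> coeffs_in L (pf_mul E p r)"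
  using poly_in_LG[of L E] by (auto simp: coeffs_in_iff pf_mul_def intro!: poly_in_ring)

lemma pf_value_in:
  "is_subfield L \<Longrightarrow> coeffs_in L p \<Longrightarrow> x \<in> L \<Longrightarrow> y \<in> L \<Longrightarrow> pf_value p x y \<in> L"
  by (auto simp: pf_value_def coeffs_in_iff intro!: is_subfieldD poly_in_poly)

lemma pf_mul_conj: "pf_mul E p (pf_conj E p) = (pf_norm E p, 0)"
  by (simp add: pf_mul_def pf_conj_def pf_norm_def algebra_simps power2_eq_square)

lemma pf_norm_mul: "pf_norm E (pf_mul E p r) = pf_norm E p * pf_norm E r"
  by (simp add: pf_mul_def pf_norm_def algebra_simps power2_eq_square)

lemma pf_mul_assoc: "pf_mul E (pf_mul E p r) s = pf_mul E p (pf_mul E r s)"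
  by (simp add: pf_mul_def algebra_simps)

lemma pf_value_mul:
  assumes "on_curve E (Affine x y)"
  shows "pf_value (pf_mul E p r) x y = pf_value p x y * pf_value r x y"
proof -
  have "poly (pf_G E) x = y^2 + poly (pf_L E) x * y"
    using assms by (simp add: pf_G_def pf_L_def algebra_simps power2_eq_square power3_eq_cube)
  then show ?thesis
    by (simp add: pf_value_def pf_mul_def algebra_simps power2_eq_square)
qed

lemma degree_pf_G: "degree (pf_G E) = 3" and degree_pf_L: "degree (pf_L E) \<le> 1"
  by (simp_all add: pf_G_def pf_L_def)

text \<open>For p = a + b y the terms a^2 and b^2 G of the norm have even and odd degree, so they
  cannot cancel. The mixed term a b L has degree at most deg a + deg b + 1, less than the mean deg a
  + deg b + 3/2 of the other two degrees. The norm therefore makes \<open>pf_deg\<close> additive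
  and the coordinate ring a domain.\<close>

lemma degree_pf_norm:
  assumes "p \<noteq> (0, 0)"
  shows "pf_norm E p \<noteq> 0 \<and> degree (pf_norm E p) = pf_deg p"
proof -
  obtain a b where p: "p = (a, b)" by (cases p)
  have G0: "pf_G E \<noteq> 0" by (simp add: pf_G_def)
  have N: "pf_norm E p = a^2 - a * b * pf_L E - b^2 * pf_G E" by (simp add: pf_norm_def p)
  show ?thesis
  proof (cases "b = 0")
    case True
    with assms have "a \<noteq> 0" by (simp add: p)
    with True show ?thesis unfolding N by (simp add: pf_deg_def p degree_power_eq)
  next
    case b: False
    have dG: "degree (b^2 * pf_G E) = 2 * degree b + 3"
      using b G0 by (simp add: degree_mult_eq degree_power_eq degree_pf_G)
    have dL: "degree (a * b * pf_L E) \<le> degree a + degree b + 1"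
      using degree_mult_le[of "a * b" "pf_L E"] degree_mult_le[of a b] degree_pf_L[of E] by linarith
    have da: "degree (a^2) = 2 * degree a"
      by (cases "a = 0") (auto simp: degree_power_eq)
    show ?thesis
    proof (cases "2 * degree a > 2 * degree b + 3")
      case True
      then have "degree (a * b * pf_L E + b^2 * pf_G E) < degree (a^2)"
        using dG dL da by (intro degree_add_less) auto
      moreover have "pf_norm E p = a^2 + - (a * b * pf_L E + b^2 * pf_G E)" by (simp add: N)
      ultimately have "degree (pf_norm E p) = 2 * degree a"
        using da degree_add_eq_left by (metis degree_minus)
      then show ?thesis using True b by (auto simp: pf_deg_def p)
    next
      case False
      then have lt: "2 * degree a < 2 * degree b + 3" by presburger
      then have "degree (a^2 - a * b * pf_L E) < degree (b^2 * pf_G E)"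
        using dG dL da by (intro degree_diff_less) auto
      moreover have "pf_norm E p = (a^2 - a * b * pf_L E) + - (b^2 * pf_G E)" by (simp add: N)
      ultimately have "degree (pf_norm E p) = 2 * degree b + 3"
        using dG degree_add_eq_right by (metis degree_minus)
      then show ?thesis using lt b by (auto simp: pf_deg_def p)
    qed
  qed
qed

lemma pf_norm_eq_0_iff: "pf_norm E p = 0 \<longleftrightarrow> p = (0, 0)"
  using degree_pf_norm[of p E] by (auto simp: pf_norm_def)

lemma pf_mul_eq_0_iff: "pf_mul E p r = (0, 0) \<longleftrightarrow> p = (0, 0) \<or> r = (0, 0)"
  using pf_norm_eq_0_iff[of E] by (metis mult_eq_0_iff pf_norm_mul)

lemma pf_deg_mul:
  assumes "p \<noteq> (0, 0)" "r \<noteq> (0, 0)"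
  shows "pf_deg (pf_mul E p r) = pf_deg p + pf_deg r"
proof -
  have "pf_mul E p r \<noteq> (0, 0)" using assms by (simp add: pf_mul_eq_0_iff)
  then have "pf_deg (pf_mul E p r) = degree (pf_norm E p * pf_norm E r)"
    using degree_pf_norm[of "pf_mul E p r" E] by (simp add: pf_norm_mul)
  also have "\<dots> = pf_deg p + pf_deg r"
    using degree_pf_norm[of p E] degree_pf_norm[of r E] assms by (simp add: degree_mult_eq)
  finally show ?thesis .
qed

text \<open>The degrees are even or at least 3. This is the Weierstrass gap of a curve of genus one
  at infinity.\<close>

lemma pf_deg_neq_1: "pf_deg p \<noteq> 1"
proof -
  have "pf_deg p = 2 * degree (fst p) \<or> pf_deg p = 2 * degree (snd p) + 3"
    by (simp add: pf_deg_def max_def)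
  then show ?thesis by presburger
qed

section \<open>Independence of the order from the chosen uniformizer\<close>

lemma ord_at_eqI:
  assumes sub: "local_max_ideal F P \<subseteq> local_ring F P"
    and one: "1 \<in> local_ring F P" "1 \<notin> local_max_ideal F P"
    and mult: "\<And>a b. a \<in> local_ring F P \<Longrightarrow> b \<in> local_ring F P \<Longrightarrow> a * b \<in> local_ring F P"
    and u: "uniformizer F P u" "u \<noteq> 0"
    and w: "w \<noteq> 0" "w \<in> local_ring F P" "inverse w \<in> local_ring F P"
    and h: "h = w * u powi k"
  shows "ord_at F P h = k"
  unfolding ord_at_def
proof (rule the_equality)
  show "\<exists>u w. uniformizer F P u \<and> w \<noteq> 0 \<and> w \<in> local_ring F P \<and> inverse w \<in> local_ring F P \<and>
          h = w * u powi k"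
    using u w h by blast
next
  fix k' assume "\<exists>u w. uniformizer F P u \<and> w \<noteq> 0 \<and> w \<in> local_ring F P \<and>
     inverse w \<in> local_ring F P \<and> h = w * u powi k'"
  then obtain u' w' where u': "uniformizer F P u'" and w': "w' \<noteq> 0" "w' \<in> local_ring F P"
    "inverse w' \<in> local_ring F P" and h': "h = w' * u' powi k'" by blast
  let ?O = "local_ring F P"
  have mem: "v \<in> local_max_ideal F P" if "uniformizer F P v" for v
    using that one(1) mult_1_right[of v] unfolding uniformizer_def
    by (metis (mono_tags, lifting) mem_Collect_eq)
  note uO = mem[OF u(1)]
  from mem[OF u(1)] mem[OF u'(1)] obtain a b where ab: "a \<in> ?O" "b \<in> ?O" "u' = u * a" "u = u' * b"
    using u(1) u'(1) unfolding uniformizer_def by blast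
  have "u * (a * b) = u * 1" using ab(3,4) by (metis mult.assoc mult_1_right)
  then have ab1: "a * b = 1" using u(2) by (metis mult_left_cancel)
  then have inv_a: "inverse a = b" by (rule inverse_unique)
  have "a \<noteq> 0" using ab1 by auto
  have pow: "x \<in> ?O \<Longrightarrow> x ^ m \<in> ?O" for x m
    by (induction m) (auto intro: one mult)
  have powi_a: "a powi j \<in> ?O" for j
    using pow ab(1,2) by (auto simp: power_int_def inv_a)
  \<comment> \<open>If \<open>u ^ m\<close> were a unit, 1 would be a multiple of \<open>u\<close>
    in the local ring and hence lie in the maximal ideal.\<close>
  have no_unit: False if "m > 0" "inverse (u ^ m) \<in> ?O" for m :: nat
  proof -
    obtain j where m: "m = Suc j" using \<open>m > 0\<close> gr0_conv_Suc by blast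
    have "u ^ j * inverse (u ^ m) \<in> ?O"
      using that(2) uO sub by (intro mult pow) auto
    moreover have "1 = u * (u ^ j * inverse (u ^ m))"
      using u(2) by (simp add: m field_simps)
    ultimately show False using u(1) one(2) unfolding uniformizer_def by blast
  qed
  have "w * u powi k = w' * (a powi k' * u powi k')"
    using h h' ab(3) by (simp add: power_int_mult_distrib mult_ac)
  then have eq: "u powi (k - k') = inverse w * w' * a powi k'"
    using u(2) w(1) by (simp add: power_int_diff field_simps)
  then have "u powi (k' - k) = w * inverse w' * a powi (- k')"
    using power_int_minus[of u "k - k'"] by (simp add: power_int_minus mult_ac)
  then have 1: "u powi (k - k') \<in> ?O" "u powi (k' - k) \<in> ?O"
    using eq w w' powi_a by (auto intro!: mult)
  show "k' = k"
  proof (rule linorder_cases[of k k'])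
    assume "k < k'"
    then show ?thesis using 1(1) no_unit[of "nat (k' - k)"] by (simp add: power_int_def power_inverse)
  next
    assume "k' < k"
    then show ?thesis using 1(2) no_unit[of "nat (k - k')"] by (simp add: power_int_def power_inverse)
  qed auto
qed

locale curve_field =
  fixes E :: "'c::alg_closed_field weierstrass" and F :: "('c, 'f::field) function_field"
  assumes ff: "function_field_of E F"
    and smooth: "on_curve E (Affine x y) \<Longrightarrow>
      \<not> (wc1 E * y = 3 * x^2 + 2 * wc2 E * x + wc4 E \<and> 2 * y + wc1 E * x + wc3 E = 0)"
begin

abbreviation "const \<equiv> ff_const F"
abbreviation "ev \<equiv> pf_eval F"
abbreviation "T \<equiv> ff_t F"
abbreviation "Y \<equiv> ff_y F"

lemma const_1 [simp]: "const 1 = 1"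
  and const_add: "const (a + b) = const a + const b"
  and const_mult: "const (a * b) = const a * const b"
  and weierstrass_eq: "Y^2 + const (wc1 E) * T * Y + const (wc3 E) * Y =
       T^3 + const (wc2 E) * T^2 + const (wc4 E) * T + const (wc6 E)"
  and ev_inj_0: "ev p = 0 \<Longrightarrow> p = (0, 0)"
  using ff unfolding function_field_of_def by blast+

lemma const_0 [simp]: "const 0 = 0"
  using const_add[of 0 0] by (metis add_0 add_cancel_right_left)

lemma const_minus: "const (- a) = - const a"
  using const_add[of a "- a"] by (simp add: eq_neg_iff_add_eq_0 add.commute)

lemma const_diff: "const (a - b) = const a - const b"
  using const_add[of a "- b"] by (simp add: const_minus)

lemma const_power: "const (a ^ m) = const a ^ m"
  by (induction m) (auto simp: const_mult)

lemma const_sum: "const (sum h I) = (\<Sum>i\<in>I. const (h i))"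
  by (induction I rule: infinite_finite_induct) (auto simp: const_add)

lemma const_numeral [simp]: "const (numeral m) = numeral m"
proof -
  have "const (of_nat i) = of_nat i" for i
    by (induction i) (auto simp: const_add)
  from this[of "numeral m"] show ?thesis by simp
qed

lemma const_eq_0_iff [simp]: "const a = 0 \<longleftrightarrow> a = 0"
proof
  assume "const a = 0"
  then have "a \<noteq> 0 \<Longrightarrow> const 1 = 0"
    using const_mult[of a "inverse a"] by simp
  then show "a = 0" by auto
qed simp

lemma const_inverse: "const (inverse a) = inverse (const a)"
proof (cases "a = 0")
  case False
  then have "const a * const (inverse a) = 1" by (simp flip: const_mult)
  then show ?thesis by (metis inverse_unique)
qed simp

definition pc :: "'c poly \<Rightarrow> 'f" where
  "pc a = poly (map_poly const a) T"

lemma map_poly_const_add: "map_poly const (a + b) = map_poly const a + map_poly const b"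
  by (rule poly_eqI) (simp add: coeff_map_poly const_add)

lemma pc_add: "pc (a + b) = pc a + pc b"
  by (simp add: pc_def map_poly_const_add)

lemma pc_smult: "pc (Polynomial.smult c a) = const c * pc a"
proof -
  have "map_poly const (Polynomial.smult c a) = Polynomial.smult (const c) (map_poly const a)"
    by (rule poly_eqI) (simp add: coeff_map_poly const_mult)
  then show ?thesis by (simp add: pc_def)
qed

lemma pc_pCons [simp]: "pc (pCons c a) = const c + T * pc a"
  by (simp add: pc_def map_poly_pCons)

lemma pc_0 [simp]: "pc 0 = 0"
  by (simp add: pc_def)

lemma pc_1 [simp]: "pc 1 = 1"
  by (simp add: one_pCons)

lemma pc_mult: "pc (a * b) = pc a * pc b"
  by (induction a) (auto simp: pc_add pc_smult algebra_simps)

lemma pc_minus: "pc (- a) = - pc a"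
  using pc_add[of a "- a"] by (simp add: eq_neg_iff_add_eq_0 add.commute)

lemma pc_diff: "pc (a - b) = pc a - pc b"
  using pc_add[of a "- b"] by (simp add: pc_minus)

lemma pc_power: "pc (a ^ m) = pc a ^ m"
  by (induction m) (auto simp: pc_mult)

lemma ev_eq: "ev p = pc (fst p) + pc (snd p) * Y"
  by (simp add: pf_eval_def pc_def)

lemma ev_eq_0_iff [simp]: "ev p = 0 \<longleftrightarrow> p = (0, 0)"
proof
  assume "p = (0, 0)"
  then show "ev p = 0" by (simp add: ev_eq)
qed (rule ev_inj_0)

definition pf_add :: "'c polyfun \<Rightarrow> 'c polyfun \<Rightarrow> 'c polyfun" where
  "pf_add p r = (fst p + fst r, snd p + snd r)"

lemma ev_add: "ev (pf_add p r) = ev p + ev r"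
  by (simp add: ev_eq pf_add_def pc_add algebra_simps)

lemma ev_uminus: "ev (- fst p, - snd p) = - ev p"
  by (simp add: ev_eq pc_minus)

lemma ev_inj: "ev p = ev r \<Longrightarrow> p = r"
  using ev_eq_0_iff[of "pf_add p (- fst r, - snd r)"]
  by (simp add: ev_add ev_uminus) (simp add: pf_add_def prod_eq_iff)

lemma ev_mul: "ev (pf_mul E p r) = ev p * ev r"
proof -
  have Y2: "Y * Y = pc (pf_G E) - pc (pf_L E) * Y"
    using weierstrass_eq
    by (simp add: pf_G_def pf_L_def power2_eq_square power3_eq_cube algebra_simps)
  have "ev p * ev r = pc (fst p) * pc (fst r) + (pc (fst p) * pc (snd r) + pc (snd p) * pc (fst r)) * Y
      + pc (snd p) * pc (snd r) * (Y * Y)"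
    by (simp add: ev_eq algebra_simps)
  also have "\<dots> = ev (pf_mul E p r)"
    unfolding Y2 by (simp add: ev_eq pf_mul_def pc_add pc_diff pc_mult algebra_simps)
  finally show ?thesis ..
qed

lemma ev_const: "ev ([:c:], 0) = const c" and ev_T: "ev ([:0, 1:], 0) = T" and ev_Y: "ev (0, 1) = Y"
  and ev_1: "ev (1, 0) = 1" and ev_0: "ev (0, 0) = 0" and ev_poly: "ev (a, 0) = pc a"
  by (simp_all add: ev_eq)

lemma coeffs_in_add:
  "is_subfield L \<Longrightarrow> coeffs_in L p \<Longrightarrow> coeffs_in L r \<Longrightarrow> coeffs_in L (pf_add p r)"
  by (auto simp: coeffs_in_iff pf_add_def intro!: poly_in_ring)

lemma wc_in_UNIV [simp]: "wc_in UNIV E"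
  by (simp add: wc_in_def)

lemma is_subfield_fractions:
  assumes L: "is_subfield L" "wc_in L E"
  shows "is_subfield {ev p / ev r | p r. coeffs_in L p \<and> coeffs_in L r \<and> r \<noteq> (0, 0)}" (is "is_subfield ?R")
proof -
  have frac: "h \<in> ?R" if "h = ev p / ev r" "coeffs_in L p" "coeffs_in L r" "r \<noteq> (0, 0)" for h p r
    using that by blast
  have c1: "coeffs_in L (1, 0)" "coeffs_in L (0, 0)"
    using poly_in_ring[OF L(1)] by (auto simp: coeffs_in_iff)
  have zero: "0 \<in> ?R" by (rule frac[of _ "(0, 0)" "(1, 0)"]) (use c1 in \<open>simp_all add: ev_0\<close>)
  have one: "1 \<in> ?R" by (rule frac[of _ "(1, 0)" "(1, 0)"]) (use c1 in \<open>simp_all add: ev_1\<close>)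
  have neg: "- a \<in> ?R" and inv: "inverse a \<in> ?R" if aR: "a \<in> ?R" for a
  proof -
    obtain p r where a: "a = ev p / ev r" "coeffs_in L p" "coeffs_in L r" "r \<noteq> (0, 0)"
      using aR by blast
    show "- a \<in> ?R"
      by (rule frac[of _ "(- fst p, - snd p)" r])
        (use a poly_in_ring(6)[OF L(1)] in \<open>auto simp: ev_uminus coeffs_in_iff\<close>)
    show "inverse a \<in> ?R"
    proof (cases "p = (0, 0)")
      case True
      then show ?thesis using a zero by (simp add: ev_0)
    next
      case False
      show ?thesis by (rule frac[of _ r p]) (use a False in simp_all)
    qed
  qed
  have add: "a + b \<in> ?R" and mult: "a * b \<in> ?R" if abR: "a \<in> ?R" "b \<in> ?R" for a b
  proof -
    obtain p r p' r' where a: "a = ev p / ev r" "coeffs_in L p" "coeffs_in L r" "r \<noteq> (0, 0)"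
      and b: "b = ev p' / ev r'" "coeffs_in L p'" "coeffs_in L r'" "r' \<noteq> (0, 0)"
      using abR by blast
    have nz: "ev r \<noteq> 0" "ev r' \<noteq> 0" using a(4) b(4) by simp_all
    show "a + b \<in> ?R"
      by (rule frac[of _ "pf_add (pf_mul E p r') (pf_mul E p' r)" "pf_mul E r r'"])
        (use a b nz in \<open>simp_all add: ev_add ev_mul pf_mul_eq_0_iff add_frac_eq coeffs_in_add coeffs_in_mul L\<close>)
    show "a * b \<in> ?R"
      by (rule frac[of _ "pf_mul E p p'" "pf_mul E r r'"])
        (use a b in \<open>simp_all add: ev_mul pf_mul_eq_0_iff coeffs_in_mul L\<close>)
  qed
  show ?thesis
    unfolding is_subfield_def using zero one neg inv add mult by (intro conjI ballI)
qed

lemma is_subfield_ratfuns: "is_subfield (ratfuns F L)"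
  unfolding ratfuns_def by (rule is_subfield_field_gen)

lemma ev_in_ratfuns:
  assumes "coeffs_in L p"
  shows "ev p \<in> ratfuns F L"
proof -
  have g: "const ` L \<union> {T, Y} \<subseteq> ratfuns F L" unfolding ratfuns_def by (rule field_gen_superset)
  have pc: "poly_in L a \<Longrightarrow> pc a \<in> ratfuns F L" for a
  proof (induction a)
    case (pCons c a)
    then show ?case using g is_subfield_ratfuns[of L] by (auto intro!: is_subfieldD)
  qed (simp add: is_subfieldD[OF is_subfield_ratfuns])
  then show ?thesis
    unfolding ev_eq using assms g is_subfield_ratfuns[of L]
    by (auto simp: coeffs_in_iff intro!: is_subfieldD)
qed

text \<open>The quotients of normal forms over \<open>L\<close> already form a field, so they
  exhaust the generated one.\<close>

lemma ratfuns_eq: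
  assumes L: "is_subfield L" "wc_in L E"
  shows "ratfuns F L = {ev p / ev r | p r. coeffs_in L p \<and> coeffs_in L r \<and> r \<noteq> (0, 0)}" (is "_ = ?R")
proof
  have c: "coeffs_in L (1, 0)" "coeffs_in L ([:0, 1:], 0)" "coeffs_in L (0, 1)"
    "x \<in> L \<Longrightarrow> coeffs_in L ([:x:], 0)" for x
    using poly_in_ring[OF L(1)] is_subfieldD[OF L(1)] by (auto simp: coeffs_in_iff)
  have R: "ev p \<in> ?R" if "coeffs_in L p" for p
  proof -
    have "ev p = ev p / ev (1, 0)" "(1, 0) \<noteq> ((0, 0) :: 'c polyfun)" by (simp_all add: ev_1)
    then show ?thesis using that c(1) by blast
  qed
  have "const ` L \<union> {T, Y} \<subseteq> ?R"
    using R[OF c(2)] R[OF c(3)] R[OF c(4)] unfolding ev_T ev_Y ev_const by blast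
  then show "ratfuns F L \<subseteq> ?R"
    unfolding ratfuns_def using is_subfield_fractions[OF L] by (rule field_gen_minimal)
next
  show "?R \<subseteq> ratfuns F L"
    using ev_in_ratfuns is_subfield_ratfuns by (auto intro!: is_subfield_divide)
qed

lemma const_in_ratfuns: "c \<in> L \<Longrightarrow> const c \<in> ratfuns F L"
  unfolding ratfuns_def using field_gen_superset[of "const ` L \<union> {T, Y}"] by auto

lemma ratfuns_mono: "ratfuns F L \<subseteq> ratfuns F UNIV"
  unfolding ratfuns_def field_gen_def by (rule hull_mono) blast


section \<open>Local rings at affine points\<close>

definition aff :: "'c point \<Rightarrow> bool" where
  "aff X \<longleftrightarrow> on_curve E X \<and> X \<noteq> Infinity"

definition point_in :: "'c set \<Rightarrow> 'c point \<Rightarrow> bool" where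
  "point_in L X \<longleftrightarrow> (case X of Infinity \<Rightarrow> True | Affine x y \<Rightarrow> x \<in> L \<and> y \<in> L)"

definition pfv :: "'c polyfun \<Rightarrow> 'c point \<Rightarrow> 'c" where
  "pfv p X = (case X of Infinity \<Rightarrow> 0 | Affine x y \<Rightarrow> pf_value p x y)"

text \<open>Regularity of \<open>h\<close> at \<open>X\<close> with value \<open>v\<close>,
  witnessed by a fraction over \<open>L\<close>. The parameter \<open>L\<close> is what later puts
  leading coefficients into \<open>H\<close>. Since \<open>pfv\<close> is 0 at
  \<open>Infinity\<close>, the predicate never holds there.\<close>

definition val :: "'c set \<Rightarrow> 'c point \<Rightarrow> 'f \<Rightarrow> 'c \<Rightarrow> bool" where
  "val L X h v \<longleftrightarrow> (\<exists>p r. coeffs_in L p \<and> coeffs_in L r \<and> pfv r X \<noteq> 0 \<and>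
     h = ev p / ev r \<and> v = pfv p X / pfv r X)"

lemma affE:
  assumes "aff X"
  obtains x y where "X = Affine x y" "on_curve E (Affine x y)"
  using assms by (cases X) (auto simp: aff_def simp del: on_curve.simps)

lemma pfv_Affine [simp]: "pfv p (Affine x y) = pf_value p x y"
  by (simp add: pfv_def)

lemma pfv_mul: "aff X \<Longrightarrow> pfv (pf_mul E p r) X = pfv p X * pfv r X"
  by (erule affE) (simp add: pf_value_mul)

lemma pfv_add: "aff X \<Longrightarrow> pfv (pf_add p r) X = pfv p X + pfv r X"
  by (erule affE) (simp add: pf_value_def pf_add_def algebra_simps)

lemma pfv_one: "aff X \<Longrightarrow> pfv (1, 0) X = 1"
  by (erule affE) (simp add: pf_value_def)

lemma pfv_zero [simp]: "pfv (0, 0) X = 0"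
  by (simp add: pfv_def pf_value_def split: point.splits)

lemma pfv_in: "is_subfield L \<Longrightarrow> coeffs_in L p \<Longrightarrow> point_in L X \<Longrightarrow> pfv p X \<in> L"
  by (auto simp: pfv_def point_in_def intro: pf_value_in is_subfieldD split: point.splits)

lemma val_UNIV: "val L X h v \<Longrightarrow> val UNIV X h v"
  unfolding val_def by auto

lemma val_in: "is_subfield L \<Longrightarrow> point_in L X \<Longrightarrow> val L X h v \<Longrightarrow> v \<in> L"
  unfolding val_def by (auto intro!: is_subfield_divide pfv_in)

lemma val_in_ratfuns: "val L X h v \<Longrightarrow> h \<in> ratfuns F L"
  unfolding val_def by (auto intro!: is_subfield_divide is_subfield_ratfuns ev_in_ratfuns)

lemma val_unique:
  assumes X: "aff X" and "val L X h v" "val L' X h v'"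
  shows "v = v'"
proof -
  obtain p r where 1: "pfv r X \<noteq> 0" "h = ev p / ev r" "v = pfv p X / pfv r X"
    using assms(2) unfolding val_def by blast
  obtain p' r' where 2: "pfv r' X \<noteq> 0" "h = ev p' / ev r'" "v' = pfv p' X / pfv r' X"
    using assms(3) unfolding val_def by blast
  have "r \<noteq> (0, 0)" "r' \<noteq> (0, 0)" using 1(1) 2(1) by auto
  then have "ev p * ev r' = ev p' * ev r" using 1(2) 2(2) by (simp add: field_simps)
  then have "pf_mul E p r' = pf_mul E p' r" by (simp add: ev_inj flip: ev_mul)
  then have "pfv p X * pfv r' X = pfv p' X * pfv r X" by (simp flip: pfv_mul[OF X])
  then show ?thesis using 1(1,3) 2(1,3) by (simp add: frac_eq_eq)
qed

lemma val_ev: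
  assumes "aff X" "is_subfield L" "coeffs_in L p"
  shows "val L X (ev p) (pfv p X)"
  unfolding val_def using assms poly_in_ring[OF assms(2)] is_subfieldD[OF assms(2)]
  by (intro exI[of _ p] exI[of _ "(1, 0)"]) (auto simp: pfv_one ev_1 coeffs_in_iff)

lemma val_const:
  assumes "aff X" "is_subfield L" "c \<in> L"
  shows "val L X (const c) c"
  using val_ev[OF assms(1,2), of "([:c:], 0)"] assms(1,3) is_subfieldD(1)[OF assms(2)]
    poly_in_ring(1)[OF assms(2)]
  by (auto elim!: affE simp: ev_const pf_value_def coeffs_in_iff simp del: on_curve.simps)

lemma val_one: "aff X \<Longrightarrow> is_subfield L \<Longrightarrow> val L X 1 1"
  using val_const[of X L 1] is_subfieldD[of L] by simp

lemma val_mult: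
  assumes X: "aff X" and L: "is_subfield L" "wc_in L E" and "val L X h v" "val L X h' v'"
  shows "val L X (h * h') (v * v')"
proof -
  obtain p r where 1: "coeffs_in L p" "coeffs_in L r" "pfv r X \<noteq> 0" "h = ev p / ev r" "v = pfv p X / pfv r X"
    using assms(4) unfolding val_def by blast
  obtain p' r' where 2: "coeffs_in L p'" "coeffs_in L r'" "pfv r' X \<noteq> 0" "h' = ev p' / ev r'" "v' = pfv p' X / pfv r' X"
    using assms(5) unfolding val_def by blast
  show ?thesis
    unfolding val_def using 1 2
    by (intro exI[of _ "pf_mul E p p'"] exI[of _ "pf_mul E r r'"])
      (auto simp: ev_mul pfv_mul[OF X] intro!: coeffs_in_mul L)
qed

lemma val_add:
  assumes X: "aff X" and L: "is_subfield L" "wc_in L E" and "val L X h v" "val L X h' v'"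
  shows "val L X (h + h') (v + v')"
proof -
  obtain p r where 1: "coeffs_in L p" "coeffs_in L r" "pfv r X \<noteq> 0" "h = ev p / ev r" "v = pfv p X / pfv r X"
    using assms(4) unfolding val_def by blast
  obtain p' r' where 2: "coeffs_in L p'" "coeffs_in L r'" "pfv r' X \<noteq> 0" "h' = ev p' / ev r'" "v' = pfv p' X / pfv r' X"
    using assms(5) unfolding val_def by blast
  have nz: "ev r \<noteq> 0" "ev r' \<noteq> 0" using 1(3) 2(3) by auto
  have "h + h' = ev (pf_add (pf_mul E p r') (pf_mul E p' r)) / ev (pf_mul E r r')"
    using 1(4) 2(4) nz by (simp add: ev_add ev_mul add_frac_eq)
  moreover have "v + v' = pfv (pf_add (pf_mul E p r') (pf_mul E p' r)) X / pfv (pf_mul E r r') X"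
    using 1 2 by (simp add: pfv_add[OF X] pfv_mul[OF X] add_frac_eq)
  moreover have "pfv (pf_mul E r r') X \<noteq> 0" using 1 2 by (simp add: pfv_mul[OF X])
  ultimately show ?thesis
    unfolding val_def using 1(1,2) 2(1,2)
    by (intro exI[of _ "pf_add (pf_mul E p r') (pf_mul E p' r)"] exI[of _ "pf_mul E r r'"] conjI
        coeffs_in_add coeffs_in_mul L) auto
qed

lemma val_minus:
  assumes "aff X" "is_subfield L" "wc_in L E" "val L X h v"
  shows "val L X (- h) (- v)"
  using val_mult[OF assms(1-3) val_const[OF assms(1,2), of "- 1"] assms(4)] is_subfieldD[OF assms(2)]
  by (simp add: const_minus)

lemma val_diff:
  assumes "aff X" "is_subfield L" "wc_in L E" "val L X h v" "val L X h' v'"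
  shows "val L X (h - h') (v - v')"
  using val_add[OF assms(1-4) val_minus[OF assms(1-3,5)]] by simp

lemma val_power:
  assumes "aff X" "is_subfield L" "wc_in L E" "val L X h v"
  shows "val L X (h ^ m) (v ^ m)"
  using assms by (induction m) (auto intro!: val_mult val_one)

lemma val_inverse:
  assumes "val L X h v" "v \<noteq> 0"
  shows "val L X (inverse h) (inverse v)"
proof -
  obtain p r where "coeffs_in L p" "coeffs_in L r" "pfv r X \<noteq> 0" "h = ev p / ev r" "v = pfv p X / pfv r X"
    using assms(1) unfolding val_def by blast
  then show ?thesis
    unfolding val_def using assms(2) by (intro exI[of _ r] exI[of _ p]) auto
qed

lemma val_nonzero: "aff X \<Longrightarrow> val L X h v \<Longrightarrow> v \<noteq> 0 \<Longrightarrow> h \<noteq> 0"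
  unfolding val_def by auto

lemma local_ring_eq: "aff X \<Longrightarrow> local_ring F X = {h. \<exists>v. val UNIV X h v}"
  by (erule affE) (auto simp: val_def)

lemma local_max_ideal_eq: "aff X \<Longrightarrow> local_max_ideal F X = {h. val UNIV X h 0}"
proof (erule affE)
  fix x y assume X: "X = Affine x y"
  have "val UNIV X h 0 \<longleftrightarrow> (\<exists>p r. h = ev p / ev r \<and> pf_value p x y = 0 \<and> pf_value r x y \<noteq> 0)" for h
    unfolding val_def X by auto
  then show ?thesis by (auto simp: X)
qed

section \<open>Uniformizers at affine points\<close>

text \<open>At a point where the y-derivative of the equation is nonzero, t - x is a uniformizer;
  otherwise smoothness makes the t-derivative nonzero and y minus its value is one. The value at
  \<open>Infinity\<close> is a dummy.\<close>

definition ufp :: "'c point \<Rightarrow> 'c polyfun" where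
  "ufp X = (case X of Infinity \<Rightarrow> (0, 0)
     | Affine x y \<Rightarrow> if 2 * y + wc1 E * x + wc3 E \<noteq> 0 then ([:- x, 1:], 0) else ([:- y:], 1))"

definition uf :: "'c point \<Rightarrow> 'f" where
  "uf X = ev (ufp X)"

lemma uf_cases:
  "uf (Affine x y) = (if 2 * y + wc1 E * x + wc3 E \<noteq> 0 then T - const x else Y - const y)"
  by (simp add: uf_def ufp_def ev_eq const_minus)

lemma uf_nonzero: "aff X \<Longrightarrow> uf X \<noteq> 0"
  by (erule affE) (simp add: uf_def ufp_def)

lemma coeffs_in_ufp: "is_subfield L \<Longrightarrow> point_in L X \<Longrightarrow> coeffs_in L (ufp X)"
  using is_subfieldD[of L] poly_in_ring[of L]
  by (auto simp: ufp_def point_in_def coeffs_in_iff split: point.splits)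

lemma val_uf: "aff X \<Longrightarrow> is_subfield L \<Longrightarrow> point_in L X \<Longrightarrow> val L X (uf X) 0"
  using val_ev[of X L "ufp X"] coeffs_in_ufp[of L X]
  by (auto elim!: affE simp: uf_def ufp_def pf_value_def simp del: on_curve.simps split: if_splits)

text \<open>The Weierstrass equation at \<open>(x, y)\<close> in the form
  \<open>(Y - y) (Y + y + a\<^sub>1 T + a\<^sub>3) = (T - x) (T\<^sup>2 + x T + x\<^sup>2 + a\<^sub>2 (T + x) + a\<^sub>4 - a\<^sub>1 y)\<close>; the second factors
  take the values of the partial derivatives, up to sign, at the point.\<close>

definition wB :: "'c \<Rightarrow> 'c \<Rightarrow> 'c polyfun" where
  "wB x y = ([:y + wc3 E, wc1 E:], 1)"

definition wA :: "'c \<Rightarrow> 'c \<Rightarrow> 'c polyfun" where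
  "wA x y = ([:x^2 + wc2 E * x + wc4 E - wc1 E * y, x + wc2 E, 1:], 0)"

lemma weierstrass_local:
  assumes "on_curve E (Affine x y)"
  shows "(Y - const y) * ev (wB x y) = (T - const x) * ev (wA x y)"
proof -
  have "const (y^2 + wc1 E * x * y + wc3 E * y) = const (x^3 + wc2 E * x^2 + wc4 E * x + wc6 E)"
    using assms by simp
  then have "const y ^ 2 + const (wc1 E) * const x * const y + const (wc3 E) * const y =
      const x ^ 3 + const (wc2 E) * const x ^ 2 + const (wc4 E) * const x + const (wc6 E)"
    by (simp only: const_add const_mult const_power)
  with weierstrass_eq show ?thesis
    by (simp add: wA_def wB_def ev_eq const_add const_mult const_diff const_power
        algebra_simps power2_eq_square power3_eq_cube)
qed

lemma wAB_values:
  "pf_value (wB x y) x y = 2 * y + wc1 E * x + wc3 E"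
  "pf_value (wA x y) x y = 3 * x^2 + 2 * wc2 E * x + wc4 E - wc1 E * y"
  by (simp_all add: wB_def wA_def pf_value_def algebra_simps power2_eq_square)

text \<open>A numerator vanishing at (x, y) has the form (T - x) d + b (Y - y). After multiplication
  by \<open>wB\<close> or \<open>wA\<close>, whichever does not vanish at the point, the local
  Weierstrass equation trades one of the two linear factors for the other, and the uniformizer can
  be taken out. Every step stays over \<open>L\<close>.\<close>

lemma val_eq_0_step:
  assumes X: "aff X" and L: "is_subfield L" "wc_in L E" "point_in L X" and h: "val L X h 0"
  shows "\<exists>w v. val L X w v \<and> h = w * uf X"
proof -
  obtain x y where Xe: "X = Affine x y" and on: "on_curve E (Affine x y)" using X by (rule affE)
  have xy: "x \<in> L" "y \<in> L" using L(3) by (auto simp: point_in_def Xe)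
  obtain p r where pr: "coeffs_in L p" "coeffs_in L r" "pfv r X \<noteq> 0" "h = ev p / ev r" "pfv p X = 0"
    using h unfolding val_def by auto
  obtain a b where p: "p = (a, b)" by (cases p)
  \<comment> \<open>Replacing Y by the constant \<open>y\<close> leaves a polynomial in t with root
    \<open>x\<close>; \<open>d\<close> is its quotient by t - x.\<close>
  define d where "d = synthetic_div (a + [:y:] * b) x"
  have "poly (a + [:y:] * b) x = 0" using pr(5) by (simp add: Xe p pf_value_def mult.commute)
  then have "a + [:y:] * b = [:- x, 1:] * d"
    unfolding d_def using synthetic_div_correct'[of x "a + [:y:] * b"] by simp
  then have "pc (a + [:y:] * b) = pc ([:- x, 1:] * d)" by simp
  then have "pc a + pc [:y:] * pc b = pc [:- x, 1:] * pc d" by (simp only: pc_add pc_mult)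
  then have "pc a + const y * pc b = (T - const x) * pc d"
    by (simp add: const_minus)
  then have ep: "ev p = (T - const x) * pc d + pc b * (Y - const y)"
    by (simp add: ev_eq p algebra_simps)
  \<comment> \<open>The same cofactor \<open>N\<close> = d \<open>wB\<close> + b \<open>wA\<close>
    serves both choices of the uniformizer.\<close>
  define N where "N = pf_add (pf_mul E (d, 0) (wB x y)) (pf_mul E (b, 0) (wA x y))"
  have evN: "ev N = pc d * ev (wB x y) + pc b * ev (wA x y)"
    by (simp add: N_def ev_add ev_mul ev_poly)
  have ab: "poly_in L a" "poly_in L b" using pr(1) by (auto simp: coeffs_in_iff p)
  have yb: "poly_in L [:y:]" using xy is_subfieldD[OF L(1)] poly_in_ring[OF L(1)] by simp
  have "poly_in L d"
    unfolding d_def using ab yb xy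
    by (intro poly_in_synthetic_div poly_in_ring L(1)) auto
  have wcL: "wc1 E \<in> L" "wc2 E \<in> L" "wc3 E \<in> L" "wc4 E \<in> L" using L(2) by (auto simp: wc_in_def)
  have cA: "coeffs_in L (wA x y)" and cB: "coeffs_in L (wB x y)"
    using xy wcL is_subfieldD[OF L(1)] poly_in_ring[OF L(1)] is_subfield_diff[OF L(1)] is_subfield_power[OF L(1)]
    by (auto simp: wA_def wB_def coeffs_in_iff)
  have cN: "coeffs_in L N"
    unfolding N_def using cA cB ab \<open>poly_in L d\<close> poly_in_ring[OF L(1)]
    by (intro coeffs_in_add coeffs_in_mul L(1,2)) (auto simp: coeffs_in_iff)
  have wl: "(Y - const y) * ev (wB x y) = (T - const x) * ev (wA x y)"
    using weierstrass_local[OF on] .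
  have "\<exists>s. coeffs_in L s \<and> pfv s X \<noteq> 0 \<and> ev p * ev s = uf X * ev N"
  proof (cases "2 * y + wc1 E * x + wc3 E = 0")
    case False
    have "ev p * ev (wB x y) = (T - const x) * (pc d * ev (wB x y)) + pc b * ((Y - const y) * ev (wB x y))"
      by (simp add: ep algebra_simps)
    also have "\<dots> = (T - const x) * ev N" unfolding wl evN by (simp add: algebra_simps)
    finally show ?thesis
      using False cB by (intro exI[of _ "wB x y"]) (simp add: Xe wAB_values uf_cases)
  next
    case True
    then have nz: "pfv (wA x y) X \<noteq> 0"
      using smooth[OF on] by (simp add: Xe wAB_values)
    have "ev p * ev (wA x y) = pc d * ((T - const x) * ev (wA x y)) + pc b * ev (wA x y) * (Y - const y)"
      by (simp add: ep algebra_simps)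
    also have "\<dots> = (Y - const y) * ev N" unfolding wl[symmetric] evN by (simp add: algebra_simps)
    finally show ?thesis
      using True nz cA by (intro exI[of _ "wA x y"]) (simp add: Xe uf_cases)
  qed
  then obtain s where s: "coeffs_in L s" "pfv s X \<noteq> 0" "ev p * ev s = uf X * ev N" by blast
  define w where "w = ev N / ev (pf_mul E r s)"
  have "val L X w (pfv N X / pfv (pf_mul E r s) X)"
    unfolding val_def w_def using cN s pr
    by (intro exI[of _ N] exI[of _ "pf_mul E r s"]) (auto simp: pfv_mul[OF X] intro!: coeffs_in_mul L)
  moreover have "h = w * uf X"
  proof -
    have "ev r \<noteq> 0" "ev s \<noteq> 0" using pr(3) s(2) by auto
    then have "h = ev p * ev s / (ev r * ev s)" using pr(4) by simp
    then show ?thesis unfolding s(3) w_def by (simp add: ev_mul)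
  qed
  ultimately show ?thesis by blast
qed

text \<open>The order of t - x is 2 exactly at the points where the y-derivative vanishes, and 1
  elsewhere. The bound 2 is for estimating orders by degrees, positivity for the diagonal of
  d[t].\<close>

lemma T_order:
  assumes X: "aff X" and Xe: "X = Affine x y"
  shows "\<exists>d w v. 0 < d \<and> d \<le> (2::nat) \<and> val UNIV X w v \<and> v \<noteq> 0 \<and> T - const x = w * uf X ^ d"
proof -
  have on: "on_curve E (Affine x y)" using X by (simp add: aff_def Xe)
  have wl: "(Y - const y) * ev (wB x y) = (T - const x) * ev (wA x y)"
    using weierstrass_local[OF on] .
  show ?thesis
  proof (cases "2 * y + wc1 E * x + wc3 E = 0")
    case False
    then show ?thesis using val_one[OF X, of UNIV]
      by (intro exI[of _ 1]) (auto simp: Xe uf_cases)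
  next
    case True
    \<comment> \<open>When the y-derivative vanishes, \<open>wB\<close> becomes (Y - y) + a_1 (T -
      x), with a_1 = \<open>wc1 E\<close>. Moving its second term to the other side gives (T - x) c
      = (Y - y)^2, with \<open>c\<close> a unit by smoothness.\<close>
    define c where "c = ev (wA x y) - const (wc1 E) * (Y - const y)"
    have u: "uf X = Y - const y" using True by (simp add: Xe uf_cases)
    have "val UNIV X c (pfv (wA x y) X - wc1 E * 0)"
      unfolding c_def u[symmetric]
      by (intro val_diff val_mult val_ev val_const val_uf X) (auto simp: point_in_def split: point.splits)
    then have c: "val UNIV X c (pfv (wA x y) X)" by simp
    have nz: "pfv (wA x y) X \<noteq> 0" using True smooth[OF on] by (simp add: Xe wAB_values)
    have "const (2 * y + wc1 E * x + wc3 E) = 0" using True by simp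
    then have "2 * const y + const (wc1 E) * const x + const (wc3 E) = 0"
      by (simp only: const_add const_mult const_numeral)
    moreover have "ev (wB x y) = (Y - const y) + const (wc1 E) * (T - const x)
        + (2 * const y + const (wc1 E) * const x + const (wc3 E))"
      by (simp add: wB_def ev_eq const_add algebra_simps)
    ultimately have evB: "ev (wB x y) = (Y - const y) + const (wc1 E) * (T - const x)" by simp
    have "(T - const x) * c = (T - const x) * ev (wA x y) - const (wc1 E) * (T - const x) * (Y - const y)"
      by (simp add: c_def algebra_simps)
    also have "\<dots> = (Y - const y) ^ 2"
      unfolding wl[symmetric] evB by (simp add: algebra_simps power2_eq_square)
    finally have "(T - const x) * c = (Y - const y) ^ 2" .
    moreover have "c \<noteq> 0" using val_nonzero[OF X c nz] .
    ultimately have "T - const x = inverse c * uf X ^ 2" unfolding u by (simp add: field_simps)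
    moreover have "val UNIV X (inverse c) (inverse (pfv (wA x y) X))" using val_inverse[OF c nz] .
    ultimately show ?thesis using nz
      by (intro exI[of _ 2] exI[of _ "inverse c"] exI[of _ "inverse (pfv (wA x y) X)"]) simp
  qed
qed


section \<open>Orders of vanishing at affine points\<close>

text \<open>A lower bound for the order, satisfied by 0 for every \<open>m\<close>, so that sums
  with cancellation need no case distinction. \<open>ordeq\<close> is the exact version;
  \<open>ord_at\<close> is only consulted where divisors are translated.\<close>

definition ordge :: "'c point \<Rightarrow> int \<Rightarrow> 'f \<Rightarrow> bool" where
  "ordge X m h \<longleftrightarrow> (\<exists>w v. val UNIV X w v \<and> h = w * uf X powi m)"

definition ordeq :: "'c point \<Rightarrow> int \<Rightarrow> 'f \<Rightarrow> bool" where
  "ordeq X m h \<longleftrightarrow> (\<exists>w v. val UNIV X w v \<and> v \<noteq> 0 \<and> h = w * uf X powi m)"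

lemma point_in_UNIV [simp]: "point_in UNIV X"
  by (simp add: point_in_def split: point.splits)

text \<open>Multiplying with the conjugate turns \<open>p\<close> into a polynomial in \<open>T\<close>, whose order at \<open>x\<close> is at
  most its degree; this is what bounds the order of \<open>p\<close> at \<open>X\<close>.\<close>

lemma ev_order_bound:
  assumes X: "aff X" and p: "p \<noteq> (0, 0)" and w: "val UNIV X w v" "ev p = w * uf X ^ m"
  shows "m \<le> 2 * degree (pf_norm E p)"
proof (rule ccontr)
  assume m: "\<not> ?thesis"
  obtain x y where Xe: "X = Affine x y" using X by (rule affE)
  define N where "N = pf_norm E p"
  define e where "e = order x N"
  have N: "N \<noteq> 0" using p by (simp add: N_def pf_norm_eq_0_iff)
  obtain s where s: "N = [:- x, 1:] ^ e * s" "\<not> [:- x, 1:] dvd s"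
    using order_decomp[OF N, of x] unfolding e_def by blast
  have e: "e \<le> degree N" unfolding e_def by (rule order_degree[OF N])
  obtain d c vc where d: "d \<le> 2" and c: "val UNIV X c vc" "vc \<noteq> 0" "T - const x = c * uf X ^ d"
    using T_order[OF X Xe] by blast
  have "d * e \<le> 2 * degree N" using d e by (intro mult_mono) auto
  then have de: "d * e < m" using m by (simp add: N_def)
  have "pc N = (T - const x) ^ e * pc s"
    by (simp only: s(1) pc_mult pc_power) (simp add: const_minus)
  also have "\<dots> = c ^ e * pc s * uf X ^ (d * e)"
    by (simp add: c(3) power_mult_distrib power_mult mult_ac)
  finally have 1: "pc N = c ^ e * pc s * uf X ^ (d * e)" .
  have "ev p * ev (pf_conj E p) = pc N"
    by (simp add: pf_mul_conj ev_poly N_def flip: ev_mul)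
  then have "pc N = w * ev (pf_conj E p) * uf X ^ m" using w(2) by (simp add: mult_ac)
  also have "\<dots> = w * ev (pf_conj E p) * uf X ^ (m - d * e) * uf X ^ (d * e)"
    using de by (simp add: mult.assoc flip: power_add)
  finally have 2: "w * ev (pf_conj E p) * uf X ^ (m - d * e) = c ^ e * pc s"
    using 1 uf_nonzero[OF X] by simp
  \<comment> \<open>A positive power of the uniformizer survives on the left, so its value at
    \<open>X\<close> is 0. On the right \<open>c\<close> is a unit, so \<open>s\<close> would vanish
    at \<open>x\<close>, although all factors t - x were removed from it.\<close>
  have "val UNIV X (w * ev (pf_conj E p) * uf X ^ (m - d * e)) (v * pfv (pf_conj E p) X * 0 ^ (m - d * e))"
    by (intro val_mult val_power val_ev val_uf X w(1)) simp_all
  moreover have "val UNIV X (c ^ e * ev (s, 0)) (vc ^ e * pfv (s, 0) X)"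
    by (intro val_mult val_power val_ev X c(1)) simp_all
  ultimately have "v * pfv (pf_conj E p) X * 0 ^ (m - d * e) = vc ^ e * pfv (s, 0) X"
    unfolding 2 ev_poly by (rule val_unique[OF X])
  then have "vc ^ e * pfv (s, 0) X = 0" using de by (simp add: power_0_left)
  then have "pfv (s, 0) X = 0" using c(2) by simp
  then have "poly s x = 0" by (simp add: Xe pf_value_def)
  then show False using s(2) by (simp add: poly_eq_0_iff_dvd)
qed

text \<open>The exponents of the powers of the uniformizer dividing \<open>ev p\<close> over
  \<open>L\<close> are bounded. At the largest one the cofactor is a unit, since otherwise one more
  division would be possible.\<close>

lemma ev_decomp:
  assumes X: "aff X" and L: "is_subfield L" "wc_in L E" "point_in L X"
    and p: "coeffs_in L p" "p \<noteq> (0, 0)"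
  shows "\<exists>m w v. val L X w v \<and> v \<noteq> 0 \<and> ev p = w * uf X ^ m"
proof -
  define P where "P m \<longleftrightarrow> (\<exists>w v. val L X w v \<and> ev p = w * uf X ^ m)" for m
  have "P 0" unfolding P_def using val_ev[OF X L(1) p(1)] by auto
  moreover have "m \<le> 2 * degree (pf_norm E p)" if "P m" for m
    using that ev_order_bound[OF X p(2)] val_UNIV unfolding P_def by blast
  ultimately obtain m where m: "P m" "\<And>m'. P m' \<Longrightarrow> m' \<le> m"
    by (metis Greatest_le_nat GreatestI_nat)
  then obtain w v where w: "val L X w v" "ev p = w * uf X ^ m" unfolding P_def by blast
  have "v \<noteq> 0"
  proof
    assume "v = 0"
    then obtain w' v' where "val L X w' v'" "w = w' * uf X"
      using val_eq_0_step[OF X L] w(1) by blast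
    then have "P (Suc m)" unfolding P_def using w(2) by (auto simp: mult_ac)
    then show False using m(2)[of "Suc m"] by simp
  qed
  then show ?thesis using w by blast
qed

lemma ratfuns_decomp:
  assumes X: "aff X" and L: "is_subfield L" "wc_in L E" "point_in L X"
    and h: "h \<in> ratfuns F L" "h \<noteq> 0"
  shows "\<exists>k w v. val L X w v \<and> v \<noteq> 0 \<and> h = w * uf X powi k"
proof -
  obtain p r where pr: "h = ev p / ev r" "coeffs_in L p" "coeffs_in L r" "r \<noteq> (0, 0)"
    using h(1) unfolding ratfuns_eq[OF L(1,2)] by blast
  then have "p \<noteq> (0, 0)" using h(2) by (auto simp: ev_0)
  obtain m w v where 1: "val L X w v" "v \<noteq> 0" "ev p = w * uf X ^ m"
    using ev_decomp[OF X L pr(2) \<open>p \<noteq> (0, 0)\<close>] by blast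
  obtain m' w' v' where 2: "val L X w' v'" "v' \<noteq> 0" "ev r = w' * uf X ^ m'"
    using ev_decomp[OF X L pr(3,4)] by blast
  have "h = w * inverse w' * uf X powi (int m - int m')"
    using uf_nonzero[OF X] by (simp add: pr(1) 1(3) 2(3) power_int_diff divide_inverse)
  moreover have "val L X (w * inverse w') (v * inverse v')"
    by (intro val_mult val_inverse X L 1 2)
  moreover have "v * inverse v' \<noteq> 0" using 1(2) 2(2) by simp
  ultimately show ?thesis by blast
qed

context
  fixes X assumes X: "aff X"
begin

lemma ordge_mono:
  assumes "ordge X m h" "m' \<le> m"
  shows "ordge X m' h"
proof -
  obtain w v where w: "val UNIV X w v" "h = w * uf X powi m" using assms(1) unfolding ordge_def by blast
  obtain j where m: "m = m' + int j" using assms(2) zle_iff_zadd by blast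
  have "h = (w * uf X ^ j) * uf X powi m'"
    using uf_nonzero[OF X] by (simp add: w(2) m power_int_add mult_ac)
  moreover have "val UNIV X (w * uf X ^ j) (v * 0 ^ j)"
    by (intro val_mult val_power val_uf X w(1)) simp_all
  ultimately show ?thesis unfolding ordge_def by blast
qed

lemma ordge_add:
  assumes "ordge X m h" "ordge X m h'"
  shows "ordge X m (h + h')"
proof -
  obtain w v w' v' where w: "val UNIV X w v" "h = w * uf X powi m" "val UNIV X w' v'" "h' = w' * uf X powi m"
    using assms unfolding ordge_def by blast
  have "h + h' = (w + w') * uf X powi m" by (simp add: w algebra_simps)
  moreover have "val UNIV X (w + w') (v + v')" by (intro val_add X w) simp_all
  ultimately show ?thesis unfolding ordge_def by blast
qed

lemma ordge_mult:
  assumes "ordge X m h" "ordge X m' h'"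
  shows "ordge X (m + m') (h * h')"
proof -
  obtain w v w' v' where w: "val UNIV X w v" "h = w * uf X powi m" "val UNIV X w' v'" "h' = w' * uf X powi m'"
    using assms unfolding ordge_def by blast
  have "h * h' = (w * w') * uf X powi (m + m')"
    using uf_nonzero[OF X] by (simp add: w power_int_add)
  moreover have "val UNIV X (w * w') (v * v')" by (intro val_mult X w) simp_all
  ultimately show ?thesis unfolding ordge_def by blast
qed

lemma ordge_0_iff: "ordge X 0 h \<longleftrightarrow> (\<exists>v. val UNIV X h v)"
  by (auto simp: ordge_def)

lemma ordge_zero: "ordge X m 0"
  unfolding ordge_def using val_const[OF X, of UNIV 0] by (intro exI[of _ 0]) auto

lemma ordge_const: "ordge X 0 (const c)"
  using val_const[OF X, of UNIV c] by (auto simp: ordge_0_iff)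

lemma ordge_const_mult: "ordge X m h \<Longrightarrow> ordge X m (const c * h)"
  using ordge_mult[OF ordge_const] by simp

lemma ordge_minus: "ordge X m h \<Longrightarrow> ordge X m (- h)"
  using ordge_const_mult[of m h "- 1"] by (simp add: const_minus)

lemma ordge_diff: "ordge X m h \<Longrightarrow> ordge X m h' \<Longrightarrow> ordge X m (h - h')"
  using ordge_add[OF _ ordge_minus] by force

lemma ordge_sum: "(\<And>i. i \<in> I \<Longrightarrow> ordge X m (h i)) \<Longrightarrow> ordge X m (sum h I)"
  by (induction I rule: infinite_finite_induct) (auto intro: ordge_zero ordge_add)

lemma ordeq_ordge: "ordeq X m h \<Longrightarrow> ordge X m h"
  unfolding ordge_def ordeq_def by blast

lemma ordeq_mult:
  assumes "ordeq X m h" "ordeq X m' h'"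
  shows "ordeq X (m + m') (h * h')"
proof -
  obtain w v w' v' where w: "val UNIV X w v" "h = w * uf X powi m" "val UNIV X w' v'" "h' = w' * uf X powi m'"
    and nz: "v \<noteq> 0" "v' \<noteq> 0"
    using assms unfolding ordeq_def by blast
  have "h * h' = (w * w') * uf X powi (m + m')"
    using uf_nonzero[OF X] by (simp add: w power_int_add)
  moreover have "val UNIV X (w * w') (v * v')" by (intro val_mult X w) simp_all
  moreover have "v * v' \<noteq> 0" using nz by simp
  ultimately show ?thesis unfolding ordeq_def by blast
qed

lemma ordeq_inverse:
  assumes "ordeq X m h"
  shows "ordeq X (- m) (inverse h)"
proof -
  obtain w v where w: "val UNIV X w v" "v \<noteq> 0" "h = w * uf X powi m"
    using assms unfolding ordeq_def by blast
  have "inverse h = inverse w * uf X powi (- m)" by (simp add: w(3) power_int_minus)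
  then show ?thesis unfolding ordeq_def using val_inverse[OF w(1,2)] w(2) nonzero_imp_inverse_nonzero by blast
qed

lemma ordeq_divide: "ordeq X m h \<Longrightarrow> ordeq X m' h' \<Longrightarrow> ordeq X (m - m') (h / h')"
  using ordeq_mult[OF _ ordeq_inverse] by (simp add: divide_inverse)

lemma ordeq_one: "ordeq X 0 1"
  unfolding ordeq_def using val_one[OF X, of UNIV] by (intro exI[of _ 1]) auto

lemma ordeq_const: "c \<noteq> 0 \<Longrightarrow> ordeq X 0 (const c)"
  unfolding ordeq_def using val_const[OF X, of UNIV c] by (intro exI[of _ "const c"] exI[of _ c]) auto

lemma ordeq_power: "ordeq X m h \<Longrightarrow> ordeq X (int i * m) (h ^ i)"
  by (induction i) (auto simp: ordeq_one algebra_simps dest: ordeq_mult)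

lemma ordeq_prod:
  "(\<And>i. i \<in> I \<Longrightarrow> ordeq X (m i) (h i)) \<Longrightarrow> ordeq X (sum m I) (prod h I)"
  by (induction I rule: infinite_finite_induct) (auto simp: ordeq_one intro: ordeq_mult)

lemma ordeq_uf: "ordeq X 1 (uf X)"
  unfolding ordeq_def using val_one[OF X, of UNIV] by (intro exI[of _ 1]) auto

lemma ordeq_ordge_le:
  assumes "ordeq X k h" "ordge X m h"
  shows "m \<le> k"
proof (rule ccontr)
  assume "\<not> ?thesis"
  then have "ordge X (k + 1) h" using ordge_mono[OF assms(2), of "k + 1"] by simp
  then obtain w v where w: "val UNIV X w v" "h = w * uf X powi (k + 1)" unfolding ordge_def by blast
  obtain w' v' where w': "val UNIV X w' v'" "v' \<noteq> 0" "h = w' * uf X powi k"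
    using assms(1) unfolding ordeq_def by blast
  have "w' = w * uf X"
    using w(2) w'(3) uf_nonzero[OF X] by (simp add: power_int_add)
  moreover have "val UNIV X (w * uf X) (v * 0)" by (intro val_mult val_uf X w(1)) simp_all
  ultimately show False using val_unique[OF X w'(1)] w'(2) by fastforce
qed

lemma ordeq_nonzero: "ordeq X k h \<Longrightarrow> h \<noteq> 0"
  using ordeq_ordge_le[of k h "k + 1"] ordge_zero by force

lemma uniformizer_uf: "uniformizer F X (uf X)"
  unfolding uniformizer_def local_ring_eq[OF X] local_max_ideal_eq[OF X]
proof (intro Set.set_eqI iffI)
  fix h assume "h \<in> {h. val UNIV X h 0}"
  then have "val UNIV X h 0" by simp
  then obtain w v where "val UNIV X w v" "h = w * uf X"
    using val_eq_0_step[OF X is_subfield_UNIV wc_in_UNIV point_in_UNIV] by blast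
  then show "h \<in> {uf X * h |h. h \<in> {h. \<exists>v. val UNIV X h v}}" by (auto simp: mult.commute)
next
  fix h assume "h \<in> {uf X * h |h. h \<in> {h. \<exists>v. val UNIV X h v}}"
  then obtain w v where w: "val UNIV X w v" "h = uf X * w" by blast
  have "val UNIV X (uf X * w) (0 * v)" by (intro val_mult val_uf X w(1)) simp_all
  then show "h \<in> {h. val UNIV X h 0}" using w(2) by simp
qed

lemma ord_at_ordeq:
  assumes "ordeq X k h"
  shows "ord_at F X h = k"
proof -
  obtain w v where w: "val UNIV X w v" "v \<noteq> 0" "h = w * uf X powi k"
    using assms unfolding ordeq_def by blast
  show ?thesis
  proof (rule ord_at_eqI[OF _ _ _ _ uniformizer_uf uf_nonzero[OF X] _ _ _ w(3)])
    show "local_max_ideal F X \<subseteq> local_ring F X"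
      by (auto simp: local_ring_eq[OF X] local_max_ideal_eq[OF X])
    show "1 \<in> local_ring F X"
      using val_one[OF X is_subfield_UNIV] by (auto simp: local_ring_eq[OF X])
    show "1 \<notin> local_max_ideal F X"
      using val_unique[OF X val_one[OF X is_subfield_UNIV], of UNIV 0]
      by (auto simp: local_max_ideal_eq[OF X])
    show "a * b \<in> local_ring F X" if "a \<in> local_ring F X" "b \<in> local_ring F X" for a b
      using that val_mult[OF X is_subfield_UNIV wc_in_UNIV] unfolding local_ring_eq[OF X] by blast
    show "w \<noteq> 0" using val_nonzero[OF X w(1,2)] .
    show "w \<in> local_ring F X" "inverse w \<in> local_ring F X"
      using w(1) val_inverse[OF w(1,2)] unfolding local_ring_eq[OF X] by blast+
  qed
qed

lemma ordeq_ord_at: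
  assumes "h \<in> ratfuns F UNIV" "h \<noteq> 0"
  shows "ordeq X (ord_at F X h) h"
proof -
  obtain k where "ordeq X k h"
    using ratfuns_decomp[OF X is_subfield_UNIV wc_in_UNIV point_in_UNIV assms] unfolding ordeq_def by blast
  then show ?thesis using ord_at_ordeq by simp
qed

lemma vanishes_to_order_iff:
  assumes "h \<in> ratfuns F UNIV"
  shows "vanishes_to_order F n X h \<longleftrightarrow> ordge X (int n) h"
proof (cases "h = 0")
  case False
  then have "ordeq X (ord_at F X h) h" using ordeq_ord_at assms by blast
  then have "ordge X (int n) h \<longleftrightarrow> int n \<le> ord_at F X h"
    using ordeq_ordge_le ordge_mono ordeq_ordge by blast
  then show ?thesis using False by (simp add: vanishes_to_order_def)
qed (simp add: vanishes_to_order_def ordge_zero)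

section \<open>Expansions along functions of increasing order\<close>

text \<open>The constant is the value of \<open>h / g\<close> at \<open>X\<close>, or 0 if this
  quotient vanishes there; it lies in \<open>L\<close> because the decomposition of the quotient is
  made over \<open>L\<close>.\<close>

lemma leading_coefficient:
  assumes L: "is_subfield L" "wc_in L E" "point_in L X"
    and h: "h \<in> ratfuns F L" "ordge X m h" and g: "g \<in> ratfuns F L" "ordeq X m g"
  shows "\<exists>c\<in>L. ordge X (m + 1) (h - const c * g)"
proof (cases "h = 0")
  case True
  then show ?thesis using is_subfieldD(1)[OF L(1)] by (intro bexI[of _ 0]) (simp_all add: ordge_zero)
next
  case False
  have g0: "g \<noteq> 0" using ordeq_nonzero[OF g(2)] .
  have "h / g \<in> ratfuns F L" "h / g \<noteq> 0"
    using h(1) g(1) g0 False is_subfield_ratfuns by (auto intro: is_subfield_divide)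
  then obtain k w v where w: "val L X w v" "v \<noteq> 0" "h / g = w * uf X powi k"
    using ratfuns_decomp[OF X L] by blast
  have vL: "v \<in> L" using val_in[OF L(1,3) w(1)] .
  have "ordge X (m + - m) (h / g)"
    unfolding divide_inverse by (intro ordge_mult h(2) ordeq_ordge ordeq_inverse g(2))
  moreover have "ordeq X k (h / g)" unfolding ordeq_def using w val_UNIV by blast
  ultimately have k: "0 \<le> k" using ordeq_ordge_le by fastforce
  have "\<exists>c\<in>L. ordge X 1 (h / g - const c)"
  proof (cases "k = 0")
    case True
    then have "h / g = w" using w(3) by simp
    then have "val UNIV X (h / g - const v) (v - v)"
      by (simp only:) (intro val_diff val_const val_UNIV[OF w(1)] X is_subfield_UNIV wc_in_UNIV UNIV_I)
    then have "val UNIV X (h / g - const v) 0" by simp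
    then obtain w' v' where "val UNIV X w' v'" "h / g - const v = w' * uf X"
      using val_eq_0_step[OF X is_subfield_UNIV wc_in_UNIV point_in_UNIV] by blast
    then have "ordge X 1 (h / g - const v)" unfolding ordge_def by auto
    then show ?thesis using vL by blast
  next
    case False
    then have "ordge X 1 (h / g)"
      using ordge_mono[OF ordeq_ordge[OF \<open>ordeq X k (h / g)\<close>], of 1] k by simp
    then show ?thesis using is_subfieldD(1)[OF L(1)] by (intro bexI[of _ 0]) simp_all
  qed
  then obtain c where c: "c \<in> L" "ordge X 1 (h / g - const c)" by blast
  have "h - const c * g = g * (h / g - const c)" using g0 by (simp add: algebra_simps)
  then have "ordge X (m + 1) (h - const c * g)"
    using ordge_mult[OF ordeq_ordge[OF g(2)] c(2)] by simp
  then show ?thesis using c(1) by blast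
qed

text \<open>As for a power series, leading terms are subtracted one at a time, with
  \<open>g k\<close> in the place of the k-th power of a uniformizer.\<close>

lemma ordered_family_expansion:
  assumes L: "is_subfield L" "wc_in L E" "point_in L X"
    and g: "\<And>k. k < n \<Longrightarrow> g k \<in> ratfuns F L" "\<And>k. k < n \<Longrightarrow> ordeq X (int k) (g k)"
    and h: "h \<in> ratfuns F L" "ordge X 0 h"
  shows "\<exists>c. (\<forall>k<n. c k \<in> L) \<and> ordge X (int n) (h - (\<Sum>k<n. const (c k) * g k))"
  using g
proof (induction n)
  case 0
  then show ?case using h(2) by simp
next
  case (Suc n)
  then obtain c where c: "\<forall>k<n. c k \<in> L" "ordge X (int n) (h - (\<Sum>k<n. const (c k) * g k))"
    using less_Suc_eq by metis
  have "h - (\<Sum>k<n. const (c k) * g k) \<in> ratfuns F L"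
    using h(1) c(1) Suc.prems(1)
    by (intro is_subfield_diff is_subfield_sum is_subfieldD(4) is_subfield_ratfuns const_in_ratfuns) auto
  then obtain d where d: "d \<in> L" "ordge X (int n + 1) (h - (\<Sum>k<n. const (c k) * g k) - const d * g n)"
    using leading_coefficient[OF L _ c(2), of "g n"] Suc.prems by blast
  define c' where "c' = c(n := d)"
  have "(\<Sum>k<n. const (c' k) * g k) = (\<Sum>k<n. const (c k) * g k)"
    by (intro sum.cong) (auto simp: c'_def)
  then have "ordge X (int (Suc n)) (h - (\<Sum>k<Suc n. const (c' k) * g k))"
    using d(2) by (simp add: c'_def algebra_simps)
  moreover have "\<forall>k<Suc n. c' k \<in> L" using c(1) d(1) by (simp add: c'_def)
  ultimately show ?case by blast
qed

text \<open>Once the coefficients below \<open>k\<close> are zero, all other terms and the sum have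
  order at least k + 1, which leaves no room for a nonzero multiple of \<open>g k\<close>. The bound
  \<open>m\<close> may be smaller than \<open>n\<close>; then just the coefficients below
  \<open>m\<close> are forced to vanish.\<close>

lemma ordered_family_independent:
  assumes g: "\<And>k. k < n \<Longrightarrow> ordeq X (int k) (g k)"
    and h: "ordge X (int m) (\<Sum>k<n. const (c k) * g k)" and k: "k < n" "k < m"
  shows "c k = 0"
  using k
proof (induction k rule: less_induct)
  case (less k)
  let ?s = "\<lambda>A. \<Sum>k\<in>A. const (c k) * g k"
  have "?s {..<n} = ?s {..<k} + ?s {k..<n}"
    using less.prems by (subst sum.union_disjoint[symmetric]) (auto intro!: sum.cong)
  also have "?s {..<k} = 0" using less by (intro sum.neutral) auto
  also have "?s {k..<n} = const (c k) * g k + ?s {Suc k..<n}"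
    using less.prems by (simp add: sum.atLeast_Suc_lessThan)
  finally have eq: "const (c k) * g k = ?s {..<n} - ?s {Suc k..<n}" by simp
  have "ordge X (int k + 1) (?s {..<n})" using ordge_mono[OF h] less.prems by simp
  moreover have "ordge X (int k + 1) (?s {Suc k..<n})"
    using ordge_mono[OF ordeq_ordge[OF g]] by (intro ordge_sum ordge_const_mult) auto
  ultimately have ge: "ordge X (int k + 1) (const (c k) * g k)" unfolding eq by (rule ordge_diff)
  show "c k = 0"
  proof (rule ccontr)
    assume "c k \<noteq> 0"
    then have "ordeq X (0 + int k) (const (c k) * g k)"
      using less.prems g by (intro ordeq_mult ordeq_const) auto
    then show False using ordeq_ordge_le[OF _ ge] by fastforce
  qed
qed

end


text \<open>The value at a point over \<open>L\<close> gives some \<open>d\<close> in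
  \<open>L\<close>, and then c - d is a constant of positive order, hence zero.\<close>

lemma const_in_ratfunsD:
  assumes X: "aff X" and L: "is_subfield L" "wc_in L E" "point_in L X" and c: "const c \<in> ratfuns F L"
  shows "c \<in> L"
proof -
  have "1 \<in> ratfuns F L" using is_subfieldD(2)[OF is_subfield_ratfuns] .
  then obtain d where d: "d \<in> L" "ordge X (0 + 1) (const c - const d * 1)"
    using leading_coefficient[OF X L c ordge_const[OF X] _ ordeq_one[OF X]] by blast
  then have d1: "ordge X 1 (const (c - d))" by (simp add: const_diff)
  have "c - d = 0"
  proof (rule ccontr)
    assume "c - d \<noteq> 0"
    then show False using ordeq_ordge_le[OF X ordeq_const[OF X] d1] by simp
  qed
  then show ?thesis using d(1) by simp
qed

section \<open>The point at infinity and functions without affine poles\<close>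

text \<open>The function t/y is a uniformizer because t and y have degrees 2 and 3, so that
  quotients of all degree differences arise from its powers and units.\<close>

lemma ord_at_infinity:
  assumes p: "p \<noteq> (0, 0)" and r: "r \<noteq> (0, 0)"
  shows "ord_at F Infinity (ev p / ev r) = int (pf_deg r) - int (pf_deg p)"
proof -
  define M where "M = (\<lambda>k. (monom 1 k, 0) :: 'c polyfun)"
  define PY where "PY = (\<lambda>k. (pf_mul E (0, 1) ^^ k) (1, 0))"
  have evM: "ev (M k) = T ^ k" for k
    by (induction k) (simp_all add: M_def ev_poly monom_Suc)
  have M: "M k \<noteq> (0, 0)" "pf_deg (M k) = 2 * k" for k
    by (simp_all add: M_def pf_deg_def degree_monom_eq monom_eq_0_iff)
  have evPY: "ev (PY k) = Y ^ k" for k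
    by (induction k) (simp_all add: PY_def ev_1 ev_mul ev_Y)
  have PY: "PY k \<noteq> (0, 0) \<and> pf_deg (PY k) = 3 * k" for k
  proof (induction k)
    case 0
    show ?case by (simp add: PY_def pf_deg_def)
  next
    case (Suc k)
    have "PY (Suc k) = pf_mul E (0, 1) (PY k)" by (simp add: PY_def)
    then show ?case using Suc pf_deg_mul[of "(0, 1)" "PY k" E]
      by (simp add: pf_mul_eq_0_iff) (simp add: pf_deg_def)
  qed
  have T0: "T \<noteq> 0" and Y0: "Y \<noteq> 0" using ev_eq_0_iff[of "([:0, 1:], 0)"] ev_eq_0_iff[of "(0, 1)"]
    by (simp_all add: ev_T ev_Y del: ev_eq_0_iff)
  let ?O = "local_ring F Infinity" and ?m = "local_max_ideal F Infinity"
  have O_I: "h \<in> ?O" if "h = ev p / ev r" "r \<noteq> (0, 0)" "p = (0, 0) \<or> pf_deg p \<le> pf_deg r" for h p r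
    using that unfolding local_ring.simps by blast
  have O_E: "\<exists>p r. h = ev p / ev r \<and> r \<noteq> (0, 0) \<and> (p = (0, 0) \<or> pf_deg p \<le> pf_deg r)" if "h \<in> ?O" for h
    using that unfolding local_ring.simps by blast
  have m_I: "h \<in> ?m" if "h = ev p / ev r" "r \<noteq> (0, 0)" "p = (0, 0) \<or> pf_deg p < pf_deg r" for h p r
    using that unfolding local_max_ideal.simps by blast
  have m_E: "\<exists>p r. h = ev p / ev r \<and> r \<noteq> (0, 0) \<and> (p = (0, 0) \<or> pf_deg p < pf_deg r)" if "h \<in> ?m" for h
    using that unfolding local_max_ideal.simps by blast
  define d e where "d = pf_deg p" and "e = pf_deg r"
  \<comment> \<open>The unit \<open>w\<close> is the given quotient times (t/y)^(d - e), with
    negative powers moved across the fraction bar; numerator and denominator both have degree 3 d +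
    3 e.\<close>
  define w1 where "w1 = pf_mul E p (pf_mul E (M d) (PY e))"
  define w2 where "w2 = pf_mul E r (pf_mul E (M e) (PY d))"
  define w where "w = ev w1 / ev w2"
  have deg: "pf_deg w1 = pf_deg w2" "w1 \<noteq> (0, 0)" "w2 \<noteq> (0, 0)"
    using p r M PY by (simp_all add: pf_deg_mul w1_def w2_def d_def e_def pf_mul_eq_0_iff)
  show ?thesis
  proof (rule ord_at_eqI[where u = "T / Y" and w = w])
    show "?m \<subseteq> ?O"
    proof
      fix h assume "h \<in> ?m"
      then show "h \<in> ?O" using m_E[of h] O_I[of h] by (metis less_imp_le)
    qed
    show "1 \<in> ?O" by (rule O_I[of _ "(1, 0)" "(1, 0)"]) (simp_all add: ev_1)
    show "1 \<notin> ?m"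
    proof
      assume "1 \<in> ?m"
      then obtain p r where pr: "1 = ev p / ev r" "r \<noteq> (0, 0)" "p = (0, 0) \<or> pf_deg p < pf_deg r"
        using m_E by blast
      then have "ev p = ev r" by simp
      then have "p = r" by (rule ev_inj)
      then show False using pr by simp
    qed
    show "a * b \<in> ?O" if ab: "a \<in> ?O" "b \<in> ?O" for a b
    proof -
      obtain p r p' r' where 1: "a = ev p / ev r" "r \<noteq> (0, 0)" "p = (0, 0) \<or> pf_deg p \<le> pf_deg r"
        "b = ev p' / ev r'" "r' \<noteq> (0, 0)" "p' = (0, 0) \<or> pf_deg p' \<le> pf_deg r'"
        using O_E[OF ab(1)] O_E[OF ab(2)] by blast
      show ?thesis
      proof (rule O_I[of _ "pf_mul E p p'" "pf_mul E r r'"])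
        show "pf_mul E p p' = (0, 0) \<or> pf_deg (pf_mul E p p') \<le> pf_deg (pf_mul E r r')"
          using 1 by (cases "p = (0, 0) \<or> p' = (0, 0)") (auto simp: pf_mul_eq_0_iff pf_deg_mul)
      qed (use 1 in \<open>simp_all add: ev_mul pf_mul_eq_0_iff\<close>)
    qed
    show "T / Y \<noteq> 0" using T0 Y0 by simp
    show "uniformizer F Infinity (T / Y)"
      unfolding uniformizer_def
    proof (intro Set.set_eqI iffI)
      fix h assume "h \<in> ?m"
      then obtain p r where pr: "h = ev p / ev r" "r \<noteq> (0, 0)" "p = (0, 0) \<or> pf_deg p < pf_deg r"
        using m_E by blast
      have "ev (pf_mul E p (PY 1)) / ev (pf_mul E r (M 1)) \<in> ?O"
      proof (rule O_I[OF refl])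
        show "pf_mul E p (PY 1) = (0, 0) \<or> pf_deg (pf_mul E p (PY 1)) \<le> pf_deg (pf_mul E r (M 1))"
          using pr(2,3) M[of 1] PY[of 1] by (cases "p = (0, 0)") (auto simp: pf_mul_eq_0_iff pf_deg_mul)
      qed (use pr M PY in \<open>simp_all add: pf_mul_eq_0_iff\<close>)
      moreover have "h = T / Y * (ev (pf_mul E p (PY 1)) / ev (pf_mul E r (M 1)))"
        using T0 Y0 by (simp add: pr(1) ev_mul evM evPY del: One_nat_def)
      ultimately show "h \<in> {T / Y * h |h. h \<in> ?O}" by blast
    next
      fix h assume "h \<in> {T / Y * h |h. h \<in> ?O}"
      then obtain h' where h': "h = T / Y * h'" "h' \<in> ?O" by blast
      then obtain p r where pr: "h' = ev p / ev r" "r \<noteq> (0, 0)" "p = (0, 0) \<or> pf_deg p \<le> pf_deg r"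
        using O_E by blast
      show "h \<in> ?m"
      proof (rule m_I[of _ "pf_mul E p (M 1)" "pf_mul E r (PY 1)"])
        show "h = ev (pf_mul E p (M 1)) / ev (pf_mul E r (PY 1))"
          by (simp add: h'(1) pr(1) ev_mul evM evPY mult_ac del: One_nat_def)
        show "pf_mul E p (M 1) = (0, 0) \<or> pf_deg (pf_mul E p (M 1)) < pf_deg (pf_mul E r (PY 1))"
          using pr(2,3) M[of 1] PY[of 1] by (cases "p = (0, 0)") (auto simp: pf_mul_eq_0_iff pf_deg_mul)
      qed (use pr PY in \<open>simp_all add: pf_mul_eq_0_iff\<close>)
    qed
    show "w \<noteq> 0" using deg by (simp add: w_def)
    show "w \<in> ?O" by (rule O_I[OF w_def]) (use deg in simp_all)
    show "inverse w \<in> ?O"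
      by (rule O_I[of _ w2 w1]) (use deg in \<open>simp_all add: w_def\<close>)
    have "ev r \<noteq> 0" using r by simp
    then show "ev p / ev r = w * (T / Y) powi (int (pf_deg r) - int (pf_deg p))"
      using T0 Y0 unfolding d_def[symmetric] e_def[symmetric]
      by (simp add: w_def w1_def w2_def ev_mul evM evPY power_int_diff power_divide field_simps)
  qed
qed

text \<open>Over \<open>x\<close> lie either two points or a single ramified one. With two points,
  vanishing of a + b y at both makes \<open>x\<close> a root of a and of b. At a ramified point
  vanishing gives only one condition, and regularity of the quotient by t - x, which has order 2
  there, must be used in full.\<close>

lemma dvd_components_of_regular:
  assumes reg: "\<And>y. on_curve E (Affine x y) \<Longrightarrow> \<exists>v. val UNIV (Affine x y) (ev p / pc [:- x, 1:]) v"
  shows "\<exists>p'. ev p = pc [:- x, 1:] * ev p'"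
proof -
  obtain a b where p: "p = (a, b)" by (cases p)
  let ?l = "[:- x, 1:] :: 'c poly"
  have "\<exists>y. y^2 + poly (pf_L E) x * y - poly (pf_G E) x = 0"
  proof -
    have "degree [:- poly (pf_G E) x, poly (pf_L E) x, 1:] = 2" by simp
    then obtain y where "poly [:- poly (pf_G E) x, poly (pf_L E) x, 1:] y = 0"
      using alg_closed_imp_poly_has_root by (metis less_2_cases_iff zero_less_numeral)
    then show ?thesis by (intro exI[of _ y]) (simp add: algebra_simps power2_eq_square)
  qed
  then obtain y where y: "y^2 + poly (pf_L E) x * y = poly (pf_G E) x" by auto
  have curve: "on_curve E (Affine x z) \<longleftrightarrow> z^2 + poly (pf_L E) x * z = poly (pf_G E) x" for z
    by (auto simp: pf_L_def pf_G_def algebra_simps power2_eq_square power3_eq_cube)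
  \<comment> \<open>The second root of the quadratic equation for y over \<open>x\<close>.\<close>
  define y' where "y' = - y - poly (pf_L E) x"
  have on: "on_curve E (Affine x y)" using y by (simp only: curve)
  have "y'^2 + poly (pf_L E) x * y' = y^2 + poly (pf_L E) x * y"
    by (simp add: y'_def algebra_simps power2_eq_square)
  then have on': "on_curve E (Affine x y')" using y by (simp only: curve)
  have quot: "\<exists>r s. pf_value r x z \<noteq> 0 \<and> pf_mul E p r = pf_mul E (?l, 0) s"
    if z: "on_curve E (Affine x z)" for z
  proof -
    obtain v where "val UNIV (Affine x z) (ev p / pc ?l) v" using reg[OF z] by blast
    then obtain s r where r: "pf_value r x z \<noteq> 0" "ev p / pc ?l = ev s / ev r"
      unfolding val_def by auto
    have "pc ?l \<noteq> 0" using ev_eq_0_iff[of "(?l, 0)"] by (simp add: ev_poly del: ev_eq_0_iff pc_pCons)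
    moreover have "ev r \<noteq> 0" using r(1) by (auto simp: pf_value_def)
    ultimately have "ev p * ev r = pc ?l * ev s" using r(2) by (simp add: frac_eq_eq mult.commute del: pc_pCons)
    then have "pf_mul E p r = pf_mul E (?l, 0) s" by (intro ev_inj) (simp add: ev_mul ev_poly del: pc_pCons)
    then show ?thesis using r(1) by blast
  qed
  have vanish: "pf_value p x z = 0" if z: "on_curve E (Affine x z)" for z
  proof -
    obtain r s where r: "pf_value r x z \<noteq> 0" "pf_mul E p r = pf_mul E (?l, 0) s" using quot[OF z] by blast
    have "pf_value p x z * pf_value r x z = pf_value (?l, 0) x z * pf_value s x z"
      using r(2) by (simp flip: pf_value_mul[OF z])
    then show ?thesis using r(1) by (simp add: pf_value_def)
  qed
  have "?l dvd a \<and> ?l dvd b"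
  proof (cases "y = y'")
    case False
    have "poly a x + poly b x * y = 0" "poly a x + poly b x * y' = 0"
      using vanish[OF on] vanish[OF on'] by (simp_all add: p pf_value_def)
    moreover have "poly b x * (y - y') = (poly a x + poly b x * y) - (poly a x + poly b x * y')"
      by (simp add: algebra_simps)
    ultimately show ?thesis using False by (simp add: poly_eq_0_iff_dvd[symmetric])
  next
    case True
    obtain r s where r: "pf_value r x y \<noteq> 0" "pf_mul E p r = pf_mul E (?l, 0) s" using quot[OF on] by blast
    \<comment> \<open>Multiplying by the conjugate of \<open>r\<close> replaces it by its norm, a
      polynomial in t, so that the two components separate. The norm is nonzero at \<open>x\<close>,
      as the point is its own conjugate.\<close>
    have "pf_mul E p (pf_norm E r, 0) = pf_mul E (?l, 0) (pf_mul E s (pf_conj E r))"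
      using r(2) by (metis pf_mul_assoc pf_mul_conj)
    then have "a * pf_norm E r = ?l * fst (pf_mul E s (pf_conj E r))"
      "b * pf_norm E r = ?l * snd (pf_mul E s (pf_conj E r))"
      by (simp_all add: p pf_mul_def del: mult_pCons_left mult_pCons_right)
    then have dvd: "?l dvd a * pf_norm E r" "?l dvd b * pf_norm E r" by (metis dvd_triv_left)+
    have "pf_value (pf_conj E r) x y = pf_value r x y'"
      by (simp add: pf_value_def pf_conj_def y'_def algebra_simps)
    then have "poly (pf_norm E r) x = pf_value r x y * pf_value r x y"
      using pf_value_mul[OF on, of r "pf_conj E r"] True by (simp add: pf_mul_conj) (simp add: pf_value_def)
    then have "poly (pf_norm E r) x \<noteq> 0" using r(1) by simp
    then show ?thesis using dvd by (simp add: poly_eq_0_iff_dvd[symmetric])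
  qed
  then obtain a' b' where "a = ?l * a'" "b = ?l * b'" by (auto elim!: dvdE)
  then have "ev p = pc ?l * ev (a', b')" by (simp only: p ev_eq fst_conv snd_conv pc_mult) (simp add: algebra_simps)
  then show ?thesis by blast
qed

text \<open>Multiplication by the conjugate of the denominator makes the denominator a polynomial in
  t. Its linear factors can then be cancelled one after another, because regularity at all points
  over a root lets the numerator absorb the factor.\<close>

lemma regular_imp_ev:
  assumes h: "h \<in> ratfuns F UNIV" and reg: "\<And>X. aff X \<Longrightarrow> ordge X 0 h"
  shows "\<exists>p. h = ev p"
proof -
  obtain p r where pr: "h = ev p / ev r" "r \<noteq> (0, 0)" using h by (auto simp: ratfuns_eq)
  have norm: "ev r * ev (pf_conj E r) = pc (pf_norm E r)"
    by (metis ev_mul ev_poly pf_mul_conj)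
  have "h * ev r = ev p" using pr by simp
  then have "h * pc (pf_norm E r) = ev (pf_mul E p (pf_conj E r))"
    by (simp add: ev_mul flip: norm mult.assoc)
  moreover have "pf_norm E r \<noteq> 0" using pr(2) by (simp add: pf_norm_eq_0_iff)
  ultimately obtain N p where N: "h * pc N = ev p" "N \<noteq> 0" by blast
  have "\<exists>p. h = ev p" if "degree N = m" "h * pc N = ev p" "N \<noteq> 0" for m N p
    using that
  proof (induction m arbitrary: N p)
    case 0
    then obtain c where c: "N = [:c:]" "c \<noteq> 0" by (metis degree_eq_zeroE pCons_0_0)
    have "ev p = h * const c" using 0(2) by (simp add: c(1))
    then have "h = ev (pf_mul E ([:inverse c:], 0) p)"
      using c(2) by (simp add: ev_mul ev_const const_inverse)
    then show ?case by blast
  next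
    case (Suc m)
    then obtain x where "poly N x = 0" using alg_closed_imp_poly_has_root[of N] by auto
    then obtain N' where N': "N = [:- x, 1:] * N'" by (auto simp: poly_eq_0_iff_dvd elim: dvdE)
    then have N'0: "N' \<noteq> 0" using Suc.prems(3) by auto
    then have "degree N' = m" using Suc.prems(1) by (simp add: N' degree_mult_eq del: mult_pCons_left)
    have l0: "pc [:- x, 1:] \<noteq> 0" using ev_eq_0_iff[of "([:- x, 1:], 0)"] by (simp add: ev_poly del: ev_eq_0_iff pc_pCons)
    have eq: "ev p = pc [:- x, 1:] * (h * pc N')"
      using Suc.prems(2) by (simp only: N' pc_mult mult_ac)
    have "\<exists>v. val UNIV (Affine x y) (ev p / pc [:- x, 1:]) v" if on: "on_curve E (Affine x y)" for y
    proof -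
      have X: "aff (Affine x y)" using on by (simp add: aff_def)
      have "\<exists>v. val UNIV (Affine x y) h v" using reg[OF X] by (simp add: ordge_0_iff[OF X])
      then have "\<exists>v. val UNIV (Affine x y) (h * ev (N', 0)) v"
        using val_mult[OF X is_subfield_UNIV wc_in_UNIV _ val_ev[OF X is_subfield_UNIV coeffs_in_UNIV]] by blast
      then show ?thesis using l0 by (simp add: eq ev_poly del: pc_pCons)
    qed
    then obtain p' where "ev p = pc [:- x, 1:] * ev p'" using dvd_components_of_regular by blast
    then have "h * pc N' = ev p'" using eq l0 by (simp del: pc_pCons)
    then show ?case using Suc.IH[OF \<open>degree N' = m\<close> _ N'0] by blast
  qed
  then show ?thesis using N by blast
qed

end

section \<open>Frobenius twisting\<close>

locale frobenius_curve = curve_field E F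
  for E :: "'c::alg_closed_field weierstrass" and F :: "('c, 'f::field) function_field" +
  fixes q :: nat
  assumes q_pos: "q > 0"
    and frob_add: "(a + b) ^ q = a ^ q + (b::'c) ^ q"
    and wc_frob: "wc1 E ^ q = wc1 E" "wc2 E ^ q = wc2 E" "wc3 E ^ q = wc3 E" "wc4 E ^ q = wc4 E"
      "wc6 E ^ q = wc6 E"
begin

abbreviation "fr \<equiv> map_poly (\<lambda>c. c ^ q)"
abbreviation "tw \<equiv> twist q F"
abbreviation "fp \<equiv> frob_point q"

lemma frob_0 [simp]: "(0::'c) ^ q = 0"
  using q_pos by simp

lemma frob_minus: "(- a) ^ q = - ((a::'c) ^ q)"
  using frob_add[of a "- a"] by (simp add: eq_neg_iff_add_eq_0 add.commute)

lemma frob_diff: "(a - b) ^ q = a ^ q - (b::'c) ^ q"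
  using frob_add[of a "- b"] by (simp add: frob_minus)

lemma frob_sum: "(sum h I) ^ q = (\<Sum>i\<in>I. (h i :: 'c) ^ q)"
  by (induction I rule: infinite_finite_induct) (auto simp: frob_add)

lemma frob_numeral: "(numeral m :: 'c) ^ q = numeral m"
proof -
  have "(of_nat i :: 'c) ^ q = of_nat i" for i
    by (induction i) (auto simp: frob_add)
  from this[of "numeral m"] show ?thesis by simp
qed

lemma frob_inj: "(a::'c) ^ q = b ^ q \<Longrightarrow> a = b"
  using frob_diff[of a b] by simp

lemma frob_surj: "\<exists>b::'c. b ^ q = a"
  using nth_root_exists[OF q_pos] by blast

lemma fr_add: "fr (a + b) = fr a + fr (b :: 'c poly)"
  by (rule poly_eqI) (simp add: coeff_map_poly frob_add)

lemma fr_diff: "fr (a - b) = fr a - fr (b :: 'c poly)"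
  by (rule poly_eqI) (simp add: coeff_map_poly frob_diff)

lemma fr_mult: "fr (a * b) = fr a * fr (b :: 'c poly)"
  by (rule poly_eqI) (simp add: coeff_map_poly coeff_mult frob_sum power_mult_distrib)

lemma fr_pCons [simp]: "fr (pCons c a) = pCons (c ^ q) (fr (a :: 'c poly))"
  by (simp add: map_poly_pCons)

lemma fr_1 [simp]: "fr 1 = (1 :: 'c poly)"
  by (simp add: one_pCons)

lemma fr_LG: "fr (pf_L E) = pf_L E" "fr (pf_G E) = pf_G E"
  by (simp_all add: pf_L_def pf_G_def wc_frob)

lemma poly_fr: "poly (fr a) (x ^ q) = (poly a x :: 'c) ^ q"
  by (induction a) (simp_all add: frob_add power_mult_distrib)

lemma fr_eq_0_iff: "fr a = 0 \<longleftrightarrow> (a :: 'c poly) = 0"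
  using q_pos by (auto simp: poly_eq_iff coeff_map_poly)

lemma pf_twist_mul: "pf_twist q (pf_mul E p r) = pf_mul E (pf_twist q p) (pf_twist q r)"
  by (simp add: pf_twist_def pf_mul_def fr_add fr_diff fr_mult fr_LG)

lemma pf_twist_add: "pf_twist q (pf_add p r) = pf_add (pf_twist q p) (pf_twist q r)"
  by (simp add: pf_twist_def pf_add_def fr_add)

lemma pf_twist_eq_0_iff: "pf_twist q p = (0, 0) \<longleftrightarrow> p = (0, 0 :: 'c poly)"
  by (cases p) (simp add: pf_twist_def fr_eq_0_iff)

lemma pfv_twist: "pfv (pf_twist q p) (fp X) = pfv p X ^ q"
  by (cases X) (simp_all add: pfv_def pf_twist_def pf_value_def poly_fr frob_add power_mult_distrib)

lemma coeffs_in_twist: "is_subfield (L :: 'c set) \<Longrightarrow> coeffs_in L p \<Longrightarrow> coeffs_in L (pf_twist q p)"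
  by (auto simp: coeffs_in_def pf_twist_def coeff_map_poly intro: is_subfield_power)

text \<open>Independence of the representing fraction holds because \<open>pf_twist\<close> respects
  products, the Weierstrass coefficients being fixed by the q-th power map.\<close>

lemma tw_frac:
  assumes r: "r \<noteq> (0, 0)"
  shows "tw (ev p / ev r) = ev (pf_twist q p) / ev (pf_twist q r)"
  unfolding twist_def
proof (rule the_equality)
  fix h' assume "\<exists>p' r'. r' \<noteq> (0, 0) \<and> ev p / ev r = ev p' / ev r' \<and>
      h' = ev (pf_twist q p') / ev (pf_twist q r')"
  then obtain p' r' where pr': "r' \<noteq> (0, 0)" "ev p / ev r = ev p' / ev r'"
    "h' = ev (pf_twist q p') / ev (pf_twist q r')" by blast
  then have "ev (pf_mul E p r') = ev (pf_mul E p' r)" using r by (simp add: frac_eq_eq ev_mul)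
  then have "pf_mul E p r' = pf_mul E p' r" by (rule ev_inj)
  then have "pf_mul E (pf_twist q p) (pf_twist q r') = pf_mul E (pf_twist q p') (pf_twist q r)"
    by (simp flip: pf_twist_mul)
  then have "ev (pf_twist q p) * ev (pf_twist q r') = ev (pf_twist q p') * ev (pf_twist q r)"
    by (simp flip: ev_mul)
  then show "h' = ev (pf_twist q p) / ev (pf_twist q r)"
    using pr' r by (simp add: frac_eq_eq pf_twist_eq_0_iff)
qed (use r in blast)

lemma tw_ev: "tw (ev p) = ev (pf_twist q p)"
  using tw_frac[of "(1, 0)" p] by (simp add: ev_1 pf_twist_def)

lemma tw_in:
  assumes L: "is_subfield L" "wc_in L E" and h: "h \<in> ratfuns F L"
  shows "tw h \<in> ratfuns F L"
proof -
  obtain p r where pr: "h = ev p / ev r" "coeffs_in L p" "coeffs_in L r" "r \<noteq> (0, 0)"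
    using h unfolding ratfuns_eq[OF L] by blast
  show ?thesis
    unfolding pr(1) tw_frac[OF pr(4)] using pr(2,3)
    by (intro is_subfield_divide is_subfield_ratfuns ev_in_ratfuns coeffs_in_twist L(1))
qed

lemma ratfuns_UNIV_E:
  assumes "h \<in> ratfuns F UNIV"
  obtains p r where "h = ev p / ev r" "r \<noteq> (0, 0)"
  using assms by (auto simp: ratfuns_eq)

lemma tw_add:
  assumes "h \<in> ratfuns F UNIV" "h' \<in> ratfuns F UNIV"
  shows "tw (h + h') = tw h + tw h'"
proof -
  obtain p r where 1: "h = ev p / ev r" "r \<noteq> (0, 0)" using assms(1) by (rule ratfuns_UNIV_E)
  obtain p' r' where 2: "h' = ev p' / ev r'" "r' \<noteq> (0, 0)" using assms(2) by (rule ratfuns_UNIV_E)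
  have nz: "ev r \<noteq> 0" "ev r' \<noteq> 0" "ev (pf_twist q r) \<noteq> 0" "ev (pf_twist q r') \<noteq> 0"
    using 1(2) 2(2) by (simp_all add: pf_twist_eq_0_iff)
  have "h + h' = ev (pf_add (pf_mul E p r') (pf_mul E p' r)) / ev (pf_mul E r r')"
    using 1 2 nz by (simp add: ev_add ev_mul add_frac_eq)
  also have "tw \<dots> = ev (pf_twist q (pf_add (pf_mul E p r') (pf_mul E p' r))) / ev (pf_twist q (pf_mul E r r'))"
    by (rule tw_frac) (use 1 2 in \<open>simp add: pf_mul_eq_0_iff\<close>)
  also have "\<dots> = tw h + tw h'"
    using nz by (simp add: 1(1) 2(1) tw_frac 1(2) 2(2) pf_twist_add pf_twist_mul ev_add ev_mul add_frac_eq)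
  finally show ?thesis .
qed

lemma tw_mult:
  assumes "h \<in> ratfuns F UNIV" "h' \<in> ratfuns F UNIV"
  shows "tw (h * h') = tw h * tw h'"
proof -
  obtain p r where 1: "h = ev p / ev r" "r \<noteq> (0, 0)" using assms(1) by (rule ratfuns_UNIV_E)
  obtain p' r' where 2: "h' = ev p' / ev r'" "r' \<noteq> (0, 0)" using assms(2) by (rule ratfuns_UNIV_E)
  have "h * h' = ev (pf_mul E p p') / ev (pf_mul E r r')" by (simp add: 1 2 ev_mul)
  also have "tw \<dots> = ev (pf_twist q (pf_mul E p p')) / ev (pf_twist q (pf_mul E r r'))"
    by (rule tw_frac) (use 1 2 in \<open>simp add: pf_mul_eq_0_iff\<close>)
  also have "\<dots> = tw h * tw h'"
    by (simp add: 1(1) 2(1) tw_frac 1(2) 2(2) pf_twist_mul ev_mul)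
  finally show ?thesis .
qed

lemma tw_const: "tw (const c) = const (c ^ q)"
  by (simp add: tw_ev pf_twist_def flip: ev_const)

lemma tw_0 [simp]: "tw 0 = 0" and tw_1 [simp]: "tw 1 = 1"
  using tw_const[of 0] tw_const[of 1] by simp_all

lemma tw_eq_0: "h \<in> ratfuns F UNIV \<Longrightarrow> tw h = 0 \<Longrightarrow> h = 0"
  by (erule ratfuns_UNIV_E) (simp add: tw_frac pf_twist_eq_0_iff)

lemma tw_inverse:
  assumes "h \<in> ratfuns F UNIV"
  shows "tw (inverse h) = inverse (tw h)"
proof (cases "h = 0")
  case False
  have "tw h * tw (inverse h) = 1"
    using tw_mult[OF assms is_subfieldD(6)[OF is_subfield_ratfuns assms]] False by simp
  then show ?thesis by (metis inverse_unique)
qed simp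

lemma tw_divide:
  "h \<in> ratfuns F UNIV \<Longrightarrow> h' \<in> ratfuns F UNIV \<Longrightarrow> tw (h / h') = tw h / tw h'"
  by (simp add: divide_inverse tw_mult tw_inverse is_subfieldD(6)[OF is_subfield_ratfuns])

lemma tw_power: "h \<in> ratfuns F UNIV \<Longrightarrow> tw (h ^ m) = tw h ^ m"
  by (induction m) (simp_all add: tw_mult is_subfield_power[OF is_subfield_ratfuns])

lemma tw_power_int: "h \<in> ratfuns F UNIV \<Longrightarrow> tw (h powi m) = tw h powi m"
  by (simp add: power_int_def tw_power tw_inverse is_subfieldD(6)[OF is_subfield_ratfuns]
      del: power_inverse flip: power_inverse)

lemma tw_sum: "(\<And>i. i \<in> I \<Longrightarrow> h i \<in> ratfuns F UNIV) \<Longrightarrow> tw (sum h I) = (\<Sum>i\<in>I. tw (h i))"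
  by (induction I rule: infinite_finite_induct)
    (simp_all add: tw_add is_subfield_sum[OF is_subfield_ratfuns])

lemma tw_prod: "(\<And>i. i \<in> I \<Longrightarrow> h i \<in> ratfuns F UNIV) \<Longrightarrow> tw (prod h I) = (\<Prod>i\<in>I. tw (h i))"
  by (induction I rule: infinite_finite_induct)
    (simp_all add: tw_mult is_subfield_prod[OF is_subfield_ratfuns])

lemma on_curve_fp: "on_curve E (fp X) \<longleftrightarrow> on_curve E X"
proof (cases X)
  case (Affine x y)
  define l where "l = y^2 + wc1 E * x * y + wc3 E * y"
  define r where "r = x^3 + wc2 E * x^2 + wc4 E * x + wc6 E"
  have pc: "(a ^ q) ^ m = (a ^ m) ^ q" for a :: 'c and m by (simp add: mult.commute flip: power_mult)
  have "l ^ q = (y^q)^2 + wc1 E * x^q * y^q + wc3 E * y^q" "r ^ q = (x^q)^3 + wc2 E * (x^q)^2 + wc4 E * x^q + wc6 E"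
    by (simp_all add: l_def r_def frob_add power_mult_distrib wc_frob pc)
  moreover have "l ^ q = r ^ q \<longleftrightarrow> l = r" using frob_inj by blast
  ultimately show ?thesis by (simp add: Affine l_def r_def)
qed simp

lemma aff_fp: "aff X \<Longrightarrow> aff (fp X)"
  using on_curve_fp[of X] by (cases X) (auto simp: aff_def simp del: on_curve.simps)

lemma fp_inj: "fp X = fp X' \<Longrightarrow> X = (X' :: 'c point)"
  by (cases X; cases X') (auto dest: frob_inj)

text \<open>The coordinates have q-th roots since the field is algebraically closed. Orders of a
  twist at any affine point can thus be read off at the preimage of the point.\<close>

lemma aff_fp_E:
  assumes "aff X"
  obtains X' where "aff X'" "fp X' = X"
proof -
  obtain x y where X: "X = Affine x y" using assms by (rule affE)
  obtain x' y' where "x' ^ q = x" "y' ^ q = y" using frob_surj by metis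
  then have "fp (Affine x' y') = X" by (simp add: X)
  moreover from this have "aff (Affine x' y')" using assms on_curve_fp unfolding aff_def by (metis point.distinct(1))
  ultimately show ?thesis using that by blast
qed

text \<open>The y-derivative at the twisted point is the q-th power of the original one, so the same
  case of \<open>ufp\<close> applies. This lets twisting carry orders at a point over unchanged to
  its image.\<close>

lemma tw_uf: "aff X \<Longrightarrow> tw (uf X) = uf (fp X)"
proof (erule affE)
  fix x y assume X: "X = Affine x y"
  have "(2 * y + wc1 E * x + wc3 E) ^ q = 2 * y ^ q + wc1 E * x ^ q + wc3 E"
    by (simp add: frob_add power_mult_distrib wc_frob frob_numeral)
  then have "2 * y ^ q + wc1 E * x ^ q + wc3 E = 0 \<longleftrightarrow> 2 * y + wc1 E * x + wc3 E = 0"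
    using q_pos by (metis power_eq_0_iff)
  then have "pf_twist q (ufp X) = ufp (fp X)"
    by (simp add: X ufp_def pf_twist_def frob_minus)
  then show ?thesis by (simp add: uf_def tw_ev)
qed

lemma val_tw: "val UNIV X h v \<Longrightarrow> val UNIV (fp X) (tw h) (v ^ q)"
proof -
  assume "val UNIV X h v"
  then obtain p r where pr: "pfv r X \<noteq> 0" "h = ev p / ev r" "v = pfv p X / pfv r X"
    unfolding val_def by blast
  then have "r \<noteq> (0, 0)" by auto
  then have "tw h = ev (pf_twist q p) / ev (pf_twist q r)" by (simp add: pr(2) tw_frac)
  moreover have "v ^ q = pfv (pf_twist q p) (fp X) / pfv (pf_twist q r) (fp X)"
    by (simp add: pr(3) pfv_twist power_divide)
  moreover have "pfv (pf_twist q r) (fp X) \<noteq> 0" using pr(1) by (simp add: pfv_twist)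
  ultimately show ?thesis unfolding val_def using coeffs_in_UNIV by blast
qed

lemma tw_uf_powi:
  assumes X: "aff X" and w: "val UNIV X w v"
  shows "tw (w * uf X powi m) = tw w * uf (fp X) powi m"
proof -
  have u: "uf X \<in> ratfuns F UNIV" unfolding uf_def by (simp add: ev_in_ratfuns)
  have "uf X powi m \<in> ratfuns F UNIV"
    unfolding power_int_def by (auto intro!: is_subfield_power is_subfieldD is_subfield_ratfuns u)
  then show ?thesis
    using val_in_ratfuns[OF w] by (simp add: tw_mult tw_power_int[OF u] tw_uf[OF X])
qed

lemma ordge_tw: "aff X \<Longrightarrow> ordge X m h \<Longrightarrow> ordge (fp X) m (tw h)"
  unfolding ordge_def using tw_uf_powi val_tw by metis

lemma ordeq_tw: "aff X \<Longrightarrow> ordeq X m h \<Longrightarrow> ordeq (fp X) m (tw h)"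
  unfolding ordeq_def using tw_uf_powi val_tw power_not_zero by metis

abbreviation "twi \<equiv> \<lambda>i. tw ^^ i"
abbreviation "fpi \<equiv> \<lambda>i. fp ^^ i"

lemma frob_point_power: "frob_point (q ^ i) X = fpi i X"
proof (induction i)
  case 0
  show ?case by (cases X) simp_all
next
  case (Suc i)
  then have "fpi (Suc i) X = fp (frob_point (q ^ i) X)" by simp
  also have "\<dots> = frob_point (q ^ Suc i) X"
    by (cases X) (simp_all add: power_mult[symmetric] mult.commute)
  finally show ?case ..
qed

lemma aff_fpi: "aff X \<Longrightarrow> aff (fpi i X)"
  by (induction i) (auto intro: aff_fp)

lemma twi_in: "is_subfield L \<Longrightarrow> wc_in L E \<Longrightarrow> h \<in> ratfuns F L \<Longrightarrow> twi i h \<in> ratfuns F L"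
  by (induction i) (auto intro: tw_in)

lemma twi_in_UNIV: "h \<in> ratfuns F UNIV \<Longrightarrow> twi i h \<in> ratfuns F UNIV"
  by (rule twi_in) simp_all

lemma ordge_twi: "aff X \<Longrightarrow> ordge X m h \<Longrightarrow> ordge (fpi i X) m (twi i h)"
  by (induction i) (auto intro: ordge_tw aff_fpi)

lemma ordeq_twi: "aff X \<Longrightarrow> ordeq X m h \<Longrightarrow> ordeq (fpi i X) m (twi i h)"
  by (induction i) (auto intro: ordeq_tw aff_fpi)

lemma twi_const: "twi i (const c) = const (c ^ q ^ i)"
  by (induction i) (simp_all add: tw_const mult.commute flip: power_mult)

lemma twi_mult:
  "h \<in> ratfuns F UNIV \<Longrightarrow> h' \<in> ratfuns F UNIV \<Longrightarrow> twi i (h * h') = twi i h * twi i h'"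
  by (induction i) (simp_all add: tw_mult twi_in_UNIV)

lemma twi_add:
  "h \<in> ratfuns F UNIV \<Longrightarrow> h' \<in> ratfuns F UNIV \<Longrightarrow> twi i (h + h') = twi i h + twi i h'"
  by (induction i) (simp_all add: tw_add twi_in_UNIV)

lemma twi_divide:
  "h \<in> ratfuns F UNIV \<Longrightarrow> h' \<in> ratfuns F UNIV \<Longrightarrow> twi i (h / h') = twi i h / twi i h'"
  by (induction i) (simp_all add: tw_divide twi_in_UNIV)

lemma twi_power: "h \<in> ratfuns F UNIV \<Longrightarrow> twi i (h ^ m) = twi i h ^ m"
  by (induction i) (simp_all add: tw_power twi_in_UNIV)

lemma twi_sum:
  "(\<And>j. j \<in> I \<Longrightarrow> h j \<in> ratfuns F UNIV) \<Longrightarrow> twi i (sum h I) = (\<Sum>j\<in>I. twi i (h j))"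
  by (induction i) (simp_all add: tw_sum twi_in_UNIV)

lemma twi_prod:
  "(\<And>j. j \<in> I \<Longrightarrow> h j \<in> ratfuns F UNIV) \<Longrightarrow> twi i (prod h I) = (\<Prod>j\<in>I. twi i (h j))"
  by (induction i) (simp_all add: tw_prod twi_in_UNIV)

end

section \<open>Triangular Sylvester equations\<close>

text \<open>Induction from the lower left corner, with n - l + m measuring the distance: by
  triangularity the equation at (l, m) involves, besides \<open>X l m\<close>, only entries to its
  left or below it. What remains is (a' - a) \<open>X l m\<close> = 0.\<close>

lemma triangular_sylvester_zero:
  fixes d d' X :: "nat \<Rightarrow> nat \<Rightarrow> 'a::field"
  assumes d: "\<And>r k. r < n \<Longrightarrow> k < r \<Longrightarrow> d r k = 0" "\<And>r. r < n \<Longrightarrow> d r r = a"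
    and d': "\<And>r k. r < n \<Longrightarrow> k < r \<Longrightarrow> d' r k = 0" "\<And>r. r < n \<Longrightarrow> d' r r = a'"
    and "a \<noteq> a'"
    and eq: "\<And>l m. l < n \<Longrightarrow> m < n \<Longrightarrow> (\<Sum>k<n. X l k * d' k m) = (\<Sum>k<n. d l k * X k m)"
    and "l < n" "m < n"
  shows "X l m = 0"
  using \<open>l < n\<close> \<open>m < n\<close>
proof (induction "n - l + m" arbitrary: l m rule: less_induct)
  case less
  have 1: "X l k * d' k m = 0" if "k < n" "k \<noteq> m" for k
  proof (cases "k < m")
    case True
    then have "X l k = 0" using less.prems by (intro less.hyps) auto
    then show ?thesis by simp
  qed (use that d'(1)[of k m] in simp)
  have 2: "d l k * X k m = 0" if "k < n" "k \<noteq> l" for k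
  proof (cases "k < l")
    case False
    then have "n - k + m < n - l + m" using that by linarith
    then have "X k m = 0" using less.prems that by (intro less.hyps) auto
    then show ?thesis by simp
  qed (use less.prems d(1)[of l k] in simp)
  have "(\<Sum>k<n. X l k * d' k m) = X l m * d' m m"
    using sum.remove[of "{..<n}" m "\<lambda>k. X l k * d' k m"] less.prems 1 by simp
  moreover have "(\<Sum>k<n. d l k * X k m) = d l l * X l m"
    using sum.remove[of "{..<n}" l "\<lambda>k. d l k * X k m"] less.prems 2 by simp
  ultimately have "X l m * (a' - a) = 0"
    using eq[OF less.prems] less.prems d(2) d'(2) by (simp add: algebra_simps)
  then show ?case using \<open>a \<noteq> a'\<close> by simp
qed

context frobenius_curve
begin

section \<open>The action of tau\<close>

abbreviation tau_n :: "nat \<Rightarrow> 'f \<Rightarrow> 'f \<Rightarrow> 'f" where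
  "tau_n n f \<equiv> tau q F n f"

lemma tau_act_eq:
  assumes "degree p \<le> D"
  shows "tau_act q F n f p m = (\<Sum>j\<le>D. const (coeff p j) * (tau_n n f ^^ j) m)"
  unfolding tau_act_def using assms
  by (intro sum.mono_neutral_left) (auto simp: coeff_eq_0)

lemma tau_act_add:
  "tau_act q F n f (p + r) m = tau_act q F n f p m + tau_act q F n f r m"
proof -
  define D where "D = max (degree p) (degree r)"
  have "degree (p + r) \<le> D" "degree p \<le> D" "degree r \<le> D"
    by (auto simp: D_def degree_add_le_max)
  then show ?thesis
    by (simp add: tau_act_eq const_add algebra_simps sum.distrib)
qed

lemma tau_act_const [simp]: "tau_act q F n f [:c:] m = const c * m"
  by (simp add: tau_act_def)

lemma tau_pow_eq:
  assumes "f \<in> ratfuns F UNIV" "m \<in> ratfuns F UNIV"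
  shows "(tau_n n f ^^ j) m = (\<Prod>i<j. twi i f) ^ n * twi j m"
proof (induction j)
  case (Suc j)
  let ?P = "\<Prod>i<j. twi i f"
  have P: "?P \<in> ratfuns F UNIV"
    using assms(1) by (auto intro!: is_subfield_prod is_subfield_ratfuns twi_in)
  have "tw (?P ^ n * twi j m) = (\<Prod>i<j. twi (Suc i) f) ^ n * twi (Suc j) m"
    using assms P by (simp add: tw_mult tw_power tw_prod twi_in is_subfield_power is_subfield_ratfuns)
  then have "(tau_n n f ^^ Suc j) m = (f * (\<Prod>i<j. twi (Suc i) f)) ^ n * twi (Suc j) m"
    unfolding funpow.simps o_apply Suc.IH by (simp add: tau_def power_mult_distrib)
  also have "f * (\<Prod>i<j. twi (Suc i) f) = (\<Prod>i<Suc j. twi i f)"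
    by (subst prod.lessThan_Suc_shift) simp
  finally show ?case .
qed simp

end

definition pdelta :: "'c point \<Rightarrow> 'c point \<Rightarrow> int" where
  "pdelta P X = (if X = P then 1 else 0)"

text \<open>The last point in the divisor of \<open>g (Suc k)\<close> is an arbitrary \<open>R k\<close>: its description in terms
  of the group law plays no role.\<close>

locale tensor_setup = frobenius_curve E F q
  for E :: "'c::alg_closed_field weierstrass" and F :: "('c, 'f::field) function_field" and q :: nat +
  fixes H :: "'c set" and \<theta> \<eta> :: 'c and V :: "'c point" and R :: "nat \<Rightarrow> 'c point"
    and f :: 'f and g :: "nat \<Rightarrow> 'f" and n :: nat
  assumes H: "is_subfield H" "wc_in H E" "\<theta> \<in> H" "\<eta> \<in> H"
    and Xi_on: "on_curve E (Affine \<theta> \<eta>)"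
    and theta: "\<And>m. m > 0 \<Longrightarrow> \<theta> ^ (q ^ m) \<noteq> \<theta>"
    and V: "aff V"
    and f: "f \<in> ratfuns F H"
      "has_divisor E F f (pt (fp V) - pt V + pt (Affine \<theta> \<eta>) - pt Infinity)"
    and n: "n \<ge> 2"
    and g: "\<And>k. k < n \<Longrightarrow> g (Suc k) \<in> ratfuns F H"
      "\<And>k. k < n \<Longrightarrow> has_divisor E F (g (Suc k))
         (dmult (- int n) V + dmult (int n - int (Suc k)) Infinity + dmult (int k) (Affine \<theta> \<eta>) + pt (R k))"
    and relation: "\<And>a. a \<in> {T, Y} \<Longrightarrow> \<exists>!P. tensor_relation q F H n f g a P"
begin

abbreviation "Xi \<equiv> Affine \<theta> \<eta>"
abbreviation "gg k \<equiv> g (Suc k)"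
abbreviation "\<tau> \<equiv> tau_n n f"

lemma Xi: "aff Xi" "point_in H Xi"
  using Xi_on H by (auto simp: aff_def point_in_def simp del: on_curve.simps)

lemma f_UNIV: "f \<in> ratfuns F UNIV"
  using f(1) ratfuns_mono by blast

lemma gg_UNIV: "k < n \<Longrightarrow> gg k \<in> ratfuns F UNIV"
  using g(1) ratfuns_mono by blast

lemma f_nonzero: "f \<noteq> 0"
  using f(2) by (simp add: has_divisor_def)

lemma gg_nonzero: "k < n \<Longrightarrow> gg k \<noteq> 0"
  using g(2) by (simp add: has_divisor_def)

lemma f_ord: "aff X \<Longrightarrow> ordeq X (pdelta (fp V) X - pdelta V X + pdelta Xi X) f"
  using ordeq_ord_at[OF _ f_UNIV f_nonzero] f(2)
  by (auto simp: has_divisor_def aff_def lookup_add lookup_minus lookup_single pdelta_def when_def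
      simp del: on_curve.simps)

lemma f_ord_infinity: "ord_at F Infinity f = -1"
  using f(2) V aff_fp[OF V] by (auto simp: has_divisor_def aff_def lookup_add lookup_minus lookup_single)

lemma gg_ord:
  "k < n \<Longrightarrow> aff X \<Longrightarrow> ordeq X (- int n * pdelta V X + int k * pdelta Xi X + pdelta (R k) X) (gg k)"
  using ordeq_ord_at[OF _ gg_UNIV gg_nonzero, of X k] g(2)[of k]
  by (auto simp: has_divisor_def aff_def lookup_add lookup_single pdelta_def when_def
      simp del: on_curve.simps)

lemma gg_ord_infinity:
  "k < n \<Longrightarrow> ord_at F Infinity (gg k) = int n - int (Suc k) + pdelta (R k) Infinity"
  using g(2)[of k] V by (auto simp: has_divisor_def aff_def lookup_add lookup_single pdelta_def when_def)

text \<open>If they were equal, the pole of \<open>f\<close> at \<open>V\<close> would cancel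
  against its zero at \<Xi>, leaving a polynomial in t and y of degree 1.\<close>

lemma V_neq_Xi: "V \<noteq> Xi"
proof
  assume VXi: "V = Xi"
  have "ordge X 0 f" if X: "aff X" for X
    using ordge_mono[OF X ordeq_ordge[OF X f_ord[OF X]], of 0] by (simp add: VXi pdelta_def)
  then obtain p where p: "f = ev p" using regular_imp_ev[OF f_UNIV] by blast
  then have "p \<noteq> (0, 0)" using f_nonzero by (auto simp: ev_0)
  then have "- int (pf_deg p) = -1"
    using ord_at_infinity[of p "(1, 0)"] f_ord_infinity by (simp add: p ev_1) (simp add: pf_deg_def)
  then show False using pf_deg_neq_1[of p] by simp
qed

text \<open>Otherwise \<open>gg (Suc k) / gg k\<close> has at most one simple pole, hence is constant, which contradicts
  the uniqueness of the matrix in the tensor relation.\<close>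

lemma R_neq_Xi:
  assumes k: "Suc k < n"
  shows "R k \<noteq> Xi"
proof
  assume R: "R k = Xi"
  let ?h = "gg (Suc k) / gg k"
  have kn: "k < n" using k by simp
  have h: "?h \<in> ratfuns F H" using g(1)[OF k] g(1)[OF kn] is_subfield_ratfuns by (rule is_subfield_divide[rotated])
  \<comment> \<open>With \<open>R k\<close> = \<Xi> the affine divisor of \<open>gg k\<close>
    already contains \<Xi> with multiplicity k + 1, so that of the quotient is just the point
    \<open>R (Suc k)\<close>, or zero if this point is infinite.\<close>
  have "ordge X 0 ?h" if X: "aff X" for X
    using ordge_mono[OF X ordeq_ordge[OF X ordeq_divide[OF X gg_ord[OF k X] gg_ord[OF kn X]]], of 0]
    by (simp add: R algebra_simps) (simp add: pdelta_def)
  then obtain p where p: "?h = ev p" using regular_imp_ev h ratfuns_mono by blast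
  have p0: "p \<noteq> (0, 0)" using p gg_nonzero[OF k] gg_nonzero[OF kn] by (auto simp: ev_0)
  obtain a b where ab: "gg k = ev a / ev b" "b \<noteq> (0, 0)" using gg_UNIV[OF kn] by (rule ratfuns_UNIV_E)
  have a0: "a \<noteq> (0, 0)" using ab gg_nonzero[OF kn] by (auto simp: ev_0)
  have "gg (Suc k) = gg k * ev p" using p gg_nonzero[OF kn] by (simp add: field_simps)
  then have "gg (Suc k) = ev (pf_mul E a p) / ev b" by (simp add: ab(1) ev_mul)
  then have "int (pf_deg b) - int (pf_deg (pf_mul E a p)) = int n - int (Suc (Suc k)) + pdelta (R (Suc k)) Infinity"
    using gg_ord_infinity[OF k] ord_at_infinity[of "pf_mul E a p" b] a0 p0 ab(2) by (simp add: pf_mul_eq_0_iff)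
  moreover have "int (pf_deg b) - int (pf_deg a) = int n - int (Suc k)"
    using gg_ord_infinity[OF kn] ord_at_infinity[OF a0 ab(2)] by (simp add: ab(1) R pdelta_def)
  \<comment> \<open>Going from \<open>gg k\<close> to \<open>gg (Suc k)\<close> lowers the order at
    infinity by at most one; the value 1 is the gap, so the quotient is constant.\<close>
  ultimately have "pf_deg p \<le> 1"
    by (simp add: pf_deg_mul[OF a0 p0] pdelta_def split: if_splits)
  then have "pf_deg p = 0" using pf_deg_neq_1[of p] by simp
  then have "degree (fst p) = 0" "snd p = 0" by (auto simp: pf_deg_def split: if_splits)
  then obtain c where "p = ([:c:], 0)" by (cases p) (auto elim: degree_eq_zeroE)
  then have hc: "?h = const c" using p by (simp add: ev_const)
  have c: "c \<in> H" by (rule const_in_ratfunsD[OF Xi(1) H(1,2) Xi(2)]) (use h hc in simp)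
  have gc: "gg (Suc k) = const c * gg k" using hc gg_nonzero[OF kn] by (simp add: field_simps)
  obtain P where P: "tensor_relation q F H n f g T P" and uniq: "\<And>P'. tensor_relation q F H n f g T P' \<Longrightarrow> P' = P"
    using relation[of T] by blast
  \<comment> \<open>A row that annihilates the family, as \<open>gg (Suc k)\<close> = c
    \<open>gg k\<close>. Adding it to row 0 of \<open>P\<close> yields a second solution; its
    entries lie in \<open>H\<close> since \<open>c\<close> does.\<close>
  define e where "e l = (if l = k then [:c:] else if l = Suc k then [:- 1:] else 0)" for l
  define P' where "P' = mat n n (\<lambda>(i, l). if i = 0 then P $$ (i, l) + e l else P $$ (i, l))"
  have "(\<Sum>l<n. tau_act q F n f (e l) (gg l)) = (\<Sum>l\<in>{k, Suc k}. tau_act q F n f (e l) (gg l))"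
    using k by (intro sum.mono_neutral_right) (auto simp: e_def tau_act_def)
  also have "\<dots> = 0" by (simp add: e_def gc const_minus)
  finally have e0: "(\<Sum>l<n. tau_act q F n f (e l) (gg l)) = 0" .
  have "tensor_relation q F H n f g T P'"
    unfolding tensor_relation_def
  proof (intro conjI allI impI)
    show "P' \<in> carrier_mat n n" by (simp add: P'_def)
    fix i assume i: "i < n"
    have Pi: "T * gg i = (\<Sum>l<n. tau_act q F n f (P $$ (i, l)) (gg l))"
      using P i by (simp add: tensor_relation_def)
    show "T * gg i = (\<Sum>l<n. tau_act q F n f (P' $$ (i, l)) (gg l))"
    proof (cases "i = 0")
      case True
      then have "(\<Sum>l<n. tau_act q F n f (P' $$ (i, l)) (gg l))
          = (\<Sum>l<n. tau_act q F n f (P $$ (i, l)) (gg l) + tau_act q F n f (e l) (gg l))"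
        using i by (intro sum.cong) (auto simp: P'_def tau_act_add)
      then show ?thesis using e0 Pi by (simp add: sum.distrib)
    next
      case False
      then have "(\<Sum>l<n. tau_act q F n f (P' $$ (i, l)) (gg l)) = (\<Sum>l<n. tau_act q F n f (P $$ (i, l)) (gg l))"
        using i by (intro sum.cong) (auto simp: P'_def)
      then show ?thesis using Pi by simp
    qed
  next
    fix i l j assume il: "i < n" "l < n"
    then have "coeff (P $$ (i, l)) j \<in> H" using P by (simp add: tensor_relation_def)
    then show "coeff (P' $$ (i, l)) j \<in> H"
      using c is_subfieldD[OF H(1)] is_subfield_diff[OF H(1)] il by (auto simp: P'_def e_def coeff_pCons split: nat.splits)
  qed
  then have "P' = P" by (rule uniq)
  then have "P' $$ (0, Suc k) = P $$ (0, Suc k)" by simp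
  then show False using k by (simp add: P'_def e_def)
qed

section \<open>Orders at Xi and its twists\<close>

text \<open>The sections of O(n V) over the affine curve, with constants in the ambient
  algebraically closed field. This is the module on which \<tau> acts.\<close>

definition pole_space :: "'f \<Rightarrow> bool" where
  "pole_space h \<longleftrightarrow> h \<in> ratfuns F UNIV \<and> (\<forall>X. aff X \<longrightarrow> ordge X (- int n * pdelta V X) h)"

lemma gg_pole_space: "k < n \<Longrightarrow> pole_space (gg k)"
  unfolding pole_space_def
proof (intro conjI allI impI)
  fix X assume k: "k < n" and X: "aff X"
  show "ordge X (- int n * pdelta V X) (gg k)"
    by (rule ordge_mono[OF X ordeq_ordge[OF X gg_ord[OF k X]]]) (simp add: pdelta_def)
qed (rule gg_UNIV)

text \<open>Twisting moves the pole from \<open>V\<close> to its twist, where \<open>f ^ n\<close>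
  has a compensating zero of order n. What is left are the n-fold pole of \<open>f ^ n\<close> at
  \<open>V\<close> and its n-fold zero at \<Xi>.\<close>

lemma tau_ordge:
  assumes h: "pole_space h" and X: "aff X"
  shows "ordge X (int n * (pdelta Xi X - pdelta V X)) (\<tau> h)"
proof -
  obtain X' where X': "aff X'" "fp X' = X" using X by (rule aff_fp_E)
  have "ordge X (- int n * pdelta V X') (tw h)"
    using ordge_tw[OF X'(1)] h X'(1) unfolding pole_space_def X'(2) by blast
  moreover have "pdelta V X' = pdelta (fp V) X"
    using fp_inj[of X' V] by (auto simp: pdelta_def X'(2)[symmetric])
  moreover have "ordge X (int n * (pdelta (fp V) X - pdelta V X + pdelta Xi X)) (f ^ n)"
    by (rule ordeq_ordge[OF X ordeq_power[OF X f_ord[OF X]]])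
  ultimately have "ordge X (int n * (pdelta (fp V) X - pdelta V X + pdelta Xi X) + - int n * pdelta (fp V) X) (\<tau> h)"
    unfolding tau_def using ordge_mult[OF X] by metis
  then show ?thesis by (simp add: algebra_simps)
qed

lemma tau_pole_space: "pole_space h \<Longrightarrow> pole_space (\<tau> h)"
  unfolding pole_space_def[of "\<tau> h"]
proof (intro conjI allI impI)
  assume h: "pole_space h"
  show "\<tau> h \<in> ratfuns F UNIV"
    using h f_UNIV unfolding tau_def pole_space_def
    by (auto intro!: is_subfieldD(4) is_subfield_power is_subfield_ratfuns tw_in)
  fix X assume X: "aff X"
  show "ordge X (- int n * pdelta V X) (\<tau> h)"
    by (rule ordge_mono[OF X tau_ordge[OF h X]]) (simp add: pdelta_def)
qed

lemma tau_pow_pole_space: "pole_space h \<Longrightarrow> pole_space ((\<tau> ^^ j) h)"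
  by (induction j) (auto intro: tau_pole_space)

lemma tau_pow_ordge:
  assumes "pole_space h" "j > 0"
  shows "ordge Xi (int n) ((\<tau> ^^ j) h)"
proof -
  obtain i where j: "j = Suc i" using \<open>j > 0\<close> gr0_conv_Suc by blast
  show ?thesis
    using tau_ordge[OF tau_pow_pole_space[OF assms(1), of i] Xi(1)] V_neq_Xi
    by (simp add: j pdelta_def split: if_splits)
qed

lemma relation_mod:
  assumes P: "tensor_relation q F H n f g a P" and i: "i < n"
  shows "ordge Xi (int n) (a * gg i - (\<Sum>k<n. const (coeff (P $$ (i, k)) 0) * gg k))"
proof -
  have "a * gg i = (\<Sum>k<n. tau_act q F n f (P $$ (i, k)) (gg k))"
    using P i by (simp add: tensor_relation_def)
  then have "a * gg i - (\<Sum>k<n. const (coeff (P $$ (i, k)) 0) * gg k)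
      = (\<Sum>k<n. tau_act q F n f (P $$ (i, k)) (gg k) - const (coeff (P $$ (i, k)) 0) * gg k)"
    by (simp add: sum_subtractf)
  moreover have "ordge Xi (int n) \<dots>"
  proof (rule ordge_sum[OF Xi(1)])
    fix k assume "k \<in> {..<n}"
    then have S: "pole_space (gg k)" by (simp add: gg_pole_space)
    have "tau_act q F n f (P $$ (i, k)) (gg k) - const (coeff (P $$ (i, k)) 0) * gg k
      = (\<Sum>j\<in>{0<..degree (P $$ (i, k))}. const (coeff (P $$ (i, k)) j) * (\<tau> ^^ j) (gg k))"
      unfolding tau_act_def atMost_atLeast0 by (subst sum.head) simp_all
    moreover have "ordge Xi (int n) \<dots>"
      using tau_pow_ordge[OF S] by (intro ordge_sum[OF Xi(1)] ordge_const_mult[OF Xi(1)]) auto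
    ultimately show "ordge Xi (int n) (tau_act q F n f (P $$ (i, k)) (gg k) - const (coeff (P $$ (i, k)) 0) * gg k)"
      by simp
  qed
  ultimately show ?thesis by simp
qed

lemma gg_ord_Xi_R: "k < n \<Longrightarrow> ordeq Xi (int k + pdelta (R k) Xi) (gg k)"
  using gg_ord[of k Xi] Xi(1) V_neq_Xi by (simp add: pdelta_def split: if_splits)

text \<open>If \<open>R (n - 1) = \<Xi>\<close>, none of the \<open>gg k\<close> has order \<open>n - 1\<close> at \<open>\<Xi>\<close>, but the uniformizer times
  \<open>gg (n - 2)\<close> does, contradicting the existence of the tensor relation for \<open>t\<close> or \<open>y\<close>.\<close>

lemma R_last_neq_Xi: "R (n - 1) \<noteq> Xi"
proof
  assume R: "R (n - 1) = Xi"
  define m where "m = n - 2"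
  have m: "n = Suc (Suc m)" using n by (simp add: m_def)
  \<comment> \<open>The uniformizer at \<Xi> may be t - \<theta> or y - \<eta>, which is why the
    relation is assumed for both coordinates.\<close>
  obtain a a0 where a: "a \<in> {T, Y}" "uf Xi = a - const a0"
    by (cases "2 * \<eta> + wc1 E * \<theta> + wc3 E = 0") (auto simp: uf_cases)
  obtain P where P: "tensor_relation q F H n f g a P" using relation[OF a(1)] by blast
  \<comment> \<open>Row \<open>m\<close> of the constant term for a - a0 in place of
    \<open>a\<close>.\<close>
  define c where "c k = coeff (P $$ (m, k)) 0 - (if k = m then a0 else 0)" for k
  have ord: "ordeq Xi (int k) (gg k)" if "k < Suc m" for k
    using gg_ord_Xi_R[of k] R_neq_Xi[of k] that by (simp add: m pdelta_def split: if_splits)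
  have last: "ordge Xi (int n) (gg (Suc m))"
    using ordeq_ordge[OF Xi(1) gg_ord_Xi_R[of "Suc m"]] R by (simp add: m pdelta_def add.commute)
  have u: "ordeq Xi (int (Suc m)) (uf Xi * gg m)"
    using ordeq_mult[OF Xi(1) ordeq_uf[OF Xi(1)] ord[of m]] by simp
  have "(\<Sum>k<n. const (c k) * gg k)
      = (\<Sum>k<n. const (coeff (P $$ (m, k)) 0) * gg k - (if k = m then const a0 * gg k else 0))"
    by (intro sum.cong) (auto simp: c_def const_diff algebra_simps)
  also have "\<dots> = (\<Sum>k<n. const (coeff (P $$ (m, k)) 0) * gg k) - const a0 * gg m"
    by (simp add: sum_subtractf m)
  finally have "uf Xi * gg m - (\<Sum>k<n. const (c k) * gg k)
      = a * gg m - (\<Sum>k<n. const (coeff (P $$ (m, k)) 0) * gg k)"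
    by (simp add: a(2) algebra_simps)
  then have 1: "ordge Xi (int n) (uf Xi * gg m - (\<Sum>k<n. const (c k) * gg k))"
    using relation_mod[OF P, of m] by (simp add: m)
  have "ordge Xi (int n) (uf Xi * gg m - (\<Sum>k<n. const (c k) * gg k) + const (c (Suc m)) * gg (Suc m))"
    by (intro ordge_add[OF Xi(1) 1] ordge_const_mult[OF Xi(1) last])
  then have 2: "ordge Xi (int n) (uf Xi * gg m - (\<Sum>k<Suc m. const (c k) * gg k))"
    by (simp add: m algebra_simps)
  have "ordge Xi (int (Suc m)) (uf Xi * gg m - (uf Xi * gg m - (\<Sum>k<Suc m. const (c k) * gg k)))"
    by (intro ordge_diff[OF Xi(1)] ordeq_ordge[OF Xi(1) u] ordge_mono[OF Xi(1) 2]) (simp add: m)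
  then have "ordge Xi (int (Suc m)) (\<Sum>k<Suc m. const (c k) * gg k)" by (simp only: diff_diff_eq2 add_diff_cancel_left')
  then have "c k = 0" if "k < Suc m" for k
    using ordered_family_independent[OF Xi(1) ord, of "Suc m"] that by blast
  then have "ordge Xi (int n) (uf Xi * gg m)" using 2 by simp
  then show False using ordeq_ordge_le[OF Xi(1) u] by (fastforce simp: m)
qed

lemma gg_ord_Xi:
  assumes "k < n"
  shows "ordeq Xi (int k) (gg k)"
proof -
  have "R k \<noteq> Xi" using R_neq_Xi[of k] R_last_neq_Xi assms by (cases "Suc k < n") (auto simp: not_less less_Suc_eq_le le_antisym dest: le_antisym simp flip: Suc_le_eq)
  then show ?thesis using gg_ord_Xi_R[OF assms] by (simp add: pdelta_def)
qed


section \<open>The matrices C\<close>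

definition Phi :: "nat \<Rightarrow> 'f" where
  "Phi i = (\<Prod>j<i. twi j f)"

abbreviation "gam i k \<equiv> gamma_fun q F n f g i (Suc k)"
abbreviation "Xii i \<equiv> fpi i Xi"

lemma gam_eq: "gam i k = gg k / Phi i ^ n"
  by (simp add: gamma_fun_def Phi_def)

lemma twi_f_nonzero: "twi i f \<noteq> 0"
proof (induction i)
  case (Suc i)
  then show ?case using tw_eq_0[OF twi_in_UNIV[OF f_UNIV]] by auto
qed (simp add: f_nonzero)

lemma Phi_nonzero: "Phi i \<noteq> 0"
  by (simp add: Phi_def twi_f_nonzero)

lemma Phi_in: "Phi i \<in> ratfuns F H"
  unfolding Phi_def by (intro is_subfield_prod is_subfield_ratfuns twi_in H f)

lemma gam_in: "k < n \<Longrightarrow> gam i k \<in> ratfuns F H"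
  unfolding gam_eq by (intro is_subfield_divide is_subfield_power is_subfield_ratfuns Phi_in g)

lemma aff_Xii: "aff (Xii i)"
  by (rule aff_fpi[OF Xi(1)])

lemma Xii_eq: "Xii i = Affine (\<theta> ^ q ^ i) (\<eta> ^ q ^ i)"
  using frob_point_power[of i Xi] by simp

lemma point_in_Xii: "point_in H (Xii i)"
  using H by (simp add: Xii_eq point_in_def is_subfield_power)

text \<open>The divisor of f f^(1) ... f^(i-1) telescopes: among the points V^(j) only V^(i) and V
  survive. At \<Xi>^(i) the first contributes nothing because V \<noteq> \<Xi>, and a possible pole
  at V, raised to the n-th power, is as strong as the pole allowed for \<open>gg k\<close>.\<close>

lemma gam_regular:
  assumes k: "k < n"
  shows "ordge (Xii i) 0 (gam i k)"
proof -
  define D where "D m = pdelta V (Xii m)" for m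
  have "ordeq (Xii i) (D (i - Suc j) - D (i - j)) (twi j f)" if j: "j < i" for j
  proof -
    define m where "m = i - Suc j"
    have i: "i = j + Suc m" using j by (simp add: m_def)
    \<comment> \<open>Hence the zero of \<open>f\<close> at \<Xi> does not enter its order at a
      proper twist of \<Xi>.\<close>
    have "\<theta> ^ q ^ Suc m \<noteq> \<theta>" by (rule theta) simp
    then have "Xii (Suc m) \<noteq> Xi" unfolding Xii_eq by blast
    moreover have "pdelta (fp V) (Xii (Suc m)) = D m"
      using fp_inj[of "Xii m" V] by (auto simp: pdelta_def D_def)
    ultimately have "ordeq (Xii (Suc m)) (D m - D (Suc m)) f"
      using f_ord[OF aff_Xii[of "Suc m"]] by (simp add: pdelta_def D_def)
    then have "ordeq (fpi j (Xii (Suc m))) (D m - D (Suc m)) (twi j f)"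
      by (rule ordeq_twi[OF aff_Xii])
    moreover have "fpi j (Xii (Suc m)) = Xii i" unfolding i by (simp only: funpow_add o_apply)
    moreover have "i - Suc j = m" "i - j = Suc m" by (simp_all add: i)
    ultimately show ?thesis by simp
  qed
  then have "ordeq (Xii i) (\<Sum>j<i. D (i - Suc j) - D (i - j)) (Phi i)"
    unfolding Phi_def by (intro ordeq_prod[OF aff_Xii]) auto
  also have "(\<Sum>j<i. D (i - Suc j) - D (i - j)) = D (i - i) - D (i - 0)"
    by (rule sum_lessThan_telescope)
  also have "\<dots> = - D i" using V_neq_Xi by (simp add: D_def pdelta_def)
  finally have "ordeq (Xii i) (- D i) (Phi i)" .
  then have "ordeq (Xii i) (int n * D i) (inverse (Phi i ^ n))"
    using ordeq_inverse[OF aff_Xii ordeq_power[OF aff_Xii], of i "- D i" "Phi i" n] by simp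
  moreover have "ordge (Xii i) (- int n * D i) (gg k)"
    using gg_pole_space[OF k] aff_Xii unfolding pole_space_def D_def by blast
  ultimately have "ordge (Xii i) (- int n * D i + int n * D i) (gam i k)"
    unfolding gam_eq divide_inverse using ordge_mult[OF aff_Xii] ordeq_ordge[OF aff_Xii] by blast
  then show ?thesis by simp
qed

lemma twi_gg_in: "k < n \<Longrightarrow> twi i (gg k) \<in> ratfuns F H"
  by (intro twi_in H g)

lemma twi_gg_ord: "k < n \<Longrightarrow> ordeq (Xii i) (int k) (twi i (gg k))"
  by (intro ordeq_twi Xi gg_ord_Xi)

lemma combination_in:
  "(\<And>k. k < n \<Longrightarrow> c k \<in> H) \<Longrightarrow> (\<Sum>k<n. const (c k) * twi i (gg k)) \<in> ratfuns F H"
  by (intro is_subfield_sum is_subfield_ratfuns is_subfieldD(4) const_in_ratfuns twi_gg_in) auto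

text \<open>The remainder is determined by the matrix and automatically lies in H(t, y), so the
  quantifier over it reduces to an order condition.\<close>

lemma expansion_relation_iff:
  "expansion_relation q F H Xi n f g i M \<longleftrightarrow>
     M \<in> carrier_mat n n \<and> (\<forall>l<n. \<forall>k<n. M $$ (l, k) \<in> H) \<and>
     (\<forall>l<n. ordge (Xii i) (int n) (gam i l - (\<Sum>k<n. const (M $$ (l, k)) * twi i (gg k))))"
proof -
  have "(\<exists>\<alpha>\<in>ratfuns F H. vanishes_to_order F n (frob_point (q ^ i) Xi) \<alpha> \<and>
      gam i l = (\<Sum>k<n. const (M $$ (l, k)) * twi i (gg k)) + \<alpha>) \<longleftrightarrow>
      ordge (Xii i) (int n) (gam i l - (\<Sum>k<n. const (M $$ (l, k)) * twi i (gg k)))"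
    (is "?L \<longleftrightarrow> ?R") if l: "l < n" and M: "\<forall>l<n. \<forall>k<n. M $$ (l, k) \<in> H" for l
  proof
    assume ?L
    then obtain \<alpha> where \<alpha>: "\<alpha> \<in> ratfuns F H" "vanishes_to_order F n (Xii i) \<alpha>"
      "gam i l = (\<Sum>k<n. const (M $$ (l, k)) * twi i (gg k)) + \<alpha>"
      unfolding frob_point_power by blast
    have "\<alpha> \<in> ratfuns F UNIV" using \<alpha>(1) ratfuns_mono by blast
    then have "ordge (Xii i) (int n) \<alpha>" using \<alpha>(2) vanishes_to_order_iff[OF aff_Xii] by blast
    then show ?R using \<alpha>(3) by simp
  next
    assume R: ?R
    let ?\<alpha> = "gam i l - (\<Sum>k<n. const (M $$ (l, k)) * twi i (gg k))"
    have \<alpha>: "?\<alpha> \<in> ratfuns F H"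
      using M l by (intro is_subfield_diff is_subfield_ratfuns gam_in combination_in) auto
    then have "?\<alpha> \<in> ratfuns F UNIV" using ratfuns_mono by blast
    then have "vanishes_to_order F n (Xii i) ?\<alpha>" using R vanishes_to_order_iff[OF aff_Xii] by blast
    then show ?L unfolding frob_point_power using \<alpha> by (intro bexI[of _ ?\<alpha>]) auto
  qed
  then show ?thesis unfolding expansion_relation_def by blast
qed

lemma combination_unique:
  assumes "ordge (Xii i) (int n) (h - (\<Sum>k<n. const (c k) * twi i (gg k)))"
    and "ordge (Xii i) (int n) (h - (\<Sum>k<n. const (d k) * twi i (gg k)))" and k: "k < n"
  shows "c k = d k"
proof -
  have "ordge (Xii i) (int n) ((h - (\<Sum>k<n. const (d k) * twi i (gg k))) - (h - (\<Sum>k<n. const (c k) * twi i (gg k))))"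
    by (intro ordge_diff[OF aff_Xii] assms)
  also have "(h - (\<Sum>k<n. const (d k) * twi i (gg k))) - (h - (\<Sum>k<n. const (c k) * twi i (gg k)))
      = (\<Sum>k<n. const (c k - d k) * twi i (gg k))"
    by (simp add: const_diff algebra_simps sum_subtractf)
  finally have ge: "ordge (Xii i) (int n) (\<Sum>k<n. const (c k - d k) * twi i (gg k))" .
  have "c k - d k = 0"
    by (rule ordered_family_independent[where g = "\<lambda>k. twi i (gg k)" and c = "\<lambda>k. c k - d k",
          OF aff_Xii _ ge k k]) (rule twi_gg_ord)
  then show ?thesis by simp
qed

text \<open>The twisted functions have orders 0, ..., n - 1 at \<Xi>^(i), and this point has
  coordinates in \<open>H\<close>, so the expansion of the regular function \<open>gam i l\<close>
  has constants in \<open>H\<close>.\<close>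

lemma expansion_ex1: "\<exists>!M. expansion_relation q F H Xi n f g i M"
proof (rule ex_ex1I)
  have "\<exists>c. (\<forall>k<n. c k \<in> H) \<and> ordge (Xii i) (int n) (gam i l - (\<Sum>k<n. const (c k) * twi i (gg k)))"
    if "l < n" for l
    by (rule ordered_family_expansion[OF aff_Xii H(1,2) point_in_Xii twi_gg_in twi_gg_ord gam_in gam_regular])
      (use that in auto)
  then obtain c where c: "\<And>l. l < n \<Longrightarrow> (\<forall>k<n. c l k \<in> H) \<and>
      ordge (Xii i) (int n) (gam i l - (\<Sum>k<n. const (c l k) * twi i (gg k)))" by metis
  have "expansion_relation q F H Xi n f g i (mat n n (\<lambda>(l, k). c l k))"
    unfolding expansion_relation_iff using c by auto
  then show "\<exists>M. expansion_relation q F H Xi n f g i M" ..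
next
  fix M M' assume "expansion_relation q F H Xi n f g i M" "expansion_relation q F H Xi n f g i M'"
  then have M: "M \<in> carrier_mat n n" "M' \<in> carrier_mat n n"
    and exp: "\<And>l. l < n \<Longrightarrow> ordge (Xii i) (int n) (gam i l - (\<Sum>k<n. const (M $$ (l, k)) * twi i (gg k)))"
      "\<And>l. l < n \<Longrightarrow> ordge (Xii i) (int n) (gam i l - (\<Sum>k<n. const (M' $$ (l, k)) * twi i (gg k)))"
    unfolding expansion_relation_iff by blast+
  show "M = M'"
  proof (rule eq_matI)
    fix l k assume "l < dim_row M'" "k < dim_col M'"
    then have "l < n" "k < n" using M by auto
    then show "M $$ (l, k) = M' $$ (l, k)"
      using combination_unique[OF exp(1) exp(2)] by blast
  qed (use M in auto)
qed

definition C :: "nat \<Rightarrow> nat \<Rightarrow> nat \<Rightarrow> 'c" where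
  "C i l k = C_matrix q F H Xi n f g i $$ (l, k)"

lemma C_matrix_relation: "expansion_relation q F H Xi n f g i (C_matrix q F H Xi n f g i)"
  unfolding C_matrix_def by (rule theI'[OF expansion_ex1])

lemma C_expansion:
  "l < n \<Longrightarrow> ordge (Xii i) (int n) (gam i l - (\<Sum>k<n. const (C i l k) * twi i (gg k)))"
  using C_matrix_relation[of i] unfolding expansion_relation_iff C_def by blast

lemma C_in: "l < n \<Longrightarrow> k < n \<Longrightarrow> C i l k \<in> H"
  using C_matrix_relation[of i] unfolding expansion_relation_iff C_def by blast

lemma C_0:
  assumes "l < n" "k < n"
  shows "C 0 l k = (if l = k then 1 else 0)"
proof (rule combination_unique[OF C_expansion[OF assms(1)] _ assms(2)])
  have "(\<Sum>k<n. const (if l = k then 1 else 0) * twi 0 (gg k)) = (\<Sum>k<n. if l = k then gg k else 0)"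
    by (intro sum.cong) auto
  also have "\<dots> = gam 0 l" using assms(1) by (simp add: gam_eq Phi_def)
  finally show "ordge (Xii 0) (int n) (gam 0 l - (\<Sum>k<n. const (if l = k then 1 else 0) * twi 0 (gg k)))"
    using ordge_zero[OF aff_Xii[of 0], of "int n"] by (simp del: funpow.simps)
qed

section \<open>The action of t and the recursion for the matrices C\<close>

definition P :: "'c poly mat" where
  "P = tensor_power q F H n f g T"

definition A :: "nat \<Rightarrow> nat \<Rightarrow> nat \<Rightarrow> 'c" where
  "A j l k = coeff (P $$ (l, k)) j"

lemma P_relation: "tensor_relation q F H n f g T P"
  unfolding P_def tensor_power_def using theI'[OF relation[of T]] by simp

lemma T_expansion: "l < n \<Longrightarrow> ordge Xi (int n) (T * gg l - (\<Sum>k<n. const (A 0 l k) * gg k))"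
  unfolding A_def by (rule relation_mod[OF P_relation])

text \<open>The product (t - \<theta>) \<open>gg l\<close> vanishes to order at least l + 1 at
  \<Xi>, and the error of its expansion has order n \<ge> l + 1. So the coefficients of t - \<theta>
  in row \<open>l\<close> vanish in all columns up to and including \<open>l\<close>.\<close>

lemma A0_triangular:
  assumes "l < n"
  shows "k < l \<Longrightarrow> A 0 l k = 0" and "A 0 l l = \<theta>"
proof -
  define c where "c k = A 0 l k - (if k = l then \<theta> else 0)" for k
  have "(\<Sum>k<n. const (c k) * gg k) = (\<Sum>k<n. const (A 0 l k) * gg k - (if k = l then const \<theta> * gg k else 0))"
    by (intro sum.cong) (auto simp: c_def const_diff algebra_simps)
  also have "\<dots> = (T - const \<theta>) * gg l - (T * gg l - (\<Sum>k<n. const (A 0 l k) * gg k))"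
    using assms by (simp add: sum_subtractf algebra_simps)
  finally have eq: "(\<Sum>k<n. const (c k) * gg k) = (T - const \<theta>) * gg l - (T * gg l - (\<Sum>k<n. const (A 0 l k) * gg k))" .
  obtain d w v where d: "0 < d" "val UNIV Xi w v" "T - const \<theta> = w * uf Xi ^ d"
    using T_order[OF Xi(1) refl] by blast
  have "ordge Xi (int d) (T - const \<theta>)" unfolding ordge_def using d by auto
  then have "ordge Xi 1 (T - const \<theta>)" by (rule ordge_mono[OF Xi(1)]) (use d(1) in simp)
  then have "ordge Xi (1 + int l) ((T - const \<theta>) * gg l)"
    by (rule ordge_mult[OF Xi(1) _ ordeq_ordge[OF Xi(1) gg_ord_Xi[OF assms]]])
  moreover have "ordge Xi (1 + int l) (T * gg l - (\<Sum>k<n. const (A 0 l k) * gg k))"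
    by (rule ordge_mono[OF Xi(1) T_expansion[OF assms]]) (use assms in simp)
  ultimately have ge: "ordge Xi (int (Suc l)) (\<Sum>k<n. const (c k) * gg k)"
    unfolding eq using ordge_diff[OF Xi(1)] by simp
  have c0: "c k = 0" if k: "k < Suc l" for k
  proof -
    have "k < n" using k assms by simp
    show ?thesis
      by (rule ordered_family_independent[where g = "\<lambda>k. gg k" and c = c, OF Xi(1) _ ge \<open>k < n\<close> k])
        (rule gg_ord_Xi)
  qed
  show "k < l \<Longrightarrow> A 0 l k = 0" "A 0 l l = \<theta>" using c0[of k] c0[of l] by (simp_all add: c_def)
qed

lemma Phi_UNIV: "Phi i \<in> ratfuns F UNIV"
  using Phi_in ratfuns_mono by blast

lemma gam_UNIV: "k < n \<Longrightarrow> gam i k \<in> ratfuns F UNIV"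
  using gam_in ratfuns_mono by blast

lemma T_UNIV: "T \<in> ratfuns F UNIV"
  using ev_in_ratfuns[of UNIV "([:0, 1:], 0)"] by (simp add: ev_T)

lemma const_UNIV: "const c \<in> ratfuns F UNIV"
  by (rule const_in_ratfuns) simp

lemma combination_UNIV: "(\<Sum>k<n. const (c k) * twi i (gg k)) \<in> ratfuns F UNIV"
  by (intro is_subfield_sum is_subfield_ratfuns is_subfieldD(4) const_UNIV twi_in_UNIV gg_UNIV) auto

lemma twi_combination:
  "twi j (\<Sum>k<n. const (c k) * twi i (gg k)) = (\<Sum>k<n. const (c k ^ q ^ j) * twi (j + i) (gg k))"
proof -
  have "twi j (\<Sum>k<n. const (c k) * twi i (gg k)) = (\<Sum>k<n. twi j (const (c k) * twi i (gg k)))"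
    by (intro twi_sum is_subfieldD(4) is_subfield_ratfuns const_UNIV twi_in_UNIV gg_UNIV) auto
  also have "\<dots> = (\<Sum>k<n. const (c k ^ q ^ j) * twi (j + i) (gg k))"
    by (intro sum.cong refl) (auto simp: twi_mult const_UNIV twi_in_UNIV gg_UNIV twi_const funpow_add)
  finally show ?thesis .
qed

lemma twi_diff:
  assumes "h \<in> ratfuns F UNIV" "h' \<in> ratfuns F UNIV"
  shows "twi i (h - h') = twi i h - twi i h'"
proof -
  have "h - h' \<in> ratfuns F UNIV" using is_subfield_diff[OF is_subfield_ratfuns assms] .
  then show ?thesis using twi_add[of "h - h'" h' i] assms(2) by simp
qed

lemma twi_T: "twi i T = T"
proof -
  have "tw T = T" using tw_ev[of "([:0, 1:], 0)"] q_pos by (simp add: ev_T pf_twist_def)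
  then show ?thesis by (induction i) simp_all
qed

lemma Phi_split: "j \<le> i \<Longrightarrow> Phi i = Phi j * twi j (Phi (i - j))"
proof -
  assume "j \<le> i"
  then obtain m where i: "i = j + m" using le_Suc_ex by blast
  have "twi j (Phi m) = (\<Prod>k<m. twi (j + k) f)"
    unfolding Phi_def by (subst twi_prod) (simp_all add: twi_in_UNIV f_UNIV funpow_add)
  moreover have "Phi (j + m) = Phi j * (\<Prod>k<m. twi (j + k) f)"
    by (induction m) (simp_all add: Phi_def mult.assoc)
  ultimately show ?thesis by (simp add: i)
qed

text \<open>Dividing \<open>t g_l = \<Sum>\<^sub>j A\<^sub>j \<tau>\<^sup>j(g)\<close> by \<open>(f f\<^sup>(\<^sup>1\<^sup>) \<dots> f\<^sup>(\<^sup>i\<^sup>-\<^sup>1\<^sup>))\<^sup>n\<close> turns the \<open>j\<close>-th term into the twist of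
  \<open>\<gamma>\<^sub>i\<^sub>-\<^sub>j\<close> if \<open>j \<le> i\<close>, and into a function vanishing to order \<open>n\<close> at \<open>\<Xi>\<^sup>(\<^sup>i\<^sup>)\<close> if \<open>j > i\<close>.\<close>

lemma tau_pow_quotient_le:
  assumes j: "j \<le> i" and k: "k < n"
  shows "ordge (Xii i) (int n) ((\<tau> ^^ j) (gg k) / Phi i ^ n
      - (\<Sum>m<n. const (C (i - j) k m ^ q ^ j) * twi i (gg m)))"
proof -
  have "ordge (fpi j (Xii (i - j))) (int n)
      (twi j (gam (i - j) k - (\<Sum>m<n. const (C (i - j) k m) * twi (i - j) (gg m))))"
    by (rule ordge_twi[OF aff_Xii C_expansion[OF k]])
  moreover have "fpi j (Xii (i - j)) = Xii i"
    using funpow_add[of j "i - j" fp] j by (metis comp_apply le_add_diff_inverse)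
  moreover have "twi j (gam (i - j) k - (\<Sum>m<n. const (C (i - j) k m) * twi (i - j) (gg m)))
      = twi j (gam (i - j) k) - (\<Sum>m<n. const (C (i - j) k m ^ q ^ j) * twi i (gg m))"
    using j by (simp add: twi_diff[OF gam_UNIV[OF k] combination_UNIV] twi_combination)
  moreover have "twi j (gam (i - j) k) = (\<tau> ^^ j) (gg k) / Phi i ^ n"
  proof -
    have "twi j (gam (i - j) k) = twi j (gg k) / twi j (Phi (i - j)) ^ n"
      unfolding gam_eq
      by (simp add: twi_divide gg_UNIV[OF k] Phi_UNIV is_subfield_power is_subfield_ratfuns twi_power)
    also have "\<dots> = (\<tau> ^^ j) (gg k) / Phi i ^ n"
      unfolding tau_pow_eq[OF f_UNIV gg_UNIV[OF k]] Phi_split[OF j] Phi_def[of j, symmetric]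
      using Phi_nonzero[of j] by (simp add: power_mult_distrib)
    finally show ?thesis .
  qed
  ultimately show ?thesis by simp
qed

lemma tau_pow_quotient_gt:
  assumes j: "i < j" and k: "k < n"
  shows "ordge (Xii i) (int n) ((\<tau> ^^ j) (gg k) / Phi i ^ n)"
proof -
  have ij: "i \<le> j" using j by simp
  have "ordge (Xii i) (int n) (twi i ((\<tau> ^^ (j - i)) (gg k)))"
    using j by (intro ordge_twi Xi tau_pow_ordge gg_pole_space k) auto
  moreover have "twi i ((\<tau> ^^ (j - i)) (gg k)) = twi i (Phi (j - i)) ^ n * twi j (gg k)"
  proof -
    have "twi i (twi (j - i) (gg k)) = twi j (gg k)"
      using funpow_add[of i "j - i" tw] ij by simp
    then show ?thesis
      unfolding tau_pow_eq[OF f_UNIV gg_UNIV[OF k]] Phi_def[symmetric]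
      by (simp add: twi_mult twi_power Phi_UNIV is_subfield_power is_subfield_ratfuns twi_in_UNIV gg_UNIV[OF k])
  qed
  moreover have "\<dots> = (\<tau> ^^ j) (gg k) / Phi i ^ n"
    unfolding tau_pow_eq[OF f_UNIV gg_UNIV[OF k]] Phi_def[symmetric] Phi_split[OF ij]
    using Phi_nonzero[of i] by (simp add: power_mult_distrib)
  ultimately show ?thesis by simp
qed

text \<open>Both sides are the m-th coefficient of t \<gamma>_(i,l) at \<Xi>^(i). On the left
  \<gamma> is expanded first and then multiplied by t, using the i-fold twist of the expansion of t
  \<open>gg k\<close> at \<Xi>; on the right t \<open>gg l\<close> is first written through \<tau>
  and then divided.\<close>

lemma C_recursion:
  assumes l: "l < n" and m: "m < n"
  shows "(\<Sum>k<n. C i l k * A 0 k m ^ q ^ i) = (\<Sum>j\<le>i. \<Sum>k<n. A j l k * C (i - j) k m ^ q ^ j)"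
proof -
  define e where "e m = (\<Sum>k<n. C i l k * A 0 k m ^ q ^ i)" for m
  define e' where "e' m = (\<Sum>j\<le>i. \<Sum>k<n. A j l k * C (i - j) k m ^ q ^ j)" for m
  let ?G = "\<lambda>m. twi i (gg m)"
  have T0: "ordge (Xii i) 0 T"
    unfolding ordge_0_iff[OF aff_Xii] using val_ev[OF aff_Xii is_subfield_UNIV coeffs_in_UNIV, of i "([:0, 1:], 0)"]
    by (auto simp: ev_T)
  have 1: "ordge (Xii i) (int n) (T * gam i l - (\<Sum>m<n. const (e m) * ?G m))"
  proof -
    have "ordge (Xii i) (0 + int n) (T * (gam i l - (\<Sum>k<n. const (C i l k) * ?G k)))"
      by (intro ordge_mult[OF aff_Xii] T0 C_expansion[OF l])
    then have a: "ordge (Xii i) (int n) (T * gam i l - (\<Sum>k<n. const (C i l k) * (T * ?G k)))"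
      by (simp add: right_diff_distrib sum_distrib_left mult_ac)
    have "ordge (Xii i) (int n) (T * ?G k - (\<Sum>m<n. const (A 0 k m ^ q ^ i) * ?G m))" if k: "k < n" for k
    proof -
      have "ordge (Xii i) (int n) (twi i (T * gg k - (\<Sum>m<n. const (A 0 k m) * twi 0 (gg m))))"
        using ordge_twi[OF Xi(1) T_expansion[OF k], of i] by simp
      moreover have "twi i (T * gg k - (\<Sum>m<n. const (A 0 k m) * twi 0 (gg m)))
          = twi i (T * gg k) - twi i (\<Sum>m<n. const (A 0 k m) * twi 0 (gg m))"
        by (rule twi_diff[OF is_subfieldD(4)[OF is_subfield_ratfuns T_UNIV gg_UNIV[OF k]] combination_UNIV])
      ultimately show ?thesis
        by (simp only: twi_combination twi_mult[OF T_UNIV gg_UNIV[OF k]] twi_T add_0_right)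
    qed
    then have b: "ordge (Xii i) (int n) (\<Sum>k<n. const (C i l k) * (T * ?G k - (\<Sum>m<n. const (A 0 k m ^ q ^ i) * ?G m)))"
      by (intro ordge_sum[OF aff_Xii] ordge_const_mult[OF aff_Xii]) auto
    have "(\<Sum>m<n. const (e m) * ?G m) = (\<Sum>m<n. \<Sum>k<n. const (C i l k) * (const (A 0 k m ^ q ^ i) * ?G m))"
      by (simp add: e_def const_sum const_mult sum_distrib_right mult.assoc)
    also have "\<dots> = (\<Sum>k<n. const (C i l k) * (\<Sum>m<n. const (A 0 k m ^ q ^ i) * ?G m))"
      by (subst sum.swap) (simp add: sum_distrib_left)
    finally show ?thesis
      using ordge_add[OF aff_Xii a b] by (simp add: right_diff_distrib sum_subtractf)
  qed
  have 2: "ordge (Xii i) (int n) (T * gam i l - (\<Sum>m<n. const (e' m) * ?G m))"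
  proof -
    \<comment> \<open>One bound for all degrees in the row; the summand \<open>i\<close> ensures
      that the range can be cut at j = i.\<close>
    define D where "D = i + (\<Sum>k<n. degree (P $$ (l, k)))"
    have D: "degree (P $$ (l, k)) \<le> D" if "k < n" for k
      using member_le_sum[of k "{..<n}" "\<lambda>k. degree (P $$ (l, k))"] that by (simp add: D_def)
    define x where "x j k = (\<tau> ^^ j) (gg k) / Phi i ^ n" for j k
    define y where "y j k = (\<Sum>m<n. const (C (i - j) k m ^ q ^ j) * ?G m)" for j k
    have "T * gg l = (\<Sum>k<n. tau_act q F n f (P $$ (l, k)) (gg k))"
      using P_relation l by (simp add: tensor_relation_def)
    also have "\<dots> = (\<Sum>k<n. \<Sum>j\<le>D. const (A j l k) * (\<tau> ^^ j) (gg k))"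
      by (intro sum.cong refl) (simp add: tau_act_eq[OF D] A_def)
    finally have "T * gg l = (\<Sum>k<n. \<Sum>j\<le>D. const (A j l k) * (\<tau> ^^ j) (gg k))" .
    then have "T * gam i l = (\<Sum>k<n. \<Sum>j\<le>D. const (A j l k) * x j k)"
      unfolding gam_eq times_divide_eq_right by (simp add: x_def sum_divide_distrib)
    also have "\<dots> = (\<Sum>j\<le>D. \<Sum>k<n. const (A j l k) * x j k)" by (rule sum.swap)
    also have "\<dots> = (\<Sum>j\<le>i. \<Sum>k<n. const (A j l k) * x j k) + (\<Sum>j\<in>{i<..D}. \<Sum>k<n. const (A j l k) * x j k)"
      by (subst sum.union_disjoint[symmetric]) (auto simp: D_def intro!: sum.cong)
    finally have T: "T * gam i l = (\<Sum>j\<le>i. \<Sum>k<n. const (A j l k) * x j k)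
        + (\<Sum>j\<in>{i<..D}. \<Sum>k<n. const (A j l k) * x j k)" .
    have "(\<Sum>m<n. const (e' m) * ?G m)
        = (\<Sum>m<n. \<Sum>j\<le>i. \<Sum>k<n. const (A j l k) * (const (C (i - j) k m ^ q ^ j) * ?G m))"
      by (simp add: e'_def const_sum const_mult sum_distrib_right mult.assoc)
    also have "\<dots> = (\<Sum>j\<le>i. \<Sum>m<n. \<Sum>k<n. const (A j l k) * (const (C (i - j) k m ^ q ^ j) * ?G m))"
      by (rule sum.swap)
    also have "\<dots> = (\<Sum>j\<le>i. \<Sum>k<n. \<Sum>m<n. const (A j l k) * (const (C (i - j) k m ^ q ^ j) * ?G m))"
      by (rule sum.cong[OF refl], rule sum.swap)
    also have "\<dots> = (\<Sum>j\<le>i. \<Sum>k<n. const (A j l k) * y j k)"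
      by (simp add: y_def sum_distrib_left)
    finally have e': "(\<Sum>m<n. const (e' m) * ?G m) = (\<Sum>j\<le>i. \<Sum>k<n. const (A j l k) * y j k)" .
    have "T * gam i l - (\<Sum>m<n. const (e' m) * ?G m)
        = (\<Sum>j\<le>i. \<Sum>k<n. const (A j l k) * (x j k - y j k)) + (\<Sum>j\<in>{i<..D}. \<Sum>k<n. const (A j l k) * x j k)"
      unfolding T e' by (simp add: right_diff_distrib sum_subtractf)
    moreover have "ordge (Xii i) (int n) \<dots>"
      using tau_pow_quotient_le tau_pow_quotient_gt unfolding x_def y_def
      by (intro ordge_add[OF aff_Xii] ordge_sum[OF aff_Xii] ordge_const_mult[OF aff_Xii]) auto
    ultimately show ?thesis by simp
  qed
  show ?thesis using combination_unique[OF 1 2 m] unfolding e_def e'_def .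
qed

text \<open>The terms with j > 0 contain only earlier matrices and agree by induction, so the
  difference of the i-th matrices solves the homogeneous Sylvester equation.\<close>

lemma recursion_unique:
  assumes 0: "\<And>l m. l < n \<Longrightarrow> m < n \<Longrightarrow> B 0 l m = (if l = m then 1 else 0)"
    and rec: "\<And>i l m. l < n \<Longrightarrow> m < n \<Longrightarrow>
      (\<Sum>k<n. B i l k * A 0 k m ^ q ^ i) = (\<Sum>j\<le>i. \<Sum>k<n. A j l k * B (i - j) k m ^ q ^ j)"
    and "l < n" "m < n"
  shows "B i l m = C i l m"
  using \<open>l < n\<close> \<open>m < n\<close>
proof (induction i arbitrary: l m rule: less_induct)
  case (less i)
  show ?case
  proof (cases "i = 0")
    case True
    then show ?thesis using 0 C_0 less.prems by simp
  next
    case False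
    have split: "(\<Sum>j\<le>i. \<Sum>k<n. A j l k * Z (i - j) k m ^ q ^ j)
        = (\<Sum>k<n. A 0 l k * Z i k m) + (\<Sum>j\<in>{0<..i}. \<Sum>k<n. A j l k * Z (i - j) k m ^ q ^ j)"
      for Z :: "nat \<Rightarrow> nat \<Rightarrow> nat \<Rightarrow> 'c" and l m
      unfolding atMost_atLeast0 by (subst sum.head) simp_all
    have tail: "(\<Sum>j\<in>{0<..i}. \<Sum>k<n. A j l k * B (i - j) k m ^ q ^ j)
        = (\<Sum>j\<in>{0<..i}. \<Sum>k<n. A j l k * C (i - j) k m ^ q ^ j)" if "m < n" for l m
      using less.IH that by (intro sum.cong refl) auto
    have pow: "(0::'c) ^ q ^ i = 0" using q_pos by simp
    have "B i l m - C i l m = 0"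
    proof (rule triangular_sylvester_zero[where X = "\<lambda>l m. B i l m - C i l m" and d = "A 0"
          and d' = "\<lambda>k m. A 0 k m ^ q ^ i" and a = \<theta> and a' = "\<theta> ^ q ^ i"])
      show "\<theta> \<noteq> \<theta> ^ q ^ i" using theta[of i] False by auto
      fix l m assume lm: "l < n" "m < n"
      show "(\<Sum>k<n. (B i l k - C i l k) * A 0 k m ^ q ^ i) = (\<Sum>k<n. A 0 l k * (B i k m - C i k m))"
        using rec[OF lm, of i] C_recursion[OF lm, of i] tail[OF lm(2), of l]
        unfolding split[of l B m] split[of l C m]
        by (simp add: left_diff_distrib right_diff_distrib sum_subtractf)
    qed (use less.prems A0_triangular pow in simp_all)
    then show ?thesis by simp
  qed
qed

end

section \<open>Series in Frobenius powers over a nonarchimedean field\<close>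

locale nonarch_field =
  fixes absv :: "'c::field \<Rightarrow> real"
  assumes nonarch: "nonarch_abs absv"
begin

lemma absv_nonneg: "0 \<le> absv x"
  and absv_eq_0_iff [simp]: "absv x = 0 \<longleftrightarrow> x = 0"
  and absv_mult: "absv (x * y) = absv x * absv y"
  and absv_add: "absv (x + y) \<le> max (absv x) (absv y)"
  using nonarch unfolding nonarch_abs_def by auto

lemma absv_0 [simp]: "absv 0 = 0"
  by simp

lemma absv_1 [simp]: "absv 1 = 1"
  using absv_mult[of 1 1] by auto

lemma absv_minus [simp]: "absv (- x) = absv x"
proof -
  have "absv (- 1) * absv (- 1) = 1" by (simp flip: absv_mult)
  then have "absv (- 1) = 1" using absv_nonneg[of "- 1"] by (simp add: square_eq_1_iff)
  then show ?thesis using absv_mult[of "- 1" x] by simp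
qed

lemma absv_diff: "absv (x - y) \<le> max (absv x) (absv y)"
  using absv_add[of x "- y"] by simp

lemma absv_power: "absv (x ^ m) = absv x ^ m"
  by (induction m) (simp_all add: absv_mult)

lemma absv_inverse: "x \<noteq> 0 \<Longrightarrow> absv (inverse x) = inverse (absv x)"
  using absv_mult[of x "inverse x"] by (simp add: inverse_unique)

lemma absv_sum:
  assumes "\<And>i. i \<in> I \<Longrightarrow> absv (h i) \<le> c" "0 \<le> c"
  shows "absv (sum h I) \<le> c"
  using assms
proof (induction I rule: infinite_finite_induct)
  case (insert i I)
  then show ?case using absv_add[of "h i" "sum h I"] by fastforce
qed simp_all

lemma abs_limit_add:
  assumes "abs_limit absv s l" "abs_limit absv s' l'"
  shows "abs_limit absv (\<lambda>k. s k + s' k) (l + l')"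
  unfolding abs_limit_def
proof (rule tendsto_sandwich[OF _ _ tendsto_const])
  show "(\<lambda>k. absv (s k - l) + absv (s' k - l')) \<longlonglongrightarrow> 0"
    using tendsto_add[OF assms[unfolded abs_limit_def]] by simp
  have "absv (s k + s' k - (l + l')) \<le> absv (s k - l) + absv (s' k - l')" for k
    using absv_add[of "s k - l" "s' k - l'"] absv_nonneg[of "s k - l"] absv_nonneg[of "s' k - l'"]
    by (simp add: algebra_simps)
  then show "\<forall>\<^sub>F k in sequentially. absv (s k + s' k - (l + l')) \<le> absv (s k - l) + absv (s' k - l')"
    by simp
qed (simp add: absv_nonneg)

lemma abs_limit_const: "abs_limit absv (\<lambda>k. l) l"
  by (simp add: abs_limit_def)

lemma abs_limit_cmult:
  assumes "abs_limit absv s l"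
  shows "abs_limit absv (\<lambda>k. a * s k) (a * l)"
proof -
  have "(\<lambda>k. absv a * absv (s k - l)) \<longlonglongrightarrow> absv a * 0"
    using assms unfolding abs_limit_def by (intro tendsto_intros)
  then show ?thesis by (simp add: abs_limit_def flip: absv_mult right_diff_distrib)
qed

lemma abs_limit_diff:
  assumes "abs_limit absv s l" "abs_limit absv s' l'"
  shows "abs_limit absv (\<lambda>k. s k - s' k) (l - l')"
  using abs_limit_add[OF assms(1) abs_limit_cmult[OF assms(2), of "- 1"]] by simp

lemma abs_limit_sum:
  "(\<And>i. i \<in> I \<Longrightarrow> abs_limit absv (s i) (l i)) \<Longrightarrow> abs_limit absv (\<lambda>k. \<Sum>i\<in>I. s i k) (\<Sum>i\<in>I. l i)"
  by (induction I rule: infinite_finite_induct) (simp_all add: abs_limit_const abs_limit_add)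

text \<open>At a sufficiently small nonzero argument the first nonzero term strictly dominates all
  later ones, and by the ultrametric inequality the partial sums keep its absolute value. Powers of
  1/x supply such arguments.\<close>

lemma frobenius_series_coeffs_zero:
  assumes q: "q \<ge> 2" and x: "absv x > 1"
    and lim: "\<And>s. abs_limit absv (\<lambda>N. \<Sum>i<N. b i * s ^ q ^ i) 0"
  shows "b i = 0"
proof (rule ccontr)
  assume "b i \<noteq> 0"
  define m where "m = (LEAST i. b i \<noteq> 0)"
  have m: "b m \<noteq> 0" and below: "\<And>i. i < m \<Longrightarrow> b i = 0"
    unfolding m_def using \<open>b i \<noteq> 0\<close> LeastI[of "\<lambda>i. b i \<noteq> 0"] not_less_Least[of _ "\<lambda>i. b i \<noteq> 0"] by blast+
  \<comment> \<open>Convergence at the argument 1 bounds the partial sums, hence the coefficients,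
    by a common \<open>K\<close>.\<close>
  have "(\<lambda>N. absv (\<Sum>i<N. b i)) \<longlonglongrightarrow> 0" using lim[of 1] by (simp add: abs_limit_def)
  then obtain K where K: "K > 0" "\<And>N. absv (\<Sum>i<N. b i) \<le> K"
    using absv_nonneg by (metis BseqE Bseq_def convergentI convergent_imp_Bseq real_norm_def abs_of_nonneg)
  have bK: "absv (b i) \<le> K" for i
    using absv_diff[of "\<Sum>i<Suc i. b i" "\<Sum>i<i. b i"] K(2)[of "Suc i"] K(2)[of i] by simp
  define e where "e = min 1 (absv (b m) / K)"
  have "absv (b m) > 0" using m absv_nonneg[of "b m"] by (simp add: less_le)
  then have e: "e > 0" using K(1) by (simp add: e_def)
  obtain M where M: "inverse (absv x) ^ M < e"
    using real_arch_pow_inv[OF e] x by (metis inverse_less_1_iff less_le_trans)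
  define s where "s = inverse x ^ M"
  define r where "r = absv s"
  have x0: "x \<noteq> 0" using x by auto
  have r: "0 < r" "r < 1" "K * r < absv (b m)"
    using M K(1) x x0 unfolding r_def s_def absv_power absv_inverse[OF x0] e_def
    by (auto simp: field_simps)
  have tail: "absv (b i * s ^ q ^ i) \<le> K * r * r ^ q ^ m" if i: "m < i" for i
  proof -
    \<comment> \<open>The exponent grows by at least one, and the extra factor \<open>r\<close>
      outweighs the ratio of \<open>K\<close> to \<open>absv (b m)\<close>.\<close>
    have "q ^ m < q ^ i" using q i by (intro power_strict_increasing) auto
    then have "r ^ q ^ i \<le> r ^ Suc (q ^ m)" using r by (intro power_decreasing) auto
    then have "absv (b i) * r ^ q ^ i \<le> K * r ^ Suc (q ^ m)"
      using bK[of i] r K(1) by (intro mult_mono) auto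
    then show ?thesis by (simp add: absv_mult absv_power r_def mult_ac)
  qed
  define c where "c = absv (b m) * r ^ q ^ m"
  have c: "K * r * r ^ q ^ m < c" "0 \<le> K * r * r ^ q ^ m"
    using r K(1) unfolding c_def by (auto intro!: mult_strict_right_mono)
  have "c \<le> absv (\<Sum>i<N. b i * s ^ q ^ i)" if N: "m < N" for N
  proof -
    let ?t = "\<lambda>i. b i * s ^ q ^ i"
    have "sum ?t {..<N} = sum ?t {m..<N}"
      using below by (intro sum.mono_neutral_right) auto
    also have "\<dots> = ?t m + sum ?t {Suc m..<N}" using N by (simp add: sum.atLeast_Suc_lessThan)
    finally have "?t m = sum ?t {..<N} - sum ?t {Suc m..<N}" by simp
    moreover have "absv (?t m) = c" by (simp add: c_def r_def absv_mult absv_power)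
    moreover have "absv (sum ?t {Suc m..<N}) \<le> K * r * r ^ q ^ m"
      using tail c(2) by (intro absv_sum) auto
    ultimately show ?thesis using absv_diff[of "sum ?t {..<N}" "sum ?t {Suc m..<N}"] c(1) by fastforce
  qed
  moreover have "(\<lambda>N. absv (\<Sum>i<N. b i * s ^ q ^ i)) \<longlonglongrightarrow> 0"
    using lim[of s] by (simp add: abs_limit_def)
  ultimately have "c \<le> 0"
    by (intro tendsto_lowerbound[of _ 0 sequentially]) (auto intro: eventually_mono[OF eventually_gt_at_top[of m]])
  then show False using c by linarith
qed

end

locale nonarch_frobenius = nonarch_field absv for absv :: "'c::field \<Rightarrow> real" +
  fixes q :: nat
  assumes q_ge_2: "q \<ge> 2" and frob_add: "(a + b) ^ q = a ^ q + (b::'c) ^ q"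
begin

lemma frob_iter_add: "(a + b) ^ q ^ j = a ^ q ^ j + (b::'c) ^ q ^ j"
  by (induction j) (simp_all add: power_mult mult.commute[of q] frob_add)

lemma frob_iter_sum: "(sum h I) ^ q ^ j = (\<Sum>i\<in>I. (h i :: 'c) ^ q ^ j)"
  using q_ge_2 by (induction I rule: infinite_finite_induct) (simp_all add: frob_iter_add)

lemma frob_iter_diff: "(a - b) ^ q ^ j = a ^ q ^ j - (b::'c) ^ q ^ j"
  using frob_iter_add[of "a - b" b j] by simp

lemma abs_limit_frob:
  assumes "abs_limit absv s l"
  shows "abs_limit absv (\<lambda>k. s k ^ q ^ j) (l ^ q ^ j)"
proof -
  have "(\<lambda>k. absv (s k - l) ^ q ^ j) \<longlonglongrightarrow> 0 ^ q ^ j"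
    using assms unfolding abs_limit_def by (intro tendsto_intros)
  then show ?thesis using q_ge_2 by (simp add: abs_limit_def power_0_left flip: frob_iter_diff absv_power)
qed

text \<open>The \<open>N\<close>-th partial sum of the twisted series is the twist of the partial sum of index \<open>N - j\<close>.\<close>

lemma abs_limit_twisted_series:
  assumes lim: "abs_limit absv (\<lambda>N. \<Sum>i<N. b i * s ^ q ^ i) l"
  shows "abs_limit absv (\<lambda>N. \<Sum>i<N. (if j \<le> i then b (i - j) ^ q ^ j else 0) * s ^ q ^ i) (l ^ q ^ j)"
proof -
  have eq: "(\<Sum>i<N. (if j \<le> i then b (i - j) ^ q ^ j else 0) * s ^ q ^ i) = (\<Sum>i<N - j. b i * s ^ q ^ i) ^ q ^ j" for N
  proof -
    have "(\<Sum>i<N. (if j \<le> i then b (i - j) ^ q ^ j else 0) * s ^ q ^ i)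
        = (\<Sum>i\<in>{j..<N}. b (i - j) ^ q ^ j * s ^ q ^ i)"
      by (rule sum.mono_neutral_cong_right) auto
    also have "\<dots> = (\<Sum>i<N - j. b i ^ q ^ j * s ^ q ^ (i + j))"
      by (rule sum.reindex_bij_witness[of _ "\<lambda>i. i + j" "\<lambda>i. i - j"]) auto
    also have "\<dots> = (\<Sum>i<N - j. b i * s ^ q ^ i) ^ q ^ j"
      by (simp add: frob_iter_sum power_mult_distrib power_add power_mult)
    finally show ?thesis .
  qed
  have "filterlim (\<lambda>N. N - j) sequentially sequentially" by (rule filterlim_minus_const_nat_at_top)
  then have "abs_limit absv (\<lambda>N. (\<Sum>i<N - j. b i * s ^ q ^ i) ^ q ^ j) (l ^ q ^ j)"
    using filterlim_compose[of "\<lambda>N. absv ((\<Sum>i<N. b i * s ^ q ^ i) ^ q ^ j - l ^ q ^ j)" "nhds 0" sequentially "\<lambda>N. N - j"]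
      abs_limit_frob[OF lim, of j] unfolding abs_limit_def by blast
  then show ?thesis unfolding eq .
qed

text \<open>The functional equation at the vector with the single entry \<open>s\<close> in position
  \<open>m\<close> equates two series in Frobenius powers of \<open>s\<close>. Their difference sums
  to 0 for every \<open>s\<close>, so all its coefficients vanish.\<close>

lemma exponential_recursion:
  assumes expo: "is_exponential absv q n S R Q" and a: "a \<in> S" and x: "absv x > 1"
    and P: "R a \<in> carrier_mat n n" and l: "l < n" and m: "m < n"
  shows "(\<Sum>k<n. Q i $$ (l, k) * coeff (R a $$ (k, m)) 0 ^ q ^ i)
    = (\<Sum>j\<le>i. \<Sum>k<n. coeff (R a $$ (l, k)) j * Q (i - j) $$ (k, m) ^ q ^ j)"
proof -
  define L where "L i = (\<Sum>k<n. Q i $$ (l, k) * coeff (R a $$ (k, m)) 0 ^ q ^ i)" for i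
  define D where "D = (\<Sum>k<n. degree (R a $$ (l, k)))"
  \<comment> \<open>Padding by 0 for j > i gives \<open>j\<close> a range independent of
    \<open>i\<close>, so the finite sums can be exchanged with the partial sums over
    \<open>i\<close>.\<close>
  define r where "r i j k = coeff (R a $$ (l, k)) j * (if j \<le> i then Q (i - j) $$ (k, m) ^ q ^ j else 0)" for i j k
  define L' where "L' i = (\<Sum>k<n. \<Sum>j\<le>D. r i j k)" for i
  have D: "degree (R a $$ (l, k)) \<le> D" if "k < n" for k
    using member_le_sum[of k "{..<n}" "\<lambda>k. degree (R a $$ (l, k))"] that by (simp add: D_def)
  have Q: "Q i \<in> carrier_mat n n" for i using expo by (simp add: is_exponential_def)
  have mat_vec: "(Q i *\<^sub>v map_vec (\<lambda>x. x ^ q ^ i) z) $ t = (\<Sum>k<n. Q i $$ (t, k) * z $ k ^ q ^ i)"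
    if "z \<in> carrier_vec n" "t < n" for i z t
    using that Q[of i] by (auto simp: scalar_prod_def lessThan_atLeast0 intro!: sum.cong)
  have "abs_limit absv (\<lambda>N. \<Sum>i<N. (L i - L' i) * s ^ q ^ i) 0" for s
  proof -
    define z where "z = vec n (\<lambda>k. if k = m then s else 0)"
    have z: "z \<in> carrier_vec n" by (simp add: z_def)
    obtain w where w: "frob_series_sums absv q n Q z w"
      using expo z unfolding is_exponential_def by blast
    have fw: "frob_series_sums absv q n Q (tau_coeff (R a) 0 *\<^sub>v z) (tau_mat_act q n (R a) w)"
      using expo a z w unfolding is_exponential_def by blast
    have limw: "abs_limit absv (\<lambda>N. \<Sum>i<N. Q i $$ (k, m) * s ^ q ^ i) (w $ k)" if k: "k < n" for k
    proof -
      have eq: "(Q i *\<^sub>v map_vec (\<lambda>x. x ^ q ^ i) z) $ k = Q i $$ (k, m) * s ^ q ^ i" for i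
      proof -
        have "(Q i *\<^sub>v map_vec (\<lambda>x. x ^ q ^ i) z) $ k = (\<Sum>k'<n. if k' = m then Q i $$ (k, m) * s ^ q ^ i else 0)"
          unfolding mat_vec[OF z k] using q_ge_2 by (intro sum.cong refl) (auto simp: z_def)
        then show ?thesis using m by simp
      qed
      have "abs_limit absv (\<lambda>N. \<Sum>i<N. (Q i *\<^sub>v map_vec (\<lambda>x. x ^ q ^ i) z) $ k) (w $ k)"
        using w k unfolding frob_series_sums_def by blast
      then show ?thesis by (simp only: eq)
    qed
    have dz: "tau_coeff (R a) 0 *\<^sub>v z \<in> carrier_vec n" "(tau_coeff (R a) 0 *\<^sub>v z) $ k = coeff (R a $$ (k, m)) 0 * s"
      if "k < n" for k
    proof -
      have "(tau_coeff (R a) 0 *\<^sub>v z) $ k = (\<Sum>k'<n. coeff (R a $$ (k, k')) 0 * (if k' = m then s else 0))"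
        using P that by (auto simp: tau_coeff_def scalar_prod_def lessThan_atLeast0 z_def)
      also have "\<dots> = (\<Sum>k'<n. if k' = m then coeff (R a $$ (k, m)) 0 * s else 0)"
        by (intro sum.cong) auto
      finally show "(tau_coeff (R a) 0 *\<^sub>v z) $ k = coeff (R a $$ (k, m)) 0 * s" using m by simp
      show "tau_coeff (R a) 0 *\<^sub>v z \<in> carrier_vec n"
        using P by (intro mult_mat_vec_carrier[of _ n n]) (simp_all add: tau_coeff_def z)
    qed
    have eq: "(Q i *\<^sub>v map_vec (\<lambda>x. x ^ q ^ i) (tau_coeff (R a) 0 *\<^sub>v z)) $ l = L i * s ^ q ^ i" for i
      unfolding mat_vec[OF dz(1)[OF l] l] L_def
      by (simp add: dz(2) sum_distrib_right power_mult_distrib mult.assoc)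
    have "abs_limit absv (\<lambda>N. \<Sum>i<N. (Q i *\<^sub>v map_vec (\<lambda>x. x ^ q ^ i) (tau_coeff (R a) 0 *\<^sub>v z)) $ l)
        (tau_mat_act q n (R a) w $ l)"
      using fw l unfolding frob_series_sums_def by blast
    then have lim1: "abs_limit absv (\<lambda>N. \<Sum>i<N. L i * s ^ q ^ i) (tau_mat_act q n (R a) w $ l)"
      by (simp only: eq)
    have "abs_limit absv (\<lambda>N. \<Sum>k<n. \<Sum>j\<le>D. coeff (R a $$ (l, k)) j *
          (\<Sum>i<N. (if j \<le> i then Q (i - j) $$ (k, m) ^ q ^ j else 0) * s ^ q ^ i))
        (\<Sum>k<n. \<Sum>j\<le>D. coeff (R a $$ (l, k)) j * w $ k ^ q ^ j)"
      by (intro abs_limit_sum abs_limit_cmult abs_limit_twisted_series limw) simp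
    also have "(\<Sum>k<n. \<Sum>j\<le>D. coeff (R a $$ (l, k)) j * w $ k ^ q ^ j) = tau_mat_act q n (R a) w $ l"
    proof -
      have "(\<Sum>j\<le>degree (R a $$ (l, k)). coeff (R a $$ (l, k)) j * w $ k ^ q ^ j)
          = (\<Sum>j\<le>D. coeff (R a $$ (l, k)) j * w $ k ^ q ^ j)" if "k < n" for k
        using D[OF that] by (intro sum.mono_neutral_left) (auto simp: coeff_eq_0)
      then show ?thesis using l by (simp add: tau_mat_act_def)
    qed
    also have "(\<lambda>N. \<Sum>k<n. \<Sum>j\<le>D. coeff (R a $$ (l, k)) j *
          (\<Sum>i<N. (if j \<le> i then Q (i - j) $$ (k, m) ^ q ^ j else 0) * s ^ q ^ i)) = (\<lambda>N. \<Sum>i<N. L' i * s ^ q ^ i)"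
    proof
      fix N
      have "(\<Sum>i<N. L' i * s ^ q ^ i) = (\<Sum>i<N. \<Sum>k<n. \<Sum>j\<le>D. r i j k * s ^ q ^ i)"
        by (simp add: L'_def sum_distrib_right)
      also have "\<dots> = (\<Sum>k<n. \<Sum>i<N. \<Sum>j\<le>D. r i j k * s ^ q ^ i)" by (rule sum.swap)
      also have "\<dots> = (\<Sum>k<n. \<Sum>j\<le>D. \<Sum>i<N. r i j k * s ^ q ^ i)"
        by (rule sum.cong[OF refl], rule sum.swap)
      finally show "(\<Sum>k<n. \<Sum>j\<le>D. coeff (R a $$ (l, k)) j *
          (\<Sum>i<N. (if j \<le> i then Q (i - j) $$ (k, m) ^ q ^ j else 0) * s ^ q ^ i)) = (\<Sum>i<N. L' i * s ^ q ^ i)"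
        by (simp add: r_def sum_distrib_left mult.assoc)
    qed
    finally have lim2: "abs_limit absv (\<lambda>N. \<Sum>i<N. L' i * s ^ q ^ i) (tau_mat_act q n (R a) w $ l)" .
    show ?thesis
      using abs_limit_diff[OF lim1 lim2] by (simp add: left_diff_distrib sum_subtractf)
  qed
  then have "L i - L' i = 0" by (rule frobenius_series_coeffs_zero[OF q_ge_2 x])
  moreover have "L' i = (\<Sum>j\<le>i. \<Sum>k<n. coeff (R a $$ (l, k)) j * Q (i - j) $$ (k, m) ^ q ^ j)"
  proof -
    have "L' i = (\<Sum>k<n. \<Sum>j\<le>i. coeff (R a $$ (l, k)) j * Q (i - j) $$ (k, m) ^ q ^ j)"
      unfolding L'_def
    proof (rule sum.cong[OF refl])
      fix k assume "k \<in> {..<n}"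
      then have k: "degree (R a $$ (l, k)) \<le> D" using D by simp
      \<comment> \<open>Either of \<open>D\<close> and \<open>i\<close> may be the larger: terms
        beyond \<open>i\<close> vanish by the padding, terms beyond \<open>D\<close> by the degree
        bound.\<close>
      have "(\<Sum>j\<le>D. r i j k) = (\<Sum>j\<in>{..D} \<inter> {..i}. r i j k)"
        by (rule sum.mono_neutral_right) (auto simp: r_def)
      also have "\<dots> = (\<Sum>j\<le>i. r i j k)"
        using k by (intro sum.mono_neutral_left) (auto simp: r_def coeff_eq_0)
      finally show "(\<Sum>j\<le>D. r i j k) = (\<Sum>j\<le>i. coeff (R a $$ (l, k)) j * Q (i - j) $$ (k, m) ^ q ^ j)"
        by (simp add: r_def)
    qed
    also have "\<dots> = (\<Sum>j\<le>i. \<Sum>k<n. coeff (R a $$ (l, k)) j * Q (i - j) $$ (k, m) ^ q ^ j)"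
      by (rule sum.swap)
    finally show ?thesis .
  qed
  ultimately show ?thesis by (simp add: L_def)
qed

end

theorem theorem4p1:
  fixes absv :: "'c::alg_closed_field \<Rightarrow> real"
    and k H :: "'c set"
    and q n :: nat
    and E :: "'c weierstrass"
    and \<theta> \<eta> :: 'c
    and F :: "('c, 'f::field) function_field"
    and \<Xi> V :: "'c point"
    and f :: 'f
    and g :: "nat \<Rightarrow> 'f"
    and Q :: "nat \<Rightarrow> 'c mat"
  assumes "is_subfield k" and "finite k" and "q = card k"
    and "elliptic_curve_over k E"
    and "is_C_infinity absv k E \<theta> \<eta>"
    and "hilbert_class_field (base_field k \<theta> \<eta>) (K_infinity absv k \<theta> \<eta>) H"
    and "function_field_of E F"
    and "\<Xi> = Affine \<theta> \<eta>"
    and "drinfeld_point absv q E H \<Xi> V"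
    and "shtuka_function q E F H \<Xi> V f"
    and "n \<ge> 2"
    and "\<And>j. 1 \<le> j \<Longrightarrow> j \<le> n \<Longrightarrow> basis_function q E F H \<Xi> V n j (g j)"
    and "\<And>a. a \<in> regfuns F k \<Longrightarrow> \<exists>!P. tensor_relation q F H n f g a P"
    and "is_exponential absv q n (regfuns F k) (tensor_power q F H n f g) Q"
  shows "\<forall>i. (\<exists>!M. expansion_relation q F H \<Xi> n f g i M) \<and>
             Q i = C_matrix q F H \<Xi> n f g i \<and>
             (\<forall>l<n. \<forall>j<n. Q i $$ (l, j) \<in> H)"
proof -
  note k = assms(1,2) and q = assms(3) and Xi_affine = assms(8)
  have k01: "0 \<in> k" "1 \<in> k" using is_subfieldD[OF k(1)] by auto
  then have "card {0, 1 :: 'c} \<le> card k" using k(2) by (intro card_mono) auto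
  then have q2: "q \<ge> 2" by (simp add: q)
  have wc: "wc_in k E" using assms(4) by (simp add: elliptic_curve_over_def wc_in_def)
  have abs: "nonarch_abs absv" and on: "on_curve E (Affine \<theta> \<eta>)"
    and absA: "\<And>p. p \<noteq> (0, 0) \<Longrightarrow> coeffs_in k p \<Longrightarrow> absv (pf_value p \<theta> \<eta>) = real (card k) ^ pf_deg p"
    using assms(5) unfolding is_C_infinity_def by blast+
  have H: "is_subfield H" "base_field k \<theta> \<eta> \<subseteq> H"
    using assms(6) unfolding hilbert_class_field_def finite_abelian_ext_def by blast+
  have kH: "k \<union> {\<theta>, \<eta>} \<subseteq> H"
    using H(2) field_gen_superset[of "k \<union> {\<theta>, \<eta>}"] unfolding base_field_def by blast
  interpret nonarch_frobenius absv q
    by unfold_locales (use abs q2 in \<open>simp_all add: q frobenius_add[OF k]\<close>)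
  have pk: "a ^ q = a" if "a \<in> k" for a using power_card_subfield[OF k that] by (simp add: q)
  interpret frobenius_curve E F q
    by unfold_locales
      (use assms(4,7) q2 wc in \<open>auto simp: elliptic_curve_over_def wc_in_def frob_add pk\<close>)
  \<comment> \<open>The function t has degree 2, so |\<theta>| = q^2. This shows that \<theta> is
    fixed by no positive iterate of the q-th power map, and \<theta> also serves as the element of
    absolute value above 1 for the series argument.\<close>
  have "absv (pf_value ([:0, 1:], 0) \<theta> \<eta>) = real q ^ pf_deg ([:0, 1 :: 'c:], 0 :: 'c poly)"
    unfolding q using k01 by (intro absA) (simp_all add: coeffs_in_iff poly_in_ring[OF k(1)])
  then have abs_theta: "absv \<theta> = real q ^ 2" by (simp add: pf_value_def pf_deg_def)
  have theta1: "absv \<theta> > 1" unfolding abs_theta using q2 by (simp add: one_less_power)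
  have theta: "\<theta> ^ q ^ m \<noteq> \<theta>" if "m > 0" for m
  proof
    assume "\<theta> ^ q ^ m = \<theta>"
    then have "absv \<theta> ^ q ^ m = absv \<theta> ^ 1" by (simp flip: absv_power)
    then have "q ^ m = 1" using theta1 by (simp only: power_inject_exp)
    then show False using q2 that by simp
  qed
  have TY: "a \<in> regfuns F k" if "a \<in> {T, Y}" for a
  proof -
    have "coeffs_in k ([:0, 1:], 0)" "coeffs_in k (0, 1)"
      using k01 poly_in_ring[OF k(1)] by (simp_all add: coeffs_in_iff)
    then show ?thesis using that ev_T ev_Y unfolding regfuns_def by force
  qed
  have V: "aff V" using assms(9) by (auto simp: drinfeld_point_def aff_def)
  \<comment> \<open>The last point in the divisor of g_j for j = i + 1, where j - 1 = i and n - j +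
    1 = n - i.\<close>
  define R where "R i = ec_add E (ec_mult E i (frob_point q V)) (ec_mult E (n - i) V)" for i
  have g: "g (Suc i) \<in> ratfuns F H \<and> has_divisor E F (g (Suc i))
      (dmult (- int n) V + dmult (int n - int (Suc i)) Infinity + dmult (int i) (Affine \<theta> \<eta>) + pt (R i))"
    if "i < n" for i
  proof -
    have "n - Suc i + 1 = n - i" using that by simp
    then show ?thesis using assms(12)[of "Suc i"] that by (simp add: basis_function_def Xi_affine R_def)
  qed
  interpret tensor_setup E F q H \<theta> \<eta> V R f g n
  proof unfold_locales
    show "is_subfield H" by (rule H(1))
    show "wc_in H E" using wc kH by (auto simp: wc_in_def)
    show "\<theta> \<in> H" "\<eta> \<in> H" using kH by auto
    show "on_curve E (Affine \<theta> \<eta>)" by (rule on)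
    show "\<theta> ^ q ^ m \<noteq> \<theta>" if "m > 0" for m by (rule theta[OF that])
    show "aff V" by (rule V)
    show "f \<in> ratfuns F H" "has_divisor E F f (pt (fp V) - pt V + pt (Affine \<theta> \<eta>) - pt Infinity)"
      using assms(10) by (simp_all add: shtuka_function_def Xi_affine)
    show "n \<ge> 2" by (rule assms(11))
    show "g (Suc i) \<in> ratfuns F H" if "i < n" for i using g[OF that] by (rule conjunct1)
    show "has_divisor E F (g (Suc i))
      (dmult (- int n) V + dmult (int n - int (Suc i)) Infinity + dmult (int i) (Affine \<theta> \<eta>) + pt (R i))"
      if "i < n" for i using g[OF that] by (rule conjunct2)
    show "\<exists>!P. tensor_relation q F H n f g a P" if "a \<in> {T, Y}" for a
      by (rule assms(13)[OF TY[OF that]])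
  qed
  have Tk: "T \<in> regfuns F k" by (rule TY) simp
  have Q: "Q i \<in> carrier_mat n n" "Q 0 = 1\<^sub>m n" for i
    using assms(14) by (simp_all add: is_exponential_def)
  have CM: "C_matrix q F H \<Xi> n f g i \<in> carrier_mat n n" for i
    using C_matrix_relation[of i] unfolding Xi_affine expansion_relation_def by blast
  have QC: "Q i $$ (l, j) = C i l j" if "l < n" "j < n" for i l j
  proof (rule recursion_unique[OF _ _ that])
    show "Q 0 $$ (l, m) = (if l = m then 1 else 0)" if "l < n" "m < n" for l m
      using that by (simp add: Q)
    show "(\<Sum>k<n. Q i $$ (l, k) * A 0 k m ^ q ^ i) = (\<Sum>j\<le>i. \<Sum>k<n. A j l k * Q (i - j) $$ (k, m) ^ q ^ j)"
      if "l < n" "m < n" for i l m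
      unfolding A_def P_def
    proof (rule exponential_recursion[OF assms(14) Tk theta1 _ that])
      show "tensor_power q F H n f g T \<in> carrier_mat n n"
        using P_relation by (simp add: P_def tensor_relation_def)
    qed
  qed
  show ?thesis
  proof (intro allI conjI impI)
    fix i
    show "\<exists>!M. expansion_relation q F H \<Xi> n f g i M" unfolding Xi_affine by (rule expansion_ex1)
    show "Q i = C_matrix q F H \<Xi> n f g i"
      by (rule eq_matI) (use Q(1)[of i] CM[of i] QC in \<open>auto simp: C_def Xi_affine\<close>)
    show "Q i $$ (l, j) \<in> H" if "l < n" "j < n" for l j using QC[OF that] C_in[OF that] by simp
  qed
qed

end
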